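(* Let $E\subset\mathbb{R}^d$ be a non-planar Galton–Watson fractal with respect to a similarity IFS $\Phi=\{\varphi_i\}_{i\in\Lambda}$ and offspring distribution $W$. Then almost surely, conditioned on nonextinction, $E$ contains a hyperplane diffuse subset. Moreover, if $\Phi$ satisfies the open set condition, then almost surely, conditioned on nonextinction, $E$ contains a sequence of subsets $(D_n)_{n\in\mathbb{N}}$ such that each $D_n\subseteq E$ is hyperplane diffuse and Ahlfors-regular, and $\dim_H(D_n)$ increases to $\dim_H(E)$.
   Context: A similarity IFS is a finite family $\Phi=\{\varphi_i\}_{i\in\Lambda}$ of contracting similarities $\varphi_i$ of $\mathbb{R}^d$ (ratios $r_i\in(0,1)$), with attractor $K$ (unique nonempty compact set with $K=\bigcup_i\varphi_iK$). For $i=i_1\dots i_n\in\Lambda^*$, $\varphi_i=\varphi_{i_1}\circ\dots\circ\varphi_{i_n}$; the coding map $\gamma_\Phi:\Lambda^{\mathbb{N}}\to\mathbb{R}^d$ sends $j$ to the point of $\bigcap_n\varphi_{j_1\dots j_n}(K)$. A tree with alphabet $\Lambda$ is a prefix-closed $T\subseteq\Lambda^*$ containing the empty word; $T_n=T\cap\Lambda^n$, $\partial T=\{j\in\Lambda^{\mathbb{N}}: j_1\dots j_n\in T\ \forall n\}$. For a random subset $W\subseteq\Lambda$ with $\mathbb{P}(i\in W)>0$ for all $i$ and $\mathbb{E}|W|>1$, the Galton–Watson tree $T$ is $T_0=\{\emptyset\}$, $T_n=\{aj:a\in T_{n-1},j\in W_a\}$ with $(W_a)$ independent copies of $W$; nonextinction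 means all $T_n\ne\emptyset$. The Galton–Watson fractal is $E=\gamma_\Phi(\partial T)$; it is non-planar if it is not a.s. contained in an affine hyperplane. Open set condition: a nonempty open $U$ with $\varphi_iU\subseteq U$ and $\varphi_iU\cap\varphi_jU=\emptyset$ for $i\ne j$. A closed set $K'\subseteq\mathbb{R}^d$ is hyperplane $\beta$-diffuse if there is $\xi_0>0$ such that for all $\xi\in(0,\xi_0)$, $x\in K'$ and affine hyperplanes $\mathcal{L}$, $K'\cap B_\xi(x)\setminus\mathcal{L}^{(\beta\xi)}\neq\emptyset$ ($\mathcal{L}^{(\varepsilon)}$ the open $\varepsilon$-neighborhood); hyperplane diffuse means hyperplane $\beta$-diffuse for some $\beta>0$. A set is $\delta$-Ahlfors-regular if it is the support of a measure $\mu$ with $c_1\rho^\delta\le\mu(B_\rho(x))\le c_2\rho^\delta$ for all $\rho\in(0,1)$ and $x\in\operatorname{supp}\mu$ (constants $c_1,c_2>0$); Ahlfors-regular means $\delta$-Ahlfors-regular for some $\delta>0$. *)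

theory Defs
  imports "HOL-Analysis.Analysis" "HOL-Probability.Probability"
begin

definition contracting_similarity :: "('a::euclidean_space \<Rightarrow> 'a) \<Rightarrow> bool" where
  "contracting_similarity f \<longleftrightarrow>
     (\<exists>r. 0 < r \<and> r < 1 \<and> (\<forall>x y. dist (f x) (f y) = r * dist x y))"

definition similarity_ifs :: "('i::finite \<Rightarrow> 'a::euclidean_space \<Rightarrow> 'a) \<Rightarrow> bool" where
  "similarity_ifs \<phi> \<longleftrightarrow> (\<forall>i. contracting_similarity (\<phi> i))"

definition ifs_attractor :: "('i::finite \<Rightarrow> 'a::euclidean_space \<Rightarrow> 'a) \<Rightarrow> 'a set" where
  "ifs_attractor \<phi> = (THE K. K \<noteq> {} \<and> compact K \<and> K = (\<Union>i. \<phi> i ` K))"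

definition word_map :: "('i \<Rightarrow> 'a \<Rightarrow> 'a) \<Rightarrow> 'i list \<Rightarrow> 'a \<Rightarrow> 'a" where
  "word_map \<phi> w = foldr (\<lambda>i f. \<phi> i \<circ> f) w id"

definition prefix_word :: "(nat \<Rightarrow> 'i) \<Rightarrow> nat \<Rightarrow> 'i list" where
  "prefix_word j n = map j [0..<n]"

definition coding_map :: "('i::finite \<Rightarrow> 'a::euclidean_space \<Rightarrow> 'a) \<Rightarrow> (nat \<Rightarrow> 'i) \<Rightarrow> 'a" where
  "coding_map \<phi> j =
     (THE x. x \<in> (\<Inter>n. word_map \<phi> (prefix_word j n) ` ifs_attractor \<phi>))"

definition open_set_condition :: "('i::finite \<Rightarrow> 'a::euclidean_space \<Rightarrow> 'a) \<Rightarrow> bool" where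
  "open_set_condition \<phi> \<longleftrightarrow>
     (\<exists>U. open U \<and> U \<noteq> {} \<and> (\<forall>i. \<phi> i ` U \<subseteq> U) \<and>
          (\<forall>i j. i \<noteq> j \<longrightarrow> \<phi> i ` U \<inter> \<phi> j ` U = {}))"

text \<open>A sample point omega assigns to every word a (a node) its offspring set W_a.
  The probability space is the product of countably many independent copies of the
  law of W (a probability distribution on subsets of the alphabet).\<close>

definition gw_space :: "'i set pmf \<Rightarrow> ('i list \<Rightarrow> 'i set) measure" where
  "gw_space W = PiM UNIV (\<lambda>_. measure_pmf W)"

fun gw_level :: "('i list \<Rightarrow> 'i set) \<Rightarrow> nat \<Rightarrow> 'i list set" where
  "gw_level \<omega> 0 = {[]}"
| "gw_level \<omega> (Suc n) = {a @ [j] | a j. a \<in> gw_level \<omega> n \<and> j \<in> \<omega> a}"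

definition gw_tree :: "('i list \<Rightarrow> 'i set) \<Rightarrow> 'i list set" where
  "gw_tree \<omega> = (\<Union>n. gw_level \<omega> n)"

definition tree_boundary :: "'i list set \<Rightarrow> (nat \<Rightarrow> 'i) set" where
  "tree_boundary T = {j. \<forall>n. prefix_word j n \<in> T}"

definition nonextinct :: "('i list \<Rightarrow> 'i set) \<Rightarrow> bool" where
  "nonextinct \<omega> \<longleftrightarrow> (\<forall>n. gw_level \<omega> n \<noteq> {})"

definition gw_fractal ::
  "('i::finite \<Rightarrow> 'a::euclidean_space \<Rightarrow> 'a) \<Rightarrow> ('i list \<Rightarrow> 'i set) \<Rightarrow> 'a set" where
  "gw_fractal \<phi> \<omega> = coding_map \<phi> ` tree_boundary (gw_tree \<omega>)"

definition admissible_offspring :: "'i::finite set pmf \<Rightarrow> bool" where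
  "admissible_offspring W \<longleftrightarrow>
     (\<forall>i. measure_pmf.prob W {S. i \<in> S} > 0) \<and>
     measure_pmf.expectation W (\<lambda>S. real (card S)) > 1"

definition affine_hyperplanes :: "'a::euclidean_space set set" where
  "affine_hyperplanes = {{x. a \<bullet> x = b} | a b. a \<noteq> 0}"

definition open_nbhd :: "'a::metric_space set \<Rightarrow> real \<Rightarrow> 'a set" where
  "open_nbhd L e = {x. \<exists>y\<in>L. dist x y < e}"

definition non_planar :: "'i::finite set pmf \<Rightarrow> ('i \<Rightarrow> 'a::euclidean_space \<Rightarrow> 'a) \<Rightarrow> bool" where
  "non_planar W \<phi> \<longleftrightarrow>
     \<not> (\<exists>L\<in>affine_hyperplanes. AE \<omega> in gw_space W. gw_fractal \<phi> \<omega> \<subseteq> L)"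

definition hyperplane_beta_diffuse :: "real \<Rightarrow> 'a::euclidean_space set \<Rightarrow> bool" where
  "hyperplane_beta_diffuse \<beta> K \<longleftrightarrow> closed K \<and>
     (\<exists>\<xi>0>0. \<forall>\<xi>. 0 < \<xi> \<and> \<xi> < \<xi>0 \<longrightarrow> (\<forall>x\<in>K. \<forall>L\<in>affine_hyperplanes.
        K \<inter> ball x \<xi> - open_nbhd L (\<beta> * \<xi>) \<noteq> {}))"

definition hyperplane_diffuse :: "'a::euclidean_space set \<Rightarrow> bool" where
  "hyperplane_diffuse K \<longleftrightarrow> (\<exists>\<beta>>0. hyperplane_beta_diffuse \<beta> K)"

definition measure_support :: "'a::metric_space measure \<Rightarrow> 'a set" where
  "measure_support \<mu> = {x. \<forall>e>0. emeasure \<mu> (ball x e) > 0}"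

definition ahlfors_regular_dim :: "real \<Rightarrow> 'a::euclidean_space set \<Rightarrow> bool" where
  "ahlfors_regular_dim \<delta> D \<longleftrightarrow>
     (\<exists>\<mu> c1 c2. sets \<mu> = sets borel \<and> measure_support \<mu> = D \<and> c1 > 0 \<and> c2 > 0 \<and>
        (\<forall>\<rho> x. 0 < \<rho> \<and> \<rho> < 1 \<and> x \<in> measure_support \<mu> \<longrightarrow>
           ennreal (c1 * \<rho> powr \<delta>) \<le> emeasure \<mu> (ball x \<rho>) \<and>
           emeasure \<mu> (ball x \<rho>) \<le> ennreal (c2 * \<rho> powr \<delta>)))"

definition ahlfors_regular :: "'a::euclidean_space set \<Rightarrow> bool" where
  "ahlfors_regular D \<longleftrightarrow> (\<exists>\<delta>>0. ahlfors_regular_dim \<delta> D)"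

definition hausdorff_pre :: "real \<Rightarrow> real \<Rightarrow> 'a::metric_space set \<Rightarrow> ennreal" where
  "hausdorff_pre s \<delta> A =
     (INF U \<in> {U :: nat \<Rightarrow> 'a set. A \<subseteq> (\<Union>i. U i) \<and>
                 (\<forall>i. bounded (U i) \<and> diameter (U i) \<le> \<delta>)}.
        \<Sum>i. ennreal (diameter (U i) powr s))"

definition hausdorff_measure :: "real \<Rightarrow> 'a::metric_space set \<Rightarrow> ennreal" where
  "hausdorff_measure s A = (SUP \<delta>\<in>{0<..}. hausdorff_pre s \<delta> A)"

definition hausdorff_dim :: "'a::metric_space set \<Rightarrow> real" where
  "hausdorff_dim A = Inf {s. s \<ge> 0 \<and> hausdorff_measure s A = 0}"

end

(* Let r i be the contraction ratios. Some finite pattern of the tree, of positive probability,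
   contains finitely many words such that every affine hyperplane stays at a definite distance from
   the cylinder of one of them: grafting any tree leaving the affine hull onto a fresh branch raises
   the dimension spanned, so points of E span the space with positive probability.
   Fix s > 0 with E sum_{i in W} (r i)^s > 1. By the second moment method the s-weighted size of the
   n-th generation, thinned by an event G, exceeds any bound with probability at least kappa, where
   kappa does not depend on P(G). Iterating "the pattern occurs, and below each of its words the
   weight of the vertices with a good subtree is large" therefore has a limit event G of positive
   probability, and a tree in G contains a subtree in which every block of N letters offers both a
   transversal family and s-weight at least 1. Convexity of the generating function shows that a
   surviving tree almost surely has a vertex whose subtree lies in G.
   Inside such a tree one selects children block by block, keeping mass / ratio^s between two
   constants: a word whose accumulated correction is m in [1,2] keeps children of total s-weight in
   [m/2, m], which puts the corrections of the children in [1,2] again. The limit set is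
   hyperplane diffuse by transversality and, under the open set condition, s-Ahlfors-regular.
   Letting s tend to the root alpha of E sum_{i in W} (r i)^alpha = 1 exhausts dim E, since the
   first moment bounds dim E by alpha. *)
theory Submission
  imports Defs
begin

subsection \<open>Similarity systems and their attractor\<close>

text \<open>The iteration behind the limit event would fail if each round lost a factor of
  probability. The order of choices prevents this. With l the mean weight, P the probability of G
  and A < l^2 the mean of the squared weights, generation n thinned by G has mean P l^n and second
  moment at most P A^n + C P^2 l^(2n). Once n is large in terms of a lower bound p for P, the first
  term is at most P^2 l^(2n), so P cancels and \<open>\<kappa>\<close> = 1/(4(1+C)) is known before
  p. One can then fix p from \<open>\<kappa>\<close> and the pattern, and only afterwards n, so that
  a round sends events of probability at least p to events of probability at least p. The
  transversal family has to survive the discarding of children. Its cardinality is bounded while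
  words become light as N grows, so its weight drops to at most 1/2, the smallest lower end of the
  windows [m/2, m]. The natural measure is realised as the law of the limit point of a path that
  follows independent random choices made at all words. Its cylinder masses then come from product
  measure, and the lower dimension bound from the mass distribution principle.\<close>

lemma word_map_Nil [simp]: "word_map \<phi> [] = id"
  and word_map_Cons: "word_map \<phi> (i # w) = \<phi> i \<circ> word_map \<phi> w"
  by (simp_all add: word_map_def)

lemma word_map_append: "word_map \<phi> (v @ w) = word_map \<phi> v \<circ> word_map \<phi> w"
  by (induction v) (simp_all add: word_map_Cons comp_assoc)

lemma length_prefix_word [simp]: "length (prefix_word j n) = n"
  by (simp add: prefix_word_def)

lemma prefix_word_0 [simp]: "prefix_word j 0 = []"
  by (simp add: prefix_word_def)

lemma prefix_word_Suc: "prefix_word j (Suc n) = prefix_word j n @ [j n]"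
  by (simp add: prefix_word_def)

lemma prefix_word_Suc_case: "prefix_word (case_nat i j) (Suc n) = i # prefix_word j n"
proof -
  have "map (case_nat i j) [0..<Suc n] = i # map j [0..<n]"
    by (simp add: upt_conv_Cons map_Suc_upt[symmetric] comp_def del: upt_Suc)
  then show ?thesis by (simp add: prefix_word_def del: upt_Suc)
qed

lemma take_prefix_word: "m \<le> n \<Longrightarrow> take m (prefix_word j n) = prefix_word j m"
  by (simp add: prefix_word_def take_map)

lemma finite_words_length [simp]: "finite {w :: 'i::finite list. length w = n}"
  using finite_lists_length_eq[of "UNIV :: 'i set" n] by simp

lemma ex_hyperplane: "\<exists>L :: 'a::euclidean_space set. L \<in> affine_hyperplanes"
  using nonzero_Basis[OF SOME_Basis] by (auto simp: affine_hyperplanes_def)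

locale similarity_system =
  fixes \<phi> :: "'i::finite \<Rightarrow> 'a::euclidean_space \<Rightarrow> 'a" and r :: "'i \<Rightarrow> real"
  assumes dist_phi: "dist (\<phi> i x) (\<phi> i y) = r i * dist x y"
    and r_pos: "0 < r i" and r_less_1: "r i < 1"
begin

definition ratio :: "'i list \<Rightarrow> real" where
  "ratio w = prod_list (map r w)"

lemma ratio_simps [simp]: "ratio [] = 1" "ratio (i # w) = r i * ratio w"
    "ratio (v @ w) = ratio v * ratio w"
  by (simp_all add: ratio_def)

lemma ratio_pos [simp]: "0 < ratio w"
  by (induction w) (simp_all add: r_pos)

lemma ratio_nonneg [simp]: "0 \<le> ratio w"
  using ratio_pos[of w] by linarith

lemma ratio_nonzero [simp]: "ratio w \<noteq> 0"
  using ratio_pos[of w] by linarith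

definition rmax :: real where "rmax = Max (range r)"
definition rmin :: real where "rmin = Min (range r)"

lemma r_le_rmax: "r i \<le> rmax" and rmin_le_r: "rmin \<le> r i"
  by (simp_all add: rmax_def rmin_def)

lemma rmax_less_1: "rmax < 1"
  by (simp add: rmax_def r_less_1)

lemma rmin_pos: "0 < rmin"
  by (simp add: rmin_def r_pos)

lemma rmax_pos: "0 < rmax"
  using r_pos r_le_rmax by (rule less_le_trans)

lemma ratio_le_rmax: "ratio w \<le> rmax ^ length w"
  by (induction w) (auto intro!: mult_mono simp: r_le_rmax rmax_pos less_imp_le)

lemma rmin_le_ratio: "rmin ^ length w \<le> ratio w"
  by (induction w) (auto intro!: mult_mono simp: rmin_le_r rmin_pos r_pos less_imp_le)

lemma dist_word_map: "dist (word_map \<phi> w x) (word_map \<phi> w y) = ratio w * dist x y"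
  by (induction w) (simp_all add: word_map_Cons dist_phi)

lemma inj_phi: "inj (\<phi> i)"
proof (rule injI)
  fix x y assume "\<phi> i x = \<phi> i y"
  then have "r i * dist x y = 0" using dist_phi[of i x y] by simp
  then show "x = y" using r_pos[of i] by simp
qed

lemma continuous_on_word_map [continuous_intros]: "continuous_on S (word_map \<phi> w)"
proof -
  have "(ratio w)-lipschitz_on S (word_map \<phi> w)"
    by (rule lipschitz_onI) (simp_all add: dist_word_map)
  then show ?thesis by (rule lipschitz_on_continuous_on)
qed

lemma continuous_on_phi: "continuous_on S (\<phi> i)"
  using continuous_on_word_map[of S "[i]"] by (simp add: word_map_Cons)

text \<open>Subtracting the image of the origin and dividing by the ratio leaves an isometry fixing
  0, hence an orthogonal map. Surjectivity, preimages of hyperplanes and affine dimensions of images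
  are read off this form.\<close>

lemma word_map_affine:
  obtains f c where "orthogonal_transformation f" "\<And>x. word_map \<phi> w x = ratio w *\<^sub>R f x + c"
proof
  let ?f = "\<lambda>x. (word_map \<phi> w x - word_map \<phi> w 0) /\<^sub>R ratio w"
  have "dist (?f x) (?f y) = dist x y" for x y
  proof -
    have "?f x - ?f y = (word_map \<phi> w x - word_map \<phi> w y) /\<^sub>R ratio w"
      by (simp add: scaleR_diff_right)
    then have "dist (?f x) (?f y) = dist (word_map \<phi> w x) (word_map \<phi> w y) / ratio w"
      by (simp add: dist_norm divide_inverse mult.commute)
    then show ?thesis by (simp add: dist_word_map)
  qed
  then show "orthogonal_transformation ?f"
    unfolding orthogonal_transformation_isometry by simp
qed simp

lemma surj_word_map: "surj (word_map \<phi> w)"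
proof -
  obtain f c where f: "orthogonal_transformation f" "\<And>x. word_map \<phi> w x = ratio w *\<^sub>R f x + c"
    using word_map_affine by blast
  have "\<exists>x. y = word_map \<phi> w x" for y
  proof -
    obtain x where "f x = (y - c) /\<^sub>R ratio w"
      using orthogonal_transformation_surj[OF f(1)] by (metis surjD)
    then show ?thesis by (intro exI[of _ x]) (simp add: f(2))
  qed
  then show ?thesis by (auto simp: surj_def)
qed

text \<open>Since rescaling a cylinder to unit size carries hyperplanes to hyperplanes, one
  transversality constant at unit size serves all cylinders. The new normal is the preimage of the
  old one under the orthogonal part, whose adjoint is its inverse.\<close>

lemma vimage_word_map_hyperplane:
  assumes "L \<in> affine_hyperplanes"
  shows "word_map \<phi> w -` L \<in> affine_hyperplanes"
proof -
  obtain a b where L: "L = {x. a \<bullet> x = b}" "a \<noteq> 0"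
    using assms by (auto simp: affine_hyperplanes_def)
  obtain f c where f: "orthogonal_transformation f" "\<And>x. word_map \<phi> w x = ratio w *\<^sub>R f x + c"
    using word_map_affine by blast
  obtain a' where a': "f a' = a"
    using orthogonal_transformation_surj[OF f(1)] by (metis surjD)
  have "a \<bullet> f x = a' \<bullet> x" for x
    using f(1) by (simp add: a'[symmetric] orthogonal_transformation_def)
  then have "word_map \<phi> w -` L = {x. a' \<bullet> x = (b - a \<bullet> c) / ratio w}"
    by (auto simp: L(1) f(2) inner_add_right field_simps)
  moreover have "a' \<noteq> 0"
    using a' L(2) f(1) by (metis linear_0 orthogonal_transformation_linear)
  ultimately show ?thesis
    by (auto simp: affine_hyperplanes_def)
qed

lemma word_map_ball: "ball (word_map \<phi> w z) (ratio w * e) \<subseteq> word_map \<phi> w ` ball z e"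
proof
  fix y assume y: "y \<in> ball (word_map \<phi> w z) (ratio w * e)"
  obtain x where "word_map \<phi> w x = y" using surj_word_map by (metis surjD)
  moreover from this y have "dist z x < e"
    using dist_word_map[of w z x] by simp
  ultimately show "y \<in> word_map \<phi> w ` ball z e" by auto
qed

lemma aff_dim_word_map: "aff_dim (word_map \<phi> w ` S) = aff_dim S"
proof -
  obtain f c where f: "orthogonal_transformation f" "\<And>x. word_map \<phi> w x = ratio w *\<^sub>R f x + c"
    using word_map_affine by blast
  let ?g = "\<lambda>x. ratio w *\<^sub>R f x"
  have lin: "linear ?g"
    using f(1) by (intro linear_compose_scale_right) (rule orthogonal_transformation_linear)
  have inj: "inj ?g"
    using orthogonal_transformation_inj[OF f(1)] by (auto simp: inj_def)
  have "word_map \<phi> w ` S = (+) c ` (?g ` S)"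
    by (auto simp: f(2) image_image add.commute)
  then show ?thesis
    using aff_dim_injective_linear_image[OF lin inj] by (simp add: aff_dim_translation_eq)
qed

section \<open>Existence and uniqueness of the attractor\<close>

definition invariant :: "'a set \<Rightarrow> bool" where
  "invariant K \<longleftrightarrow> K \<noteq> {} \<and> compact K \<and> K = (\<Union>i. \<phi> i ` K)"

text \<open>The point of \<open>K\<close> farthest from \<open>K'\<close> is the image under some
  \<open>\<phi> i\<close> of a point of \<open>K\<close>, and \<open>\<phi> i\<close> maps
  \<open>K'\<close> into itself. So the largest distance is at most \<open>r i\<close> times itself,
  hence 0. Used in both directions this gives uniqueness.\<close>

lemma invariant_subset:
  assumes "invariant K" "invariant K'"
  shows "K \<subseteq> K'"
proof -
  have K: "compact K" "K \<noteq> {}" "K = (\<Union>i. \<phi> i ` K)"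
    and K': "compact K'" "K' \<noteq> {}" "K' = (\<Union>i. \<phi> i ` K')"
    using assms by (auto simp: invariant_def)
  obtain x where x: "x \<in> K" "\<And>y. y \<in> K \<Longrightarrow> infdist y K' \<le> infdist x K'"
    using continuous_attains_sup[OF K(1,2) continuous_on_infdist[OF continuous_on_id], of K']
    by blast
  obtain i y where y: "x = \<phi> i y" "y \<in> K" using K(3) x(1) by blast
  obtain z where z: "z \<in> K'" "infdist y K' = dist y z"
    using infdist_attains_inf[OF compact_imp_closed[OF K'(1)] K'(2)] by metis
  have "\<phi> i z \<in> K'" using K'(3) z(1) by blast
  then have "infdist x K' \<le> dist x (\<phi> i z)" by (rule infdist_le)
  also have "\<dots> = r i * infdist y K'" by (simp add: y dist_phi z)
  also have "\<dots> \<le> r i * infdist x K'" using x(2)[OF y(2)] r_pos[of i] by simp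
  finally have "infdist x K' * (1 - r i) \<le> 0" by (simp add: algebra_simps)
  then have "infdist x K' \<le> 0" using r_less_1[of i] by (simp add: mult_le_0_iff)
  then have "infdist y K' = 0" if "y \<in> K" for y
    using x(2)[OF that] infdist_nonneg[of y K'] by linarith
  then show ?thesis
    using in_closed_iff_infdist_zero[OF compact_imp_closed[OF K'(1)] K'(2)] by blast
qed

text \<open>The attractor is the intersection of the decreasing images of a ball that every map
  sends into itself. Its radius R solves R = rmax * R + M, where M bounds the displacement of the
  origin.\<close>

lemma ex_invariant: "\<exists>K. invariant K"
proof -
  define M where "M = Max (range (\<lambda>i. norm (\<phi> i 0)))"
  have M: "norm (\<phi> i 0) \<le> M" for i by (simp add: M_def)
  define B where "B = cball (0::'a) (M / (1 - rmax))"
  have pos: "1 - rmax > 0" using rmax_less_1 by simp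
  have "0 \<le> M" by (rule order_trans[OF norm_ge_zero M[of undefined]])
  then have R0: "0 \<le> M / (1 - rmax)" using pos by simp
  have B: "\<phi> i ` B \<subseteq> B" for i
  proof
    fix y assume "y \<in> \<phi> i ` B"
    then obtain x where x: "y = \<phi> i x" "norm x \<le> M / (1 - rmax)" by (auto simp: B_def)
    have "norm y \<le> dist (\<phi> i x) (\<phi> i 0) + norm (\<phi> i 0)"
      unfolding x dist_norm by (metis diff_add_cancel norm_triangle_ineq)
    also have "\<dots> \<le> rmax * (M / (1 - rmax)) + M"
      unfolding dist_phi using x M[of i] r_le_rmax[of i] rmax_pos r_pos[of i]
      by (intro add_mono mult_mono) (auto simp: less_imp_le)
    also have "\<dots> = M / (1 - rmax)" using pos by (simp add: field_simps)
    finally show "y \<in> B" by (simp add: B_def)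
  qed
  define F where "F = (\<lambda>n. ((\<lambda>S. \<Union>i. \<phi> i ` S) ^^ n) B)"
  have FS: "F (Suc n) = (\<Union>i. \<phi> i ` F n)" for n by (simp add: F_def)
  have F0: "F 0 = B" by (simp add: F_def)
  have cpt: "compact (F n)" for n
    by (induction n) (auto simp: F0 FS B_def intro!: compact_UN compact_continuous_image continuous_on_phi)
  have ne: "F n \<noteq> {}" for n
    by (induction n) (use R0 in \<open>auto simp: F0 FS B_def\<close>)
  have step: "F (Suc n) \<subseteq> F n" for n
  proof (induction n)
    case 0 then show ?case using B by (auto simp: FS F0)
  next
    case (Suc n) then show ?case unfolding FS[of "Suc n"] FS[of n] by blast
  qed
  have mono: "m \<le> n \<Longrightarrow> F n \<subseteq> F m" for m n
    using step by (rule lift_Suc_antimono_le)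
  define K where "K = (\<Inter>n. F n)"
  have "K \<noteq> {}" unfolding K_def using cpt ne mono by (rule compact_nest)
  moreover have "compact K" unfolding K_def using cpt by (intro compact_Inter) auto
  moreover have "K = (\<Union>i. \<phi> i ` K)"
  proof
    show "(\<Union>i. \<phi> i ` K) \<subseteq> K"
    proof
      fix x assume "x \<in> (\<Union>i. \<phi> i ` K)"
      then have "x \<in> F (Suc n)" for n by (auto simp: FS K_def)
      then have "x \<in> F n" for n using step by blast
      then show "x \<in> K" by (simp add: K_def)
    qed
    show "K \<subseteq> (\<Union>i. \<phi> i ` K)"
    proof
      fix x assume "x \<in> K"
      then have "x \<in> F (Suc n)" for n by (simp add: K_def)
      then have "\<exists>i. x \<in> \<phi> i ` F n" for n
        unfolding FS by blast
      then obtain g where g: "\<And>n. x \<in> \<phi> (g n) ` F n" by metis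
      \<comment> \<open>The letter \<open>g n\<close> with \<open>x\<close> in its image of
        \<open>F n\<close> may vary with \<open>n\<close>. Some letter occurs infinitely often, and
        as the sets \<open>F n\<close> decrease, this letter then works for every
        \<open>n\<close>.\<close>
      have "\<exists>i. infinite (g -` {i})"
      proof (rule ccontr)
        assume "\<not> ?thesis"
        then have "finite (\<Union>i. g -` {i})" by (intro finite_UN_I) auto
        moreover have "(\<Union>i. g -` {i}) = UNIV" by auto
        ultimately show False by simp
      qed
      then obtain i where i: "infinite (g -` {i})" by blast
      have "x \<in> \<phi> i ` F n" for n
      proof -
        obtain m where "m \<ge> n" "m \<in> g -` {i}" using i by (meson infinite_nat_iff_unbounded_le)
        then show ?thesis using g[of m] mono[of n m] by auto
      qed
      then have "x \<in> \<phi> i ` K"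
        unfolding K_def using image_INT[OF inj_phi[of i], of UNIV F] by auto
      then show "x \<in> (\<Union>i. \<phi> i ` K)" by blast
    qed
  qed
  ultimately show ?thesis unfolding invariant_def by blast
qed

definition K :: "'a set" where "K = ifs_attractor \<phi>"

lemma invariant_K: "invariant K"
proof -
  obtain K0 where K0: "invariant K0" using ex_invariant by blast
  have "K = K0"
    unfolding K_def ifs_attractor_def invariant_def[symmetric]
    using K0 invariant_subset by (intro the_equality) blast+
  with K0 show ?thesis by simp
qed

abbreviation cyl :: "'i list \<Rightarrow> 'a set" where
  "cyl w \<equiv> word_map \<phi> w ` K"

lemma K_nonempty: "K \<noteq> {}" and compact_K: "compact K" and K_eq: "K = (\<Union>i. \<phi> i ` K)"
  using invariant_K by (auto simp: invariant_def)

lemma phi_K_subset: "\<phi> i ` K \<subseteq> K"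
  using K_eq by blast

lemma word_map_K_subset: "cyl w \<subseteq> K"
  by (induction w) (use phi_K_subset in \<open>auto simp: word_map_Cons image_comp[symmetric]\<close>)

lemma word_map_append_K_subset: "cyl (v @ w) \<subseteq> cyl v"
  using word_map_K_subset[of w] by (auto simp: word_map_append)

lemma compact_word_map_K: "compact (cyl w)"
  by (intro compact_continuous_image continuous_on_word_map compact_K)

text \<open>The added 1 makes the scale positive even for a one-point attractor and the distance
  bounds inside cylinders strict.\<close>

definition diam :: real where "diam = diameter K + 1"

lemma diam_pos: "0 < diam"
  using diameter_ge_0[OF compact_imp_bounded[OF compact_K]] by (simp add: diam_def)

lemma dist_word_map_K:
  assumes "x \<in> cyl w" "y \<in> cyl w"
  shows "dist x y < ratio w * diam"
proof -
  obtain x' y' where "x = word_map \<phi> w x'" "y = word_map \<phi> w y'" "x' \<in> K" "y' \<in> K"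
    using assms by blast
  moreover have "dist x' y' < diam"
    using diameter_bounded_bound[OF compact_imp_bounded[OF compact_K] \<open>x' \<in> K\<close> \<open>y' \<in> K\<close>]
    by (simp add: diam_def)
  ultimately show ?thesis by (simp add: dist_word_map)
qed

lemma ratio_prefix_small:
  assumes "e > 0" "N > 0" "\<And>k. length (w k) \<ge> k * N"
  shows "\<exists>k. ratio (w k) * diam < e"
proof -
  obtain k where k: "rmax ^ k < e / diam"
    using real_arch_pow_inv[of "e / diam" rmax] rmax_less_1 assms(1) diam_pos by auto
  have "k \<le> k * N" using assms(2) by simp
  then have "k \<le> length (w k)" using assms(3)[of k] by linarith
  then have "rmax ^ length (w k) \<le> rmax ^ k"
    using rmax_pos rmax_less_1 by (intro power_decreasing) auto
  then have "ratio (w k) < e / diam" using k ratio_le_rmax[of "w k"] by linarith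
  then show ?thesis using diam_pos by (auto simp: field_simps)
qed

text \<open>Cylinders along a code are nested and shrink to a point, so membership in arbitrarily
  long ones decides. This suits block paths, where only every N-th prefix is under control.\<close>

lemma coding_map_unique:
  assumes x: "\<And>n. \<exists>m\<ge>n. x \<in> cyl (prefix_word j m)"
  shows "x = coding_map \<phi> j"
proof -
  have x': "x \<in> cyl (prefix_word j n)" for n
  proof -
    obtain m where m: "m \<ge> n" "x \<in> cyl (prefix_word j m)" using x by blast
    have "prefix_word j m = prefix_word j n @ drop n (prefix_word j m)"
      using m(1) by (metis append_take_drop_id take_prefix_word)
    then show ?thesis using m(2) word_map_append_K_subset by (metis subsetD)
  qed
  have "coding_map \<phi> j = x"
    unfolding coding_map_def K_def[symmetric]
  proof (rule the_equality)
    show "x \<in> (\<Inter>n. cyl (prefix_word j n))" using x' by blast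
    fix y assume y: "y \<in> (\<Inter>n. cyl (prefix_word j n))"
    show "y = x"
    proof (rule ccontr)
      assume "y \<noteq> x"
      then obtain k where "ratio (prefix_word j k) * diam < dist y x"
        using ratio_prefix_small[of "dist y x" 1 "prefix_word j"] by auto
      moreover have "dist y x < ratio (prefix_word j k) * diam"
        using y x' by (intro dist_word_map_K) auto
      ultimately show False by simp
    qed
  qed
  then show ?thesis ..
qed

lemma coding_map_mem: "coding_map \<phi> j \<in> cyl (prefix_word j n)"
proof -
  have "(\<Inter>n. cyl (prefix_word j n)) \<noteq> {}"
  proof (rule compact_nest)
    fix m n :: nat assume "m \<le> n"
    then have "prefix_word j n = prefix_word j m @ drop m (prefix_word j n)"
      by (metis append_take_drop_id take_prefix_word)
    then show "cyl (prefix_word j n) \<subseteq> cyl (prefix_word j m)"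
      using word_map_append_K_subset by metis
  qed (simp_all add: compact_word_map_K K_nonempty)
  then obtain x where x: "\<And>n. x \<in> cyl (prefix_word j n)" by blast
  then have "x = coding_map \<phi> j" by (intro coding_map_unique) blast
  with x show ?thesis by simp
qed

lemma coding_map_case_nat: "coding_map \<phi> (case_nat i j) = \<phi> i (coding_map \<phi> j)"
proof (rule coding_map_unique[symmetric])
  fix n
  have "\<phi> i (coding_map \<phi> j) \<in> cyl (prefix_word (case_nat i j) (Suc n))"
    using coding_map_mem[of j n] by (auto simp: prefix_word_Suc_case word_map_Cons)
  then show "\<exists>m\<ge>n. \<phi> i (coding_map \<phi> j) \<in> cyl (prefix_word (case_nat i j) m)"
    using le_SucI by blast
qed

end

subsection \<open>Subtrees of the word tree and diffuseness\<close>

text \<open>\<open>R v\<close> is the set of blocks that may follow \<open>v\<close>. It is defined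
  and nonempty at every word, so levels and limit sets can be formed below any vertex without
  membership side conditions.\<close>

locale word_tree = similarity_system \<phi> r
  for \<phi> :: "'i::finite \<Rightarrow> 'a::euclidean_space \<Rightarrow> 'a" and r :: "'i \<Rightarrow> real" +
  fixes R :: "'i list \<Rightarrow> 'i list set" and N :: nat
  assumes N_pos: "0 < N" and length_R: "w \<in> R v \<Longrightarrow> length w = N" and R_nonempty: "R v \<noteq> {}"
begin

lemma finite_R: "finite (R v)"
  by (rule finite_subset[OF _ finite_words_length[of N]]) (auto dest: length_R)

primrec lev :: "'i list \<Rightarrow> nat \<Rightarrow> 'i list set" where
  "lev v 0 = {v}"
| "lev v (Suc k) = (\<Union>w\<in>R v. lev (v @ w) k)"

lemma finite_lev: "finite (lev v k)"
  by (induction k arbitrary: v) (auto simp: finite_R)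

lemma lev_Suc_snoc: "lev v (Suc k) = (\<Union>u\<in>lev v k. (@) u ` R u)"
proof (induction k arbitrary: v)
  case (Suc k)
  have "lev v (Suc (Suc k)) = (\<Union>w\<in>R v. lev (v @ w) (Suc k))" by simp
  also have "\<dots> = (\<Union>w\<in>R v. \<Union>u\<in>lev (v @ w) k. (@) u ` R u)" unfolding Suc ..
  also have "\<dots> = (\<Union>u\<in>lev v (Suc k). (@) u ` R u)" by simp
  finally show ?case .
qed auto

lemma lev_nonempty: "lev v k \<noteq> {}"
  by (induction k arbitrary: v) (use R_nonempty in auto)

lemma length_lev: "u \<in> lev v k \<Longrightarrow> length u = length v + k * N"
  by (induction k arbitrary: v) (auto dest: length_R)

definition approx :: "'i list \<Rightarrow> nat \<Rightarrow> 'a set" where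
  "approx v k = (\<Union>u\<in>lev v k. cyl u)"

definition D :: "'i list \<Rightarrow> 'a set" where
  "D v = (\<Inter>k. approx v k)"

lemma approx_Suc_subset: "approx v (Suc k) \<subseteq> approx v k"
  unfolding approx_def lev_Suc_snoc using word_map_append_K_subset by blast

lemma approx_mono: "m \<le> n \<Longrightarrow> approx v n \<subseteq> approx v m"
  using approx_Suc_subset by (rule lift_Suc_antimono_le)

lemma approx_Suc: "approx v (Suc k) = (\<Union>w\<in>R v. approx (v @ w) k)"
  by (simp add: approx_def)

lemma compact_approx: "compact (approx v k)"
  unfolding approx_def by (intro compact_UN finite_lev compact_word_map_K)

lemma compact_D: "compact (D v)"
  unfolding D_def using compact_approx by (intro compact_Inter) auto

lemma D_nonempty: "D v \<noteq> {}"
  unfolding D_def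
  by (rule compact_nest) (auto simp: compact_approx approx_mono, auto simp: approx_def lev_nonempty K_nonempty)

lemma D_subset: "D v \<subseteq> cyl v"
proof -
  have "D v \<subseteq> approx v 0" unfolding D_def by blast
  then show ?thesis by (simp add: approx_def)
qed

text \<open>The inclusion that needs an argument is from left to right: a point missing the limit
  set of each child misses some finite stage of each, and since \<open>R v\<close> is finite a
  common stage exists.\<close>

lemma D_unfold: "D v = (\<Union>w\<in>R v. D (v @ w))"
proof
  show "(\<Union>w\<in>R v. D (v @ w)) \<subseteq> D v"
  proof
    fix x assume "x \<in> (\<Union>w\<in>R v. D (v @ w))"
    then have "x \<in> approx v (Suc k)" for k unfolding approx_Suc D_def by blast
    then show "x \<in> D v" using approx_Suc_subset unfolding D_def by blast
  qed
  show "D v \<subseteq> (\<Union>w\<in>R v. D (v @ w))"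
  proof (rule subsetI, rule ccontr)
    fix x assume x: "x \<in> D v" "x \<notin> (\<Union>w\<in>R v. D (v @ w))"
    then have "\<forall>w\<in>R v. \<exists>k. x \<notin> approx (v @ w) k" by (auto simp: D_def)
    then obtain g where g: "\<And>w. w \<in> R v \<Longrightarrow> x \<notin> approx (v @ w) (g w)" by metis
    define k where "k = Max (g ` R v)"
    have "x \<notin> approx (v @ w) k" if "w \<in> R v" for w
      using g[OF that] approx_mono[of "g w" k "v @ w"] that finite_R[of v] by (auto simp: k_def)
    then have "x \<notin> approx v (Suc k)" unfolding approx_Suc by blast
    then show False using x(1) by (auto simp: D_def)
  qed
qed

lemma D_append_subset: "w \<in> R v \<Longrightarrow> D (v @ w) \<subseteq> D v"
  using D_unfold[of v] by blast

lemma D_lev_subset: "u \<in> lev v k \<Longrightarrow> D u \<subseteq> D v"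
proof (induction k arbitrary: v)
  case (Suc k)
  then obtain w where w: "w \<in> R v" "u \<in> lev (v @ w) k" by auto
  then show ?case using Suc.IH[OF w(2)] D_append_subset[OF w(1)] by blast
qed simp

lemma D_path:
  assumes "x \<in> D v"
  obtains p where "p 0 = v" "\<And>k. x \<in> D (p k)" "\<And>k. \<exists>w\<in>R (p k). p (Suc k) = p k @ w"
proof -
  have "\<exists>p. \<forall>k. (x \<in> D (p k) \<and> (k = 0 \<longrightarrow> p k = v)) \<and> (\<exists>w\<in>R (p k). p (Suc k) = p k @ w)"
  proof (rule dependent_nat_choice)
    show "\<exists>u. x \<in> D u \<and> ((0::nat) = 0 \<longrightarrow> u = v)" using assms by blast
    fix u and k :: nat assume "x \<in> D u \<and> (k = 0 \<longrightarrow> u = v)"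
    then obtain w where "w \<in> R u" "x \<in> D (u @ w)" using D_unfold[of u] by blast
    then show "\<exists>u'. (x \<in> D u' \<and> (Suc k = 0 \<longrightarrow> u' = v)) \<and> (\<exists>w\<in>R u. u' = u @ w)" by auto
  qed
  then show ?thesis using that by blast
qed

lemma path_lev:
  assumes "p 0 = v" "\<And>k. \<exists>w\<in>R (p k). p (Suc k) = p k @ w"
  shows "p k \<in> lev v k"
proof (induction k)
  case (Suc k)
  then show ?case using assms(2)[of k] unfolding lev_Suc_snoc by blast
qed (simp add: assms)

lemma path_length:
  assumes "p 0 = v" "\<And>k. \<exists>w\<in>R (p k). p (Suc k) = p k @ w"
  shows "length (p k) = length v + k * N"
  using path_lev[of p, OF assms] length_lev by blast

lemma path_take:
  assumes "p 0 = v" "\<And>k. \<exists>w\<in>R (p k). p (Suc k) = p k @ w" and "k \<le> k'"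
  shows "take (length (p k)) (p k') = p k"
  using \<open>k \<le> k'\<close>
proof (induction k' rule: dec_induct)
  case (step n)
  obtain w where "p (Suc n) = p n @ w" using assms(2) by blast
  moreover have "length (p k) \<le> length (p n)" using step by (simp add: path_length[of p, OF assms(1,2)])
  ultimately show ?case using step by simp
qed simp

lemma path_code:
  assumes "p 0 = v" "\<And>k. \<exists>w\<in>R (p k). p (Suc k) = p k @ w"
  obtains j where "\<And>k. prefix_word j (length (p k)) = p k"
proof
  note len = path_length[of p, OF assms]
  fix k
  \<comment> \<open>Letter \<open>n\<close> is read from \<open>p (Suc n)\<close>, which is longer
    than \<open>n\<close> because every block has at least one letter. Later words of the path
    extend this one and agree with it there.\<close>
  show "prefix_word (\<lambda>n. p (Suc n) ! n) (length (p k)) = p k"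
  proof (rule nth_equalityI)
    fix n assume n: "n < length (prefix_word (\<lambda>n. p (Suc n) ! n) (length (p k)))"
    have nth_eq: "p k' ! n = p k ! n" if "k \<le> k'" "n < length (p k)" for k k'
      using that path_take[of p, OF assms] by (metis nth_take)
    have "n < Suc n * N" using N_pos by (cases N) auto
    then have "n < length (p (Suc n))" by (simp add: len)
    then have "p (Suc n) ! n = p k ! n"
      using n nth_eq[of "Suc n" k] nth_eq[of k "Suc n"] by (cases "Suc n \<le> k") auto
    then show "prefix_word (\<lambda>n. p (Suc n) ! n) (length (p k)) ! n = p k ! n"
      using n by (simp add: prefix_word_def)
  qed simp
qed

lemma D_code:
  assumes "x \<in> D v"
  obtains j where "x = coding_map \<phi> j" "\<And>k. prefix_word j (length v + k * N) \<in> lev v k"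
proof -
  obtain p where p: "p 0 = v" "\<And>k. x \<in> D (p k)" "\<And>k. \<exists>w\<in>R (p k). p (Suc k) = p k @ w"
    using D_path[OF assms] by blast
  obtain j where j: "\<And>k. prefix_word j (length (p k)) = p k" using path_code[of p, OF p(1,3)] by blast
  have len: "length (p k) = length v + k * N" for k
    using path_lev[of p, OF p(1,3)] length_lev by blast
  have "x = coding_map \<phi> j"
  proof (rule coding_map_unique)
    fix n
    have "n \<le> length (p n)" using N_pos by (simp add: len trans_le_add2)
    moreover have "x \<in> word_map \<phi> (prefix_word j (length (p n))) ` K"
      unfolding j using p(2) D_subset by blast
    ultimately show "\<exists>m\<ge>n. x \<in> cyl (prefix_word j m)" by blast
  qed
  moreover have "prefix_word j (length v + k * N) \<in> lev v k" for k
    using j[of k] path_lev[of p, OF p(1,3), of k] by (simp add: len)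
  ultimately show ?thesis using that by blast
qed

text \<open>Stop the first time the cylinder size falls below \<open>\<xi>\<close>. As
  \<open>\<xi>\<close> is smaller than the initial size, there is a preceding word of size at least
  \<open>\<xi>\<close>, and a single block shrinks it by at most \<open>rmin ^ N\<close>.\<close>

lemma stopping_path:
  assumes "p 0 = v" "\<And>k. \<exists>w\<in>R (p k). p (Suc k) = p k @ w" and "0 < \<xi>" "\<xi> < ratio v * diam"
  obtains k where "ratio (p k) * diam < \<xi>" "rmin ^ N * \<xi> \<le> ratio (p k) * diam"
    "\<And>l. l < k \<Longrightarrow> \<xi> \<le> ratio (p l) * diam"
proof -
  define k where "k = (LEAST k. ratio (p k) * diam < \<xi>)"
  have "\<exists>k. ratio (p k) * diam < \<xi>"
    using assms(3) N_pos by (rule ratio_prefix_small) (simp add: path_length[of p, OF assms(1,2)])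
  then have k: "ratio (p k) * diam < \<xi>" unfolding k_def by (rule LeastI_ex)
  have least: "\<xi> \<le> ratio (p l) * diam" if "l < k" for l
    using not_less_Least[of l "\<lambda>k. ratio (p k) * diam < \<xi>"] that by (simp add: k_def)
  have "k \<noteq> 0" using k assms(1,4) by (metis less_asym)
  then obtain k' where k': "k = Suc k'" by (metis not0_implies_Suc)
  then have "\<xi> \<le> ratio (p k') * diam" by (intro least) simp
  moreover obtain w where w: "w \<in> R (p k')" "p k = p k' @ w" using assms(2)[of k'] k' by blast
  ultimately have "rmin ^ N * \<xi> \<le> ratio w * (ratio (p k') * diam)"
    using rmin_le_ratio[of w] length_R[OF w(1)] assms(3) by (intro mult_mono) auto
  then have "rmin ^ N * \<xi> \<le> ratio (p k) * diam" by (simp add: w(2) mult_ac)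
  then show ?thesis using that[of k] k least by blast
qed

lemma stopping_node:
  assumes "x \<in> D v" "0 < \<xi>" "\<xi> < ratio v * diam"
  obtains u k where "u \<in> lev v k" "x \<in> D u" "ratio u * diam < \<xi>" "rmin ^ N * \<xi> \<le> ratio u * diam"
proof -
  obtain p where p: "p 0 = v" "\<And>k. x \<in> D (p k)" "\<And>k. \<exists>w\<in>R (p k). p (Suc k) = p k @ w"
    using D_path[OF assms(1)] by blast
  obtain k where "ratio (p k) * diam < \<xi>" "rmin ^ N * \<xi> \<le> ratio (p k) * diam"
    using stopping_path[of p, OF p(1,3) assms(2,3)] by blast
  then show ?thesis using that[of "p k" k] path_lev[of p, OF p(1,3)] p(2) by blast
qed

text \<open>Around \<open>x\<close>, stop at a word \<open>u\<close> of size comparable to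
  \<open>\<xi>\<close> and pull the hyperplane back by its map. A child cylinder stays at distance
  \<open>c\<close> from it, and pushing forward again multiplies this distance by
  \<open>ratio u\<close>, which is at least \<open>rmin ^ N * \<xi> / diam\<close>. That is the
  origin of \<open>\<beta>\<close>.\<close>

lemma hyperplane_diffuse_D:
  assumes c: "c > 0"
    and transversal: "\<And>v L. L \<in> affine_hyperplanes \<Longrightarrow>
      \<exists>w\<in>R v. \<forall>y\<in>cyl w. \<forall>z\<in>L. c \<le> dist y z"
  shows "hyperplane_diffuse (D v)"
proof -
  define \<beta> where "\<beta> = c * rmin ^ N / diam"
  have \<beta>: "\<beta> > 0" using c rmin_pos diam_pos by (simp add: \<beta>_def)
  have "D v \<inter> ball x \<xi> - open_nbhd L (\<beta> * \<xi>) \<noteq> {}"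
    if \<xi>: "0 < \<xi>" "\<xi> < ratio v * diam" and x: "x \<in> D v" and L: "L \<in> affine_hyperplanes" for \<xi> x L
  proof -
    obtain u k where u: "u \<in> lev v k" "x \<in> D u" "ratio u * diam < \<xi>" "rmin ^ N * \<xi> \<le> ratio u * diam"
      using stopping_node[OF x \<xi>] by blast
    obtain w where w: "w \<in> R u" "\<And>y z. y \<in> cyl w \<Longrightarrow> z \<in> word_map \<phi> u -` L \<Longrightarrow> c \<le> dist y z"
      using transversal[OF vimage_word_map_hyperplane[OF L]] by metis
    obtain y where y: "y \<in> D (u @ w)" using D_nonempty by blast
    have yu: "y \<in> D u" using y D_append_subset[OF w(1)] by blast
    have "dist x y < \<xi>"
      using dist_word_map_K[of x u y] u D_subset[of u] yu by force
    moreover have "\<beta> * \<xi> \<le> dist y z" if z: "z \<in> L" for z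
    proof -
      obtain z' where z': "z = word_map \<phi> u z'" using surj_word_map by (metis surjD)
      obtain y' where y': "y = word_map \<phi> u y'" "y' \<in> cyl w"
        using y D_subset[of "u @ w"] by (auto simp: word_map_append)
      have "\<beta> * \<xi> = c * (rmin ^ N * \<xi>) / diam" by (simp add: \<beta>_def)
      also have "\<dots> \<le> c * (ratio u * diam) / diam"
        using u(4) c diam_pos by (intro divide_right_mono mult_left_mono) auto
      also have "\<dots> = ratio u * c" using diam_pos by simp
      also have "\<dots> \<le> ratio u * dist y' z'"
        using w(2)[OF y'(2), of z'] z z' by (intro mult_left_mono) auto
      also have "\<dots> = dist y z" by (simp add: y' z' dist_word_map)
      finally show ?thesis .
    qed
    ultimately have "y \<in> D v \<inter> ball x \<xi> - open_nbhd L (\<beta> * \<xi>)"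
      using yu D_lev_subset[OF u(1)] by (force simp: open_nbhd_def dist_commute)
    then show ?thesis by blast
  qed
  moreover have "0 < ratio v * diam" using diam_pos by simp
  ultimately have "hyperplane_beta_diffuse \<beta> (D v)"
    unfolding hyperplane_beta_diffuse_def using compact_imp_closed[OF compact_D] by blast
  with \<beta> show ?thesis unfolding hyperplane_diffuse_def by blast
qed

end

subsection \<open>Hausdorff measure and mass distributions\<close>

lemma space_PiM_pmf [simp]: "space (PiM UNIV (\<lambda>t. measure_pmf (q t))) = UNIV"
  by (simp add: space_PiM PiE_def)

lemma prob_space_PiM_pmf: "prob_space (PiM UNIV (\<lambda>t. measure_pmf (q t)))"
  by (intro prob_space_PiM prob_space_measure_pmf)

lemma measurable_PiM_pmf_component [measurable]:
  "(\<lambda>\<omega>. \<omega> t) \<in> measurable (PiM UNIV (\<lambda>t. measure_pmf (q t))) (count_space UNIV)"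
proof -
  have "(\<lambda>\<omega>. \<omega> t) \<in> measurable (PiM UNIV (\<lambda>t. measure_pmf (q t))) (measure_pmf (q t))"
    by (rule measurable_component_singleton) simp
  then show ?thesis by simp
qed

lemma measure_PiM_pmf_cylinder:
  assumes "finite J"
  shows "measure (PiM UNIV (\<lambda>t. measure_pmf (q t))) {\<omega>. \<forall>t\<in>J. \<omega> t = f t} = (\<Prod>t\<in>J. pmf (q t) (f t))"
proof -
  have "{\<omega>. \<forall>t\<in>J. \<omega> t = f t} = prod_emb UNIV (\<lambda>t. measure_pmf (q t)) J (\<Pi>\<^sub>E t\<in>J. {f t})"
    by (auto simp: prod_emb_def PiE_iff Pi_iff restrict_def extensional_def)
  then have "emeasure (PiM UNIV (\<lambda>t. measure_pmf (q t))) {\<omega>. \<forall>t\<in>J. \<omega> t = f t}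
      = (\<Prod>t\<in>J. emeasure (measure_pmf (q t)) {f t})"
    using emeasure_PiM_emb[of UNIV "\<lambda>t. measure_pmf (q t)" J "\<lambda>t. {f t}"] assms
    by (simp add: prob_space_measure_pmf)
  then show ?thesis
    by (simp add: measure_def emeasure_pmf_single prod_ennreal prod_nonneg)
qed

lemma AE_PiM_pmf_support:
  fixes q :: "'t::countable \<Rightarrow> 'b pmf"
  shows "AE \<omega> in PiM UNIV (\<lambda>t. measure_pmf (q t)). \<forall>t. \<omega> t \<in> set_pmf (q t)"
  unfolding AE_all_countable
  by (intro allI AE_PiM_component prob_space_measure_pmf) (auto simp: AE_measure_pmf)

section \<open>Volume packing and the mass distribution principle\<close>

lemma card_disjoint_balls_le:
  fixes g :: "'b \<Rightarrow> 'a::euclidean_space"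
  assumes "finite F" and disj: "disjoint_family_on (\<lambda>u. ball (g u) \<epsilon>) F"
    and sub: "\<And>u. u \<in> F \<Longrightarrow> ball (g u) \<epsilon> \<subseteq> ball x \<rho>" and \<epsilon>: "\<epsilon> > 0" and \<rho>: "\<rho> > 0"
  shows "card F \<le> (\<rho> / \<epsilon>) ^ DIM('a)"
proof -
  define V where "V = unit_ball_vol (real DIM('a))"
  have V: "V > 0" by (simp add: V_def)
  have "ennreal (card F * (V * \<epsilon> ^ DIM('a))) = (\<Sum>u\<in>F. emeasure lborel (ball (g u) \<epsilon>))"
    using \<epsilon> V by (simp add: emeasure_ball ennreal_mult V_def ennreal_of_nat_eq_real_of_nat)
  also have "\<dots> = emeasure lborel (\<Union>u\<in>F. ball (g u) \<epsilon>)"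
    using disj \<open>finite F\<close> by (intro sum_emeasure) auto
  also have "\<dots> \<le> emeasure lborel (ball x \<rho>)"
    using sub by (intro emeasure_mono) auto
  also have "\<dots> = ennreal (V * \<rho> ^ DIM('a))" using \<rho> by (simp add: emeasure_ball V_def)
  finally have "card F * (V * \<epsilon> ^ DIM('a)) \<le> V * \<rho> ^ DIM('a)"
    using V \<rho> by (subst (asm) ennreal_le_iff) auto
  then have "V * (card F * \<epsilon> ^ DIM('a)) \<le> V * \<rho> ^ DIM('a)" by (simp add: mult_ac)
  then have "card F * \<epsilon> ^ DIM('a) \<le> \<rho> ^ DIM('a)" using V by simp
  then show ?thesis using \<epsilon> by (simp add: power_divide field_simps)
qed

text \<open>Every countable cover by small sets is replaced by balls centred in \<open>D\<close>,
  whose total mass is at least that of \<open>D\<close> and at most a constant times the Hausdorff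
  sum. All \<open>t \<le> s\<close> are treated at once because the diameters are below 1.\<close>

lemma hausdorff_measure_nonzero:
  fixes D :: "'a::euclidean_space set"
  assumes \<mu>: "sets \<mu> = sets borel" and D: "closed D" "emeasure \<mu> D > 0"
    and ball: "\<And>x \<rho>. x \<in> D \<Longrightarrow> 0 < \<rho> \<Longrightarrow> \<rho> < 1 \<Longrightarrow> emeasure \<mu> (ball x \<rho>) \<le> ennreal (c * \<rho> powr s)"
    and c: "c > 0" and t: "0 \<le> t" "t \<le> s" and s: "s > 0"
  shows "hausdorff_measure t D \<noteq> 0"
proof -
  \<comment> \<open>A covering set of diameter 0 contributes nothing to the Hausdorff sum, even for
    \<open>t = 0\<close>, since \<open>0 powr t = 0\<close>. Such sets must therefore carry no mass
    either.\<close>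
  have pt: "emeasure \<mu> {x} = 0" if "x \<in> D" for x
  proof (rule ccontr)
    assume "emeasure \<mu> {x} \<noteq> 0"
    then obtain e where e: "0 < e" "ennreal e < emeasure \<mu> {x}"
      by (metis ennreal_less_zero_iff not_gr_zero dense ennreal_cases infinity_ennreal_def less_top_ennreal top_greatest ennreal_0 leD linorder_cases)
    have "((\<lambda>\<rho>. c * \<rho> powr s) \<longlongrightarrow> c * 0 powr s) (at_right 0)"
      using s by (intro tendsto_intros tendsto_powr2 eventually_at_rightI[of 0 1]) auto
    then have "((\<lambda>\<rho>. c * \<rho> powr s) \<longlongrightarrow> 0) (at_right 0)" by simp
    then have "eventually (\<lambda>\<rho>. c * \<rho> powr s < e) (at_right 0)"
      using e(1) by (rule order_tendstoD)
    moreover have "eventually (\<lambda>\<rho>. \<rho> \<in> {0<..<1}) (at_right (0::real))"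
      by (rule eventually_at_right_real) simp
    ultimately have "eventually (\<lambda>\<rho>. c * \<rho> powr s < e \<and> \<rho> \<in> {0<..<1}) (at_right 0)"
      by eventually_elim simp
    then obtain \<rho> where \<rho>: "c * \<rho> powr s < e" "0 < \<rho>" "\<rho> < 1"
      using eventually_happens trivial_limit_at_right_real by (metis (no_types, lifting) greaterThanLessThan_iff)
    have "emeasure \<mu> {x} \<le> emeasure \<mu> (ball x \<rho>)"
      using \<rho> \<mu> by (intro emeasure_mono) auto
    also have "\<dots> \<le> ennreal e"
      using ball[OF that \<rho>(2,3)] \<rho>(1) by (meson ennreal_leI less_imp_le order_trans)
    finally show False using e(2) by simp
  qed
  \<comment> \<open>The threshold 1/4 keeps the doubled diameters below 1, the range where the ball
    bound holds.\<close>
  have "ennreal (1 / (c * 2 powr s)) * emeasure \<mu> D \<le> hausdorff_pre t (1/4) D"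
    unfolding hausdorff_pre_def
  proof (rule INF_greatest)
    fix U :: "nat \<Rightarrow> 'a set"
    assume "U \<in> {U. D \<subseteq> (\<Union>i. U i) \<and> (\<forall>i. bounded (U i) \<and> diameter (U i) \<le> 1 / 4)}"
    then have U: "D \<subseteq> (\<Union>i. U i)" "\<And>i. bounded (U i)" "\<And>i. diameter (U i) \<le> 1 / 4" by auto
    define p where "p i = (SOME x. x \<in> D \<inter> U i)" for i
    have p: "p i \<in> D \<inter> U i" if "D \<inter> U i \<noteq> {}" for i
      using that unfolding p_def by (metis some_in_eq)
    \<comment> \<open>Only balls centred in \<open>D\<close> are controlled, so the centre is a
      point of \<open>D\<close> in the covering set. Doubling a positive diameter makes the open
      ball contain every point of that set.\<close>
    define B where "B i = (if D \<inter> U i = {} then {} else if diameter (U i) = 0 then {p i}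
        else ball (p i) (2 * diameter (U i)))" for i
    have B_sets: "B i \<in> sets \<mu>" for i by (simp add: B_def \<mu>)
    have cov: "D \<subseteq> (\<Union>i. B i)"
    proof
      fix x assume x: "x \<in> D"
      then obtain i where i: "x \<in> U i" using U(1) by blast
      have pi: "p i \<in> U i" using p[of i] x i by blast
      have d: "dist (p i) x \<le> diameter (U i)" using U(2) pi i by (rule diameter_bounded_bound)
      have "x \<in> B i"
      proof (cases "diameter (U i) = 0")
        case True
        then have "x = p i" using d by simp
        then show ?thesis using x i True by (auto simp: B_def)
      next
        case False
        then have "diameter (U i) > 0" using diameter_ge_0[OF U(2)[of i]] by linarith
        then show ?thesis using x i d False by (auto simp: B_def)
      qed
      then show "x \<in> (\<Union>i. B i)" by blast
    qed
    have meas: "emeasure \<mu> (B i) \<le> ennreal (c * 2 powr s) * ennreal (diameter (U i) powr t)" for i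
    proof -
      consider "D \<inter> U i = {}" | "D \<inter> U i \<noteq> {}" "diameter (U i) = 0"
        | "D \<inter> U i \<noteq> {}" "diameter (U i) > 0"
        using diameter_ge_0[OF U(2)[of i]] by linarith
      then show ?thesis
      proof cases
        case 1 then show ?thesis by (simp add: B_def)
      next
        case 2 then show ?thesis using p[of i] pt[of "p i"] by (simp add: B_def)
      next
        case 3
        let ?d = "diameter (U i)"
        have "emeasure \<mu> (B i) \<le> ennreal (c * (2 * ?d) powr s)"
          using 3 U(3)[of i] p[of i] ball[of "p i" "2 * ?d"] by (simp add: B_def)
        also have "\<dots> = ennreal (c * 2 powr s * ?d powr s)"
          using 3 by (simp add: powr_mult mult_ac)
        also have "\<dots> \<le> ennreal (c * 2 powr s * ?d powr t)"
          using 3 U(3)[of i] t c by (intro ennreal_leI mult_left_mono powr_mono') auto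
        finally show ?thesis using c by (simp add: ennreal_mult)
      qed
    qed
    have "emeasure \<mu> D \<le> emeasure \<mu> (\<Union>i. B i)"
      using cov B_sets by (intro emeasure_mono) auto
    also have "\<dots> \<le> (\<Sum>i. emeasure \<mu> (B i))"
      using B_sets by (intro emeasure_subadditive_countably) auto
    also have "\<dots> \<le> (\<Sum>i. ennreal (c * 2 powr s) * ennreal (diameter (U i) powr t))"
      by (intro suminf_le meas summableI)
    also have "\<dots> = ennreal (c * 2 powr s) * (\<Sum>i. ennreal (diameter (U i) powr t))"
      by (rule ennreal_suminf_cmult)
    finally have "ennreal (1 / (c * 2 powr s)) * emeasure \<mu> D
        \<le> ennreal (1 / (c * 2 powr s)) * (ennreal (c * 2 powr s) * (\<Sum>i. ennreal (diameter (U i) powr t)))"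
      by (intro mult_left_mono) auto
    also have "\<dots> = (\<Sum>i. ennreal (diameter (U i) powr t))"
      using c by (simp add: mult.assoc[symmetric] ennreal_mult[symmetric])
    finally show "ennreal (1 / (c * 2 powr s)) * emeasure \<mu> D \<le> (\<Sum>i. ennreal (diameter (U i) powr t))" .
  qed
  also have "\<dots> \<le> hausdorff_measure t D"
    unfolding hausdorff_measure_def by (rule SUP_upper) simp
  finally have "ennreal (1 / (c * 2 powr s)) * emeasure \<mu> D \<le> hausdorff_measure t D" .
  moreover have "ennreal (1 / (c * 2 powr s)) * emeasure \<mu> D > 0"
    using D(2) c by (simp add: ennreal_zero_less_mult_iff)
  ultimately show ?thesis by auto
qed

subsection \<open>The natural measure of a weighted subtree\<close>

text \<open>Strip the common prefix using injectivity. Neither word extends the other, so eventually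
  the first letters differ and the open set condition separates the images.\<close>

lemma incomparable_images_disjoint:
  assumes sub: "\<And>i. \<phi> i ` U \<subseteq> U" and disj: "\<And>i j. i \<noteq> j \<Longrightarrow> \<phi> i ` U \<inter> \<phi> j ` U = {}"
    and inj: "\<And>i. inj (\<phi> i)" and "\<nexists>t. v = u @ t" "\<nexists>t. u = v @ t"
  shows "word_map \<phi> u ` U \<inter> word_map \<phi> v ` U = {}"
  using assms(4,5)
proof (induction u arbitrary: v)
  case (Cons i u)
  have in_U: "word_map \<phi> w ` U \<subseteq> U" for w
    by (induction w) (use sub in \<open>auto simp: word_map_Cons image_comp[symmetric]\<close>)
  obtain j v' where v: "v = j # v'" using Cons.prems(2) by (cases v) auto
  show ?case
  proof (cases "i = j")
    case True
    then have "word_map \<phi> u ` U \<inter> word_map \<phi> v' ` U = {}"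
      using Cons.prems by (intro Cons.IH) (auto simp: v)
    then show ?thesis
      using inj[of j] by (auto simp: v True word_map_Cons inj_def)
  next
    case False
    have "word_map \<phi> (i # u) ` U \<subseteq> \<phi> i ` U" "word_map \<phi> v ` U \<subseteq> \<phi> j ` U"
      using in_U by (auto simp: v word_map_Cons)
    then show ?thesis using disj[OF False] by blast
  qed
qed simp

text \<open>\<open>m\<close> is the ratio between the mass of a cylinder and
  \<open>ratio v powr s\<close>. The last assumption gives all children of \<open>v\<close> the same
  correction and makes their masses add up to the mass of \<open>v\<close>.\<close>

locale weighted_word_tree = word_tree +
  fixes m :: "'a list \<Rightarrow> real" and s :: real
  assumes s_pos: "0 < s" and m_ge_1: "1 \<le> m v" and m_le_2: "m v \<le> 2"
    and m_append: "w \<in> R v \<Longrightarrow> m (v @ w) * (\<Sum>w\<in>R v. ratio w powr s) = m v"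
begin

definition Z :: "'a list \<Rightarrow> real" where
  "Z v = (\<Sum>w\<in>R v. ratio w powr s)"

lemma Z_pos: "0 < Z v"
  unfolding Z_def using finite_R R_nonempty by (intro sum_pos) auto

definition q :: "'a list \<Rightarrow> 'a list pmf" where
  "q v = embed_pmf (\<lambda>w. indicator (R v) w * (ratio w powr s / Z v))"

lemma pmf_q: "pmf (q v) w = indicator (R v) w * (ratio w powr s / Z v)"
  unfolding q_def
proof (rule pmf_embed_pmf)
  show "0 \<le> indicator (R v) w * (ratio w powr s / Z v)" for w
    using Z_pos[of v] by (simp add: indicator_def)
  have "(\<integral>\<^sup>+ w. ennreal (indicator (R v) w * (ratio w powr s / Z v)) \<partial>count_space UNIV)
      = (\<integral>\<^sup>+ w. ennreal (ratio w powr s / Z v) * indicator (R v) w \<partial>count_space UNIV)"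
    by (intro nn_integral_cong) (simp add: indicator_def)
  also have "\<dots> = (\<Sum>w\<in>R v. ennreal (ratio w powr s / Z v))"
    using finite_R by (simp add: nn_integral_count_space_indicator[symmetric] nn_integral_count_space_finite)
  also have "\<dots> = ennreal (\<Sum>w\<in>R v. ratio w powr s / Z v)"
    using Z_pos[of v] by (intro sum_ennreal) simp
  also have "(\<Sum>w\<in>R v. ratio w powr s / Z v) = 1"
    using Z_pos[of v] by (simp add: sum_divide_distrib[symmetric] Z_def[symmetric])
  finally show "(\<integral>\<^sup>+ w. ennreal (indicator (R v) w * (ratio w powr s / Z v)) \<partial>count_space UNIV) = 1"
    by simp
qed

lemma set_pmf_q: "set_pmf (q v) = R v"
  using Z_pos[of v] by (auto simp: set_pmf_iff pmf_q indicator_def)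

text \<open>Every word draws a child independently, with probability proportional to
  \<open>ratio w powr s\<close>, whether or not it is ever visited. Following the draws from
  \<open>v\<close> produces the random path of the natural measure.\<close>

definition choices :: "('a list \<Rightarrow> 'a list) measure" where
  "choices = PiM UNIV (\<lambda>v. measure_pmf (q v))"

sublocale choices: prob_space choices
  unfolding choices_def by (rule prob_space_PiM_pmf)

lemma space_choices [simp]: "space choices = UNIV"
  by (simp add: choices_def)

primrec path :: "'a list \<Rightarrow> nat \<Rightarrow> ('a list \<Rightarrow> 'a list) \<Rightarrow> 'a list" where
  "path v 0 \<omega> = v"
| "path v (Suc k) \<omega> = path v k \<omega> @ \<omega> (path v k \<omega>)"

lemma measurable_path [measurable]: "path v k \<in> measurable choices (count_space UNIV)"
proof (induction k)
  case (Suc k)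
  have "(\<lambda>\<omega>. (\<lambda>u \<omega>. u @ \<omega> u) (path v k \<omega>) \<omega>) \<in> measurable choices (count_space UNIV)"
  proof (rule measurable_compose_countable[OF _ Suc])
    fix u
    have "(\<lambda>\<omega>. \<omega> u) \<in> measurable choices (count_space UNIV)"
      unfolding choices_def by (rule measurable_PiM_pmf_component)
    then show "(\<lambda>\<omega>. u @ \<omega> u) \<in> measurable choices (count_space UNIV)"
      by (rule measurable_compose) simp
  qed
  then show ?case by simp
qed simp

lemma AE_choices: "AE \<omega> in choices. \<forall>t. \<omega> t \<in> R t"
  unfolding choices_def using AE_PiM_pmf_support[of q] unfolding set_pmf_q .

lemma sets_choices_Ball: "finite J \<Longrightarrow> {\<omega>. \<forall>t\<in>J. \<omega> t = f t} \<in> sets choices"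
proof -
  assume "finite J"
  have "{\<omega>. \<omega> t = f t} \<in> sets choices" for t
  proof -
    have "(\<lambda>\<omega>. \<omega> t) -` {f t} \<inter> space choices \<in> sets choices"
      unfolding choices_def by (rule measurable_sets[OF measurable_PiM_pmf_component]) simp
    then show ?thesis by (simp add: vimage_def)
  qed
  then have "{\<omega> \<in> space choices. \<forall>t\<in>J. \<omega> t = f t} \<in> sets choices"
    using \<open>finite J\<close> by (intro sets.sets_Collect_finite_All) auto
  then show ?thesis by simp
qed

lemma sets_path: "{\<omega>. path v k \<omega> = u} \<in> sets choices"
proof -
  have "path v k -` {u} \<inter> space choices \<in> sets choices"
    by (rule measurable_sets[OF measurable_path]) simp
  then show ?thesis by (simp add: vimage_def)
qed

lemma path_step: "\<forall>t. \<omega> t \<in> R t \<Longrightarrow> \<exists>w\<in>R (path v k \<omega>). path v (Suc k) \<omega> = path v k \<omega> @ w"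
  by auto

definition mass :: "'a list \<Rightarrow> real" where
  "mass u = m u * ratio u powr s"

lemma mass_pos: "0 < mass u"
  using m_ge_1[of u] by (simp add: mass_def)

lemma mass_append:
  assumes "w \<in> R u"
  shows "mass (u @ w) = mass u * pmf (q u) w"
proof -
  have "m (u @ w) = m u / Z u"
    using m_append[OF assms] Z_pos[of u] by (simp add: Z_def field_simps)
  then show ?thesis
    using assms by (simp add: mass_def pmf_q powr_mult)
qed

text \<open>The set \<open>J\<close> of further prescribed choices is there for the induction: the
  last step of the path becomes one more prescribed choice at its penultimate word. The words in
  \<open>J\<close> are no shorter than the end of the path, so their draws do not influence
  it.\<close>

lemma measure_path_cylinder:
  assumes "u \<in> lev v k" "finite J" "\<And>t. t \<in> J \<Longrightarrow> length v + k * N \<le> length t"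
  shows "measure choices {\<omega>. path v k \<omega> = u \<and> (\<forall>t\<in>J. \<omega> t = f t)} = mass u / mass v * (\<Prod>t\<in>J. pmf (q t) (f t))"
  using assms
proof (induction k arbitrary: u J f)
  case 0
  then show ?case
    using mass_pos[of v] measure_PiM_pmf_cylinder[of J q f] by (simp add: choices_def)
next
  case (Suc k)
  obtain u' w where u: "u' \<in> lev v k" "w \<in> R u'" "u = u' @ w"
    using Suc.prems(1) unfolding lev_Suc_snoc by blast
  have len: "length u' = length v + k * N" using u(1) by (rule length_lev)
  have nJ: "u' \<notin> J" using Suc.prems(3)[of u'] len N_pos by auto
  have meas: "{\<omega>. path v n \<omega> = t \<and> (\<forall>t\<in>J. \<omega> t = f t)} \<in> sets choices" if "finite J" for n t J f
  proof -
    have "{\<omega>. path v n \<omega> = t} \<inter> {\<omega>. \<forall>t\<in>J. \<omega> t = f t} \<in> sets choices"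
      using sets_path sets_choices_Ball[OF that] by (rule sets.Int)
    then show ?thesis by (simp add: Collect_conj_eq)
  qed
  \<comment> \<open>The equality of events holds only almost surely: the split of \<open>u\<close>
    into \<open>u'\<close> and \<open>w\<close> is forced by length, and the length of the path is
    known only when every draw lies in \<open>R\<close>.\<close>
  have "measure choices {\<omega>. path v (Suc k) \<omega> = u \<and> (\<forall>t\<in>J. \<omega> t = f t)}
      = measure choices {\<omega>. path v k \<omega> = u' \<and> (\<forall>t\<in>insert u' J. \<omega> t = (f(u' := w)) t)}"
  proof (rule measure_eq_AE)
    show "AE \<omega> in choices. (\<omega> \<in> {\<omega>. path v (Suc k) \<omega> = u \<and> (\<forall>t\<in>J. \<omega> t = f t)})
        = (\<omega> \<in> {\<omega>. path v k \<omega> = u' \<and> (\<forall>t\<in>insert u' J. \<omega> t = (f(u' := w)) t)})"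
      using AE_choices
    proof eventually_elim
      case (elim \<omega>)
      have "length (path v k \<omega>) = length v + k * N"
        using path_step[OF elim] by (intro path_length[of "\<lambda>k. path v k \<omega>"]) auto
      then have "path v (Suc k) \<omega> = u \<longleftrightarrow> path v k \<omega> = u' \<and> \<omega> u' = w"
        by (auto simp: u(3) len)
      moreover have "(\<forall>t\<in>J. \<omega> t = (f(u' := w)) t) \<longleftrightarrow> (\<forall>t\<in>J. \<omega> t = f t)"
        using nJ by auto
      ultimately show ?case by auto
    qed
  qed (rule meas, simp add: Suc.prems(2))+
  also have "\<dots> = mass u' / mass v * (\<Prod>t\<in>insert u' J. pmf (q t) ((f(u' := w)) t))"
    using u(1) Suc.prems(2,3) len by (intro Suc.IH) (auto dest: Suc.prems(3))
  also have "(\<Prod>t\<in>insert u' J. pmf (q t) ((f(u' := w)) t)) = pmf (q u') w * (\<Prod>t\<in>J. pmf (q t) (f t))"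
    using nJ Suc.prems(2) by (subst prod.insert) (auto intro!: prod.cong)
  finally show ?case by (simp add: u(3) mass_append[OF u(2)])
qed

lemma measure_path: "u \<in> lev v k \<Longrightarrow> measure choices {\<omega>. path v k \<omega> = u} = mass u / mass v"
  using measure_path_cylinder[of u v k "{}"] by simp

text \<open>A limit of countably valued maps is measurable by construction. The base point in
  \<open>K\<close> is arbitrary because the cylinders along the path shrink.\<close>

definition endpoint :: "'a list \<Rightarrow> ('a list \<Rightarrow> 'a list) \<Rightarrow> 'b" where
  "endpoint v \<omega> = lim (\<lambda>k. word_map \<phi> (path v k \<omega>) (SOME x. x \<in> K))"

lemma measurable_endpoint: "endpoint v \<in> borel_measurable choices"
proof -
  have "(\<lambda>\<omega>. word_map \<phi> (path v k \<omega>) (SOME x. x \<in> K)) \<in> borel_measurable choices" for k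
    by (rule measurable_compose[OF measurable_path]) simp
  then show ?thesis
    unfolding endpoint_def by (rule borel_measurable_lim_metric)
qed

lemma endpoint_mem:
  assumes \<omega>: "\<forall>t. \<omega> t \<in> R t"
  shows "endpoint v \<omega> \<in> cyl (path v k \<omega>)" "endpoint v \<omega> \<in> D v"
proof -
  have lev: "path v k \<omega> \<in> lev v k" for k
    using path_step[OF \<omega>] by (intro path_lev[of "\<lambda>k. path v k \<omega>"]) auto
  have "(\<Inter>k. cyl (path v k \<omega>)) \<noteq> {}"
  proof (rule compact_nest)
    show "cyl (path v k \<omega>) \<subseteq> cyl (path v l \<omega>)" if "l \<le> k" for k l
      using that by (rule lift_Suc_antimono_le[rotated]) (simp add: word_map_append_K_subset)
  qed (simp_all add: compact_word_map_K K_nonempty)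
  then obtain y where y: "\<And>k. y \<in> cyl (path v k \<omega>)" by blast
  have "(\<lambda>k. word_map \<phi> (path v k \<omega>) (SOME x. x \<in> K)) \<longlonglongrightarrow> y"
  proof (rule tendstoI)
    fix e :: real assume "e > 0"
    have len: "length (path v k \<omega>) = length v + k * N" for k using lev length_lev by blast
    obtain k0 where k0: "ratio (path v k0 \<omega>) * diam < e"
      using ratio_prefix_small[OF \<open>e > 0\<close> N_pos, of "\<lambda>k. path v k \<omega>"] by (auto simp: len)
    have "dist (word_map \<phi> (path v k \<omega>) (SOME x. x \<in> K)) y < e" if "k0 \<le> k" for k
    proof -
      have "take (length (path v k0 \<omega>)) (path v k \<omega>) = path v k0 \<omega>"
        using path_step[OF \<omega>] that by (intro path_take[of "\<lambda>k. path v k \<omega>"]) auto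
      then obtain t where "path v k \<omega> = path v k0 \<omega> @ t" by (metis append_take_drop_id)
      moreover have "(SOME x. x \<in> K) \<in> K" using K_nonempty by (simp add: some_in_eq)
      ultimately have "word_map \<phi> (path v k \<omega>) (SOME x. x \<in> K) \<in> cyl (path v k0 \<omega>)"
        using word_map_append_K_subset by (metis image_eqI subsetD)
      then show ?thesis using dist_word_map_K[OF _ y[of k0]] k0 by force
    qed
    then show "\<forall>\<^sub>F k in sequentially. dist (word_map \<phi> (path v k \<omega>) (SOME x. x \<in> K)) y < e"
      by (auto simp: eventually_sequentially)
  qed
  then have e: "endpoint v \<omega> = y" unfolding endpoint_def by (rule limI)
  show "endpoint v \<omega> \<in> cyl (path v k \<omega>)" using e y by simp
  show "endpoint v \<omega> \<in> D v" unfolding e D_def approx_def using y lev by blast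
qed

definition \<mu> :: "'a list \<Rightarrow> 'b measure" where
  "\<mu> v = distr choices borel (endpoint v)"

lemma sets_\<mu> [simp]: "sets (\<mu> v) = sets borel"
  by (simp add: \<mu>_def)

lemma emeasure_\<mu>: "A \<in> sets borel \<Longrightarrow> emeasure (\<mu> v) A = emeasure choices {\<omega>. endpoint v \<omega> \<in> A}"
  unfolding \<mu>_def using measurable_endpoint by (simp add: emeasure_distr vimage_def)

lemma sets_endpoint: "A \<in> sets borel \<Longrightarrow> {\<omega>. endpoint v \<omega> \<in> A} \<in> sets choices"
  using measurable_sets[OF measurable_endpoint, of A v] by (simp add: vimage_def)

lemma emeasure_\<mu>_D: "D v \<subseteq> A \<Longrightarrow> A \<in> sets borel \<Longrightarrow> emeasure (\<mu> v) A = 1"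
proof -
  assume A: "D v \<subseteq> A" "A \<in> sets borel"
  have "emeasure choices {\<omega>. endpoint v \<omega> \<in> A} = emeasure choices (space choices)"
  proof (rule emeasure_eq_AE)
    show "AE \<omega> in choices. (\<omega> \<in> {\<omega>. endpoint v \<omega> \<in> A}) = (\<omega> \<in> space choices)"
      using AE_choices by eventually_elim (use A(1) endpoint_mem(2) in auto)
  qed (use sets_endpoint[OF A(2)] sets.top[of choices] in simp_all)
  then show ?thesis using A by (simp add: emeasure_\<mu> choices.emeasure_space_1[simplified])
qed

text \<open>Regularity concerns all radii below 1, whereas stopping needs a scale below the size of
  the cylinder of \<open>v\<close>. Multiplying the radius by this constant reconciles the two
  ranges at the price of constants.\<close>

definition scale :: "'a list \<Rightarrow> real" where
  "scale v = min 1 (ratio v * diam)"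

lemma scale_pos: "0 < scale v" and scale_le_1: "scale v \<le> 1" and scale_le: "scale v \<le> ratio v * diam"
  using diam_pos by (simp_all add: scale_def)

lemma scaled_radius:
  assumes "0 < \<rho>" "\<rho> < 1"
  shows "0 < scale v * \<rho> \<and> scale v * \<rho> < ratio v * diam \<and> scale v * \<rho> \<le> \<rho>"
proof -
  have "scale v * \<rho> < scale v * 1" using assms scale_pos by (intro mult_strict_left_mono) auto
  then have "scale v * \<rho> < ratio v * diam" using scale_le[of v] by linarith
  then show ?thesis
    using assms scale_pos[of v] mult_right_mono[OF scale_le_1[of v], of \<rho>] by auto
qed

text \<open>The stopping cylinder of \<open>x\<close> lies inside the ball, and its mass is at least
  its ratio to the power \<open>s\<close> because \<open>m\<close> is at least 1.\<close>

lemma \<mu>_ball_ge: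
  assumes x: "x \<in> D v" and \<rho>: "0 < \<rho>" "\<rho> < 1"
  shows "ennreal ((rmin ^ N * scale v / diam) powr s / mass v * \<rho> powr s) \<le> emeasure (\<mu> v) (ball x \<rho>)"
proof -
  have \<xi>: "0 < scale v * \<rho>" "scale v * \<rho> < ratio v * diam" "scale v * \<rho> \<le> \<rho>"
    using scaled_radius[OF \<rho>] by blast+
  obtain u k where u: "u \<in> lev v k" "x \<in> D u" "ratio u * diam < scale v * \<rho>"
      "rmin ^ N * (scale v * \<rho>) \<le> ratio u * diam"
    using stopping_node[OF x \<xi>(1,2)] by blast
  have "(rmin ^ N * scale v / diam) powr s / mass v * \<rho> powr s
      = (rmin ^ N * (scale v * \<rho>) / diam) powr s / mass v"
    using \<rho> scale_pos[of v] diam_pos rmin_pos by (simp add: powr_mult powr_divide)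
  also have "\<dots> \<le> ratio u powr s / mass v"
    using u(4) diam_pos mass_pos[of v] \<xi>(1) s_pos rmin_pos
    by (intro divide_right_mono powr_mono2)
      (auto simp: pos_divide_le_eq intro!: divide_nonneg_pos mult_nonneg_nonneg less_imp_le[OF scale_pos] less_imp_le[OF \<rho>(1)])
  also have "\<dots> \<le> mass u / mass v"
    unfolding mass_def[of u] using m_ge_1[of u] mass_pos[of v]
    by (intro divide_right_mono mult_le_cancel_right1[THEN iffD2]) auto
  finally have "ennreal ((rmin ^ N * scale v / diam) powr s / mass v * \<rho> powr s)
      \<le> emeasure choices {\<omega>. path v k \<omega> = u}"
    using measure_path[OF u(1)] by (simp add: choices.emeasure_eq_measure ennreal_leI)
  also have "\<dots> \<le> emeasure choices {\<omega>. endpoint v \<omega> \<in> ball x \<rho>}"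
  proof (rule emeasure_mono_AE)
    show "AE \<omega> in choices. \<omega> \<in> {\<omega>. path v k \<omega> = u} \<longrightarrow> \<omega> \<in> {\<omega>. endpoint v \<omega> \<in> ball x \<rho>}"
      using AE_choices
    proof eventually_elim
      case (elim \<omega>)
      have "endpoint v \<omega> \<in> ball x \<rho>" if "path v k \<omega> = u"
      proof -
        have "dist x (endpoint v \<omega>) < ratio u * diam"
          using endpoint_mem(1)[OF elim, of v k] that u(2) D_subset by (intro dist_word_map_K) auto
        then show ?thesis using u(3) \<xi>(3) by simp
      qed
      then show ?case by simp
    qed
  qed (rule sets_endpoint, simp)
  finally show ?thesis by (simp add: emeasure_\<mu>)
qed

text \<open>A path ending in the ball stops at a cylinder meeting the ball. By the open set
  condition the stopping cylinders carry disjoint balls of comparable radius, so boundedly many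
  occur, and \<open>m \<le> 2\<close> bounds the mass of each.\<close>

lemma \<mu>_ball_le:
  assumes osc: "open_set_condition \<phi>"
  obtains C where "C > 0" "\<And>x \<rho>. 0 < \<rho> \<Longrightarrow> \<rho> < 1 \<Longrightarrow> emeasure (\<mu> v) (ball x \<rho>) \<le> ennreal (C * \<rho> powr s)"
proof -
  obtain U where U: "open U" "U \<noteq> {}" "\<And>i. \<phi> i ` U \<subseteq> U" "\<And>i j. i \<noteq> j \<Longrightarrow> \<phi> i ` U \<inter> \<phi> j ` U = {}"
    using osc unfolding open_set_condition_def by blast
  obtain z where z: "z \<in> U" using U(2) by blast
  obtain \<eta> where \<eta>: "\<eta> > 0" "ball z \<eta> \<subseteq> U" using U(1) z openE by blast
  obtain M where M: "\<And>y. y \<in> K \<Longrightarrow> dist z y \<le> M"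
    using compact_imp_bounded[OF compact_K] by (metis bounded_any_center)
  have M0: "0 \<le> M" using M K_nonempty zero_le_dist by (metis all_not_in_conv order_trans)
  \<comment> \<open>\<open>A * \<rho>\<close> is the radius of a ball inside the image of
    \<open>U\<close> under each stopping word. \<open>B * \<rho>\<close> adds the distance
    \<open>\<rho>\<close> from \<open>x\<close> to a point of the cylinder, the distance from there
    to the image of \<open>z\<close>, and the small radius.\<close>
  define A where "A = rmin ^ N * scale v * \<eta> / diam"
  define B where "B = 1 + M / diam + \<eta> / diam"
  have A: "A > 0" using rmin_pos scale_pos diam_pos \<eta> by (simp add: A_def)
  have B: "B > 0" using M0 diam_pos \<eta> by (simp add: B_def add_pos_nonneg)
  define C where "C = (B / A) ^ DIM('b) * (2 / diam powr s / mass v)"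
  have C: "C > 0" using A B diam_pos mass_pos[of v] by (simp add: C_def)
  have "emeasure (\<mu> v) (ball x \<rho>) \<le> ennreal (C * \<rho> powr s)" if \<rho>: "0 < \<rho>" "\<rho> < 1" for x \<rho>
  proof -
    define \<xi> where "\<xi> = scale v * \<rho>"
    have \<xi>: "0 < \<xi>" "\<xi> < ratio v * diam" "\<xi> \<le> \<rho>"
      using scaled_radius[OF \<rho>] unfolding \<xi>_def by blast+
    \<comment> \<open>The clause about ancestors says that \<open>u\<close> is the first word of its
      path below the scale. Without it one member could extend another and their images of
      \<open>U\<close> would overlap.\<close>
    define \<Gamma> where "\<Gamma> = {(k, u). u \<in> lev v k \<and> ratio u * diam < \<xi> \<and> rmin ^ N * \<xi> \<le> ratio u * diam
      \<and> (\<forall>l<k. \<forall>u'\<in>lev v l. (\<exists>t. u = u' @ t) \<longrightarrow> \<xi> \<le> ratio u' * diam)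
      \<and> cyl u \<inter> ball x \<rho> \<noteq> {}}"
    have incomp: "\<nexists>t. u' = u @ t" if "(k, u) \<in> \<Gamma>" "(k', u') \<in> \<Gamma>" "(k, u) \<noteq> (k', u')" for k u k' u'
    proof
      assume "\<exists>t. u' = u @ t"
      then obtain t where t: "u' = u @ t" by blast
      have lev: "u \<in> lev v k" "u' \<in> lev v k'" using that by (auto simp: \<Gamma>_def)
      have len: "length u = length v + k * N" "length u' = length v + k' * N"
        using lev length_lev by blast+
      then have "k * N \<le> k' * N" using t by (metis add_le_cancel_left le_add1 length_append)
      then have "k \<le> k'" using N_pos by simp
      moreover have "k \<noteq> k'" using len t that(3) by auto
      ultimately have "k < k'" by simp
      then have "\<xi> \<le> ratio u * diam" using that(2) lev(1) t by (auto simp: \<Gamma>_def)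
      then show False using that(1) by (auto simp: \<Gamma>_def)
    qed
    have card_le: "card F \<le> (B / A) ^ DIM('b)" if F: "finite F" "F \<subseteq> \<Gamma>" for F
    proof -
      have "card F \<le> ((B * \<rho>) / (A * \<rho>)) ^ DIM('b)"
      proof (rule card_disjoint_balls_le[where g = "\<lambda>(k, u). word_map \<phi> u z" and x = x])
        have in_img: "ball (word_map \<phi> u z) (A * \<rho>) \<subseteq> word_map \<phi> u ` U" if "(k, u) \<in> \<Gamma>" for k u
        proof -
          have "A * \<rho> = rmin ^ N * \<xi> / diam * \<eta>" by (simp add: A_def \<xi>_def)
          also have "\<dots> \<le> ratio u * \<eta>"
            using that \<eta> diam_pos by (intro mult_right_mono) (auto simp: \<Gamma>_def field_simps)
          finally have "ball (word_map \<phi> u z) (A * \<rho>) \<subseteq> ball (word_map \<phi> u z) (ratio u * \<eta>)"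
            by (rule subset_ball)
          also have "\<dots> \<subseteq> word_map \<phi> u ` U" using word_map_ball[of u z \<eta>] \<eta>(2) by blast
          finally show ?thesis .
        qed
        show "disjoint_family_on (\<lambda>p. ball (case p of (k, u) \<Rightarrow> word_map \<phi> u z) (A * \<rho>)) F"
          unfolding disjoint_family_on_def
        proof (intro ballI impI)
          fix p p' assume p: "p \<in> F" "p' \<in> F" "p \<noteq> p'"
          obtain k u k' u' where eq: "p = (k, u)" "p' = (k', u')" by (metis prod.exhaust)
          have G: "(k, u) \<in> \<Gamma>" "(k', u') \<in> \<Gamma>" "(k, u) \<noteq> (k', u')" using p F(2) by (auto simp: eq)
          have "word_map \<phi> u ` U \<inter> word_map \<phi> u' ` U = {}"
            using U(3,4) inj_phi incomp[OF G] incomp[OF G(2,1)] G(3)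
            by (intro incomparable_images_disjoint) auto
          then show "ball (case p of (k, u) \<Rightarrow> word_map \<phi> u z) (A * \<rho>) \<inter>
              ball (case p' of (k, u) \<Rightarrow> word_map \<phi> u z) (A * \<rho>) = {}"
            using in_img[OF G(1)] in_img[OF G(2)] unfolding eq prod.case by blast
        qed
        fix p assume "p \<in> F"
        then obtain k u where eq: "p = (k, u)" and G: "(k, u) \<in> \<Gamma>" using F(2) by (metis prod.exhaust subsetD)
        have ru: "ratio u \<le> \<rho> / diam" "rmin ^ N * \<xi> \<le> ratio u * diam"
          using G \<xi>(3) diam_pos by (auto simp: \<Gamma>_def field_simps)
        obtain y where y: "y \<in> K" "dist x (word_map \<phi> u y) < \<rho>" using G by (auto simp: \<Gamma>_def)
        have "dist x (word_map \<phi> u z) < \<rho> + ratio u * dist z y"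
          using dist_triangle[of x "word_map \<phi> u z" "word_map \<phi> u y"] y(2)
          by (simp add: dist_commute dist_word_map)
        also have "ratio u * dist z y \<le> \<rho> / diam * M"
          using ru M[OF y(1)] \<rho>(1) diam_pos by (intro mult_mono) auto
        finally have d: "dist x (word_map \<phi> u z) < \<rho> + \<rho> / diam * M" by simp
        have "A * \<rho> = rmin ^ N * \<xi> / diam * \<eta>" by (simp add: A_def \<xi>_def)
        also have "\<dots> \<le> \<rho> / diam * \<eta>"
          using ru \<eta> diam_pos by (intro mult_right_mono) (auto simp: field_simps intro: order_trans)
        finally have Ar: "A * \<rho> \<le> \<rho> / diam * \<eta>" .
        show "ball (case p of (k, u) \<Rightarrow> word_map \<phi> u z) (A * \<rho>) \<subseteq> ball x (B * \<rho>)"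
        proof
          fix t assume "t \<in> ball (case p of (k, u) \<Rightarrow> word_map \<phi> u z) (A * \<rho>)"
          then have "dist (word_map \<phi> u z) t < A * \<rho>" by (simp add: eq)
          then have "dist x t < \<rho> + \<rho> / diam * M + \<rho> / diam * \<eta>"
            using d Ar dist_triangle[of x t "word_map \<phi> u z"] by linarith
          also have "\<dots> = B * \<rho>" by (simp add: B_def algebra_simps)
          finally show "t \<in> ball x (B * \<rho>)" by simp
        qed
      qed (use F A B \<rho> in auto)
      then show ?thesis using \<rho> by simp
    qed
    \<comment> \<open>The definition ranges over all levels, so finiteness is itself a consequence
      of the packing bound on finite subsets.\<close>
    have "finite \<Gamma> \<and> card \<Gamma> \<le> nat \<lfloor>(B / A) ^ DIM('b)\<rfloor>"
    proof (rule finite_if_finite_subsets_card_bdd)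
      fix G assume "G \<subseteq> \<Gamma>" "finite G"
      then show "card G \<le> nat \<lfloor>(B / A) ^ DIM('b)\<rfloor>" using card_le[of G] by (simp add: le_nat_floor)
    qed
    then have fin: "finite \<Gamma>" by blast
    have "emeasure (\<mu> v) (ball x \<rho>) = emeasure choices {\<omega>. endpoint v \<omega> \<in> ball x \<rho>}"
      by (simp add: emeasure_\<mu>)
    also have "\<dots> \<le> emeasure choices (\<Union>(k, u)\<in>\<Gamma>. {\<omega>. path v k \<omega> = u})"
    proof (rule emeasure_mono_AE)
      show "AE \<omega> in choices. \<omega> \<in> {\<omega>. endpoint v \<omega> \<in> ball x \<rho>}
          \<longrightarrow> \<omega> \<in> (\<Union>(k, u)\<in>\<Gamma>. {\<omega>. path v k \<omega> = u})"
        using AE_choices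
      proof eventually_elim
        case (elim \<omega>)
        show ?case
        proof
          assume "\<omega> \<in> {\<omega>. endpoint v \<omega> \<in> ball x \<rho>}"
          then have e: "endpoint v \<omega> \<in> ball x \<rho>" by simp
          note p = path.simps(1)[of v \<omega>] path_step[OF elim, of v]
          obtain k where k: "ratio (path v k \<omega>) * diam < \<xi>" "rmin ^ N * \<xi> \<le> ratio (path v k \<omega>) * diam"
              "\<And>l. l < k \<Longrightarrow> \<xi> \<le> ratio (path v l \<omega>) * diam"
            using stopping_path[of "\<lambda>k. path v k \<omega>", OF p \<xi>(1,2)] by blast
          have "\<xi> \<le> ratio u' * diam" if "l < k" "u' \<in> lev v l" "path v k \<omega> = u' @ t" for l u' t
          proof -
            have "length u' = length (path v l \<omega>)"
              using length_lev[OF that(2)] path_length[of "\<lambda>k. path v k \<omega>", OF p] by simp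
            then have "u' = path v l \<omega>"
              using path_take[of "\<lambda>k. path v k \<omega>", OF p less_imp_le[OF that(1)]] that(3)
              by (metis append_eq_conv_conj)
            then show ?thesis using k(3)[OF that(1)] by simp
          qed
          then have "(k, path v k \<omega>) \<in> \<Gamma>"
            using k path_lev[of "\<lambda>k. path v k \<omega>", OF p] endpoint_mem(1)[OF elim, of v k] e
            by (auto simp: \<Gamma>_def)
          then show "\<omega> \<in> (\<Union>(k, u)\<in>\<Gamma>. {\<omega>. path v k \<omega> = u})" by blast
        qed
      qed
    qed (use fin sets_path in auto)
    also have "\<dots> \<le> (\<Sum>(k, u)\<in>\<Gamma>. emeasure choices {\<omega>. path v k \<omega> = u})"
      using emeasure_subadditive_finite[OF fin, of "\<lambda>(k, u). {\<omega>. path v k \<omega> = u}" choices] sets_path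
      by (auto simp: image_subset_iff case_prod_beta)
    also have "\<dots> \<le> (\<Sum>p\<in>\<Gamma>. ennreal (2 / diam powr s / mass v * \<rho> powr s))"
    proof (rule sum_mono)
      fix p assume "p \<in> \<Gamma>"
      then obtain k u where eq: "p = (k, u)" and u: "u \<in> lev v k" "ratio u * diam < \<xi>" by (auto simp: \<Gamma>_def)
      have "ratio u \<le> \<rho> / diam" using u(2) \<xi>(3) diam_pos by (auto simp: field_simps)
      then have "ratio u powr s \<le> (\<rho> / diam) powr s" using s_pos by (intro powr_mono2) auto
      then have "mass u / mass v \<le> 2 * (\<rho> / diam) powr s / mass v"
        unfolding mass_def[of u] using m_le_2[of u] m_ge_1[of u] mass_pos[of v]
        by (intro divide_right_mono mult_mono) auto
      also have "\<dots> = 2 / diam powr s / mass v * \<rho> powr s"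
        using \<rho> diam_pos by (simp add: powr_divide)
      finally show "(case p of (k, u) \<Rightarrow> emeasure choices {\<omega>. path v k \<omega> = u})
          \<le> ennreal (2 / diam powr s / mass v * \<rho> powr s)"
        using measure_path[OF u(1)] by (simp add: eq choices.emeasure_eq_measure ennreal_leI)
    qed
    also have "\<dots> = ennreal (card \<Gamma> * (2 / diam powr s / mass v * \<rho> powr s))"
      using diam_pos mass_pos[of v] by (simp add: ennreal_mult[symmetric] ennreal_of_nat_eq_real_of_nat)
    also have "\<dots> \<le> ennreal (C * \<rho> powr s)"
    proof (rule ennreal_leI)
      have "card \<Gamma> * (2 / diam powr s / mass v * \<rho> powr s)
          \<le> (B / A) ^ DIM('b) * (2 / diam powr s / mass v * \<rho> powr s)"
        using card_le[OF fin order_refl] diam_pos mass_pos[of v]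
        by (intro mult_right_mono) (auto intro!: mult_nonneg_nonneg divide_nonneg_pos)
      then show "card \<Gamma> * (2 / diam powr s / mass v * \<rho> powr s) \<le> C * \<rho> powr s"
        by (simp add: C_def mult_ac)
    qed
    finally show ?thesis .
  qed
  then show ?thesis using that[OF C] by blast
qed

lemma measure_support_\<mu>: "measure_support (\<mu> v) = D v"
proof (rule set_eqI)
  fix x
  show "x \<in> measure_support (\<mu> v) \<longleftrightarrow> x \<in> D v"
  proof
    assume x: "x \<in> D v"
    have "emeasure (\<mu> v) (ball x e) > 0" if "e > 0" for e
    proof -
      let ?e = "min e (1/2)"
      have "0 < ennreal ((rmin ^ N * scale v / diam) powr s / mass v * ?e powr s)"
        using rmin_pos scale_pos[of v] diam_pos mass_pos[of v] that by (simp add: min_def)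
      also have "\<dots> \<le> emeasure (\<mu> v) (ball x ?e)" using x that by (intro \<mu>_ball_ge) auto
      also have "\<dots> \<le> emeasure (\<mu> v) (ball x e)" by (intro emeasure_mono) auto
      finally show ?thesis .
    qed
    then show "x \<in> measure_support (\<mu> v)" by (simp add: measure_support_def)
  next
    assume x: "x \<in> measure_support (\<mu> v)"
    show "x \<in> D v"
    proof (rule ccontr)
      assume "x \<notin> D v"
      then have "open (- D v)" "x \<in> - D v" using compact_imp_closed[OF compact_D, of v] by auto
      then obtain e where e: "e > 0" "ball x e \<subseteq> - D v" using openE by blast
      have "emeasure choices {\<omega>. endpoint v \<omega> \<in> ball x e} = 0"
      proof -
        have "AE \<omega> in choices. \<not> endpoint v \<omega> \<in> ball x e"
          using AE_choices by eventually_elim (use e(2) endpoint_mem(2) in blast)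
        from emeasure_eq_0_AE[OF this] show ?thesis by simp
      qed
      then have "emeasure (\<mu> v) (ball x e) = 0" by (simp add: emeasure_\<mu>)
      then show False using x e(1) by (auto simp: measure_support_def)
    qed
  qed
qed

theorem ahlfors_regular_dim_D:
  assumes "open_set_condition \<phi>"
  shows "ahlfors_regular_dim s (D v)"
proof -
  obtain C where C: "C > 0" "\<And>x \<rho>. 0 < \<rho> \<Longrightarrow> \<rho> < 1 \<Longrightarrow> emeasure (\<mu> v) (ball x \<rho>) \<le> ennreal (C * \<rho> powr s)"
    using \<mu>_ball_le[OF assms, of v] by blast
  have "0 < (rmin ^ N * scale v / diam) powr s / mass v"
    using rmin_pos scale_pos[of v] diam_pos mass_pos[of v] by simp
  then show ?thesis
    unfolding ahlfors_regular_dim_def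
    using C \<mu>_ball_ge[of _ v] measure_support_\<mu>[of v] sets_\<mu>[of v] by blast
qed

theorem hausdorff_measure_D_nonzero:
  assumes "open_set_condition \<phi>" "0 \<le> t" "t \<le> s"
  shows "hausdorff_measure t (D v) \<noteq> 0"
proof -
  obtain C where C: "C > 0" "\<And>x \<rho>. 0 < \<rho> \<Longrightarrow> \<rho> < 1 \<Longrightarrow> emeasure (\<mu> v) (ball x \<rho>) \<le> ennreal (C * \<rho> powr s)"
    using \<mu>_ball_le[OF assms(1), of v] by blast
  have "emeasure (\<mu> v) (D v) = 1"
    using compact_imp_closed[OF compact_D, of v] by (intro emeasure_\<mu>_D) auto
  then show ?thesis
    using C assms compact_imp_closed[OF compact_D, of v] s_pos
    by (intro hausdorff_measure_nonzero[of "\<mu> v" _ C s]) auto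
qed

end

section \<open>Choosing children with balanced mass\<close>

lemma subset_sum_in_window:
  fixes g :: "'b \<Rightarrow> real"
  assumes "finite F" "F0 \<subseteq> F" "sum g F0 \<le> a" "a \<le> sum g F" and g: "\<And>x. x \<in> F \<Longrightarrow> g x \<le> \<delta>" and "0 \<le> \<delta>"
  obtains F' where "F0 \<subseteq> F'" "F' \<subseteq> F" "a \<le> sum g F'" "sum g F' \<le> a + \<delta>"
proof -
  have "finite F0" using assms(1,2) finite_subset by blast
  have "finite X \<Longrightarrow> X \<inter> F0 = {} \<Longrightarrow> a \<le> sum g (F0 \<union> X) \<Longrightarrow> (\<And>x. x \<in> X \<Longrightarrow> g x \<le> \<delta>) \<Longrightarrow>
     \<exists>F'. F0 \<subseteq> F' \<and> F' \<subseteq> F0 \<union> X \<and> a \<le> sum g F' \<and> sum g F' \<le> a + \<delta>" for X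
  proof (induction X rule: finite_induct)
    case empty
    then show ?case using assms(3) \<open>0 \<le> \<delta>\<close> by (intro exI[of _ F0]) auto
  next
    case (insert x X)
    show ?case
    proof (cases "a \<le> sum g (F0 \<union> X)")
      case True
      then obtain F' where "F0 \<subseteq> F'" "F' \<subseteq> F0 \<union> X" "a \<le> sum g F'" "sum g F' \<le> a + \<delta>"
        using insert by auto
      then show ?thesis by blast
    next
      \<comment> \<open>The sum is still below \<open>a\<close> before \<open>x\<close> is added and
        reaches \<open>a\<close> afterwards, so it overshoots by at most \<open>g x\<close>.\<close>
      case False
      have "x \<notin> F0 \<union> X" using insert.hyps insert.prems(1) by blast
      then have "sum g (F0 \<union> insert x X) = g x + sum g (F0 \<union> X)"
        using insert.hyps \<open>finite F0\<close> by simp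
      then show ?thesis using False insert.prems(2) insert.prems(3)[of x]
        by (intro exI[of _ "F0 \<union> insert x X"]) auto
    qed
  qed
  from this[of "F - F0"] show ?thesis
    using that assms by (auto simp: Un_absorb1)
qed

text \<open>Which children are kept at a word depends on its correction, and this depends on what
  was kept at its ancestors, hence a recursion on the number of blocks. \<open>Z u c\<close> stands
  for the weight kept at \<open>u\<close> when its correction is \<open>c\<close>. Blocks are
  counted from the end of the word, so a starting vertex of any length is allowed; its correction
  need not be 1.\<close>

primrec correction :: "nat \<Rightarrow> ('b list \<Rightarrow> real \<Rightarrow> real) \<Rightarrow> nat \<Rightarrow> 'b list \<Rightarrow> real" where
  "correction N Z 0 v = 1"
| "correction N Z (Suc k) v = (let u = take (length v - N) v; c = correction N Z k u in c / Z u c)"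

context similarity_system begin

text \<open>The predicate \<open>P\<close> passes from a word to the children offered by
  \<open>A\<close>, and so along every selected path. It will say that the word lies in the random
  tree and has a good subtree. The choice \<open>M \<ge> 2\<close> turns the bound on the whole
  transversal family into a bound 1/4 on each single word.\<close>

theorem subtree_fractal:
  fixes A :: "'i list \<Rightarrow> 'i list set" and M :: nat
  assumes N: "0 < N" and s: "0 < s" and c: "0 < c"
    and length_A: "\<And>u w. w \<in> A u \<Longrightarrow> length w = N"
    and transversal: "\<And>u. \<exists>F\<subseteq>A u. card F \<le> M \<and>
          (\<forall>L\<in>affine_hyperplanes. \<exists>w\<in>F. \<forall>y\<in>cyl w. \<forall>z\<in>L. c \<le> dist y z)"
    and small: "real M * (rmax ^ N) powr s \<le> 1 / 2" "M \<ge> 2"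
    and large: "\<And>u. 1 \<le> (\<Sum>w\<in>A u. ratio w powr s)"
    and P: "P v" "\<And>u w. P u \<Longrightarrow> w \<in> A u \<Longrightarrow> P (u @ w)"
  obtains D where "D \<noteq> {}" "compact D" "hyperplane_diffuse D"
    "\<And>x. x \<in> D \<Longrightarrow> \<exists>j. x = coding_map \<phi> j \<and> (\<forall>k. P (prefix_word j (length v + k * N)))"
    "open_set_condition \<phi> \<Longrightarrow> ahlfors_regular_dim s D"
    "\<And>t. open_set_condition \<phi> \<Longrightarrow> 0 \<le> t \<Longrightarrow> t \<le> s \<Longrightarrow> hausdorff_measure t D \<noteq> 0"
proof -
  have finite_A: "finite (A u)" for u
    by (rule finite_subset[OF _ finite_words_length[of N]]) (auto dest: length_A)
  have ratio_small: "ratio w powr s \<le> (rmax ^ N) powr s" if "w \<in> A u" for w u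
    using ratio_le_rmax[of w] length_A[OF that] s by (intro powr_mono2) auto
  have quarter: "(rmax ^ N) powr s \<le> 1 / 4"
  proof -
    have "2 * (rmax ^ N) powr s \<le> real M * (rmax ^ N) powr s"
      using small(2) by (intro mult_right_mono) auto
    then show ?thesis using small(1) by linarith
  qed
  \<comment> \<open>Here \<open>x\<close> is the correction at \<open>u\<close>. A transversal
    family weighs at most 1/2, hence at most \<open>x / 2\<close>, and adding words of weight at
    most 1/4 lands in [x/2, x/2 + 1/4], inside [x/2, x]. The guard on \<open>x\<close> lets the
    selection be a total function.\<close>
  have "\<exists>F\<subseteq>A u. (\<forall>L\<in>affine_hyperplanes. \<exists>w\<in>F. \<forall>y\<in>cyl w. \<forall>z\<in>L. c \<le> dist y z)
      \<and> (1 \<le> x \<longrightarrow> x \<le> 2 \<longrightarrow> x / 2 \<le> (\<Sum>w\<in>F. ratio w powr s) \<and> (\<Sum>w\<in>F. ratio w powr s) \<le> x)" for u and x :: real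
  proof (cases "1 \<le> x \<and> x \<le> 2")
    case True
    obtain F0 where F0: "F0 \<subseteq> A u" "card F0 \<le> M"
      "\<forall>L\<in>affine_hyperplanes. \<exists>w\<in>F0. \<forall>y\<in>cyl w. \<forall>z\<in>L. c \<le> dist y z"
      using transversal[of u] by - (elim exE conjE, rule that)
    have "(\<Sum>w\<in>F0. ratio w powr s) \<le> (\<Sum>w\<in>F0. (rmax ^ N) powr s)"
      using F0(1) by (intro sum_mono ratio_small[of _ u]) auto
    also have "\<dots> \<le> real M * (rmax ^ N) powr s" using F0(2) by (simp add: mult_right_mono)
    finally have low: "(\<Sum>w\<in>F0. ratio w powr s) \<le> x / 2" using small(1) True by linarith
    have high: "x / 2 \<le> (\<Sum>w\<in>A u. ratio w powr s)" using large[of u] True by linarith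
    have weight: "ratio w powr s \<le> 1 / 4" if "w \<in> A u" for w
      using ratio_small[OF that] quarter by linarith
    obtain F where F: "F0 \<subseteq> F" "F \<subseteq> A u" "x / 2 \<le> (\<Sum>w\<in>F. ratio w powr s)"
        "(\<Sum>w\<in>F. ratio w powr s) \<le> x / 2 + 1 / 4"
      by (rule subset_sum_in_window[OF finite_A F0(1) low high weight _ that]) auto
    have "\<forall>L\<in>affine_hyperplanes. \<exists>w\<in>F. \<forall>y\<in>cyl w. \<forall>z\<in>L. c \<le> dist y z"
      using F0(3) F(1) by blast
    moreover have "(\<Sum>w\<in>F. ratio w powr s) \<le> x" using F(4) True by linarith
    ultimately show ?thesis using F(2,3) by (intro exI[of _ F]) simp
  next
    case False
    then show ?thesis using transversal[of u] by blast
  qed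
  then obtain S where S: "\<And>u x. S u x \<subseteq> A u"
    "\<And>u x L. L \<in> affine_hyperplanes \<Longrightarrow> \<exists>w\<in>S u x. \<forall>y\<in>cyl w. \<forall>z\<in>L. c \<le> dist y z"
    "\<And>u x. 1 \<le> x \<Longrightarrow> x \<le> 2 \<Longrightarrow> x / 2 \<le> (\<Sum>w\<in>S u x. ratio w powr s)"
    "\<And>u x. 1 \<le> x \<Longrightarrow> x \<le> 2 \<Longrightarrow> (\<Sum>w\<in>S u x. ratio w powr s) \<le> x"
    by metis
  define Z where "Z u x = (\<Sum>w\<in>S u x. ratio w powr s)" for u x
  define m where "m u = correction N Z (length u div N) u" for u
  define R where "R u = S u (m u)" for u
  have corr: "1 \<le> correction N Z k u \<and> correction N Z k u \<le> 2" for k u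
  proof (induction k arbitrary: u)
    case (Suc k)
    let ?u = "take (length u - N) u" let ?c = "correction N Z k ?u"
    have c: "1 \<le> ?c" "?c \<le> 2" using Suc by auto
    then have "?c / 2 \<le> Z ?u ?c" "Z ?u ?c \<le> ?c" using S(3)[OF c] S(4)[OF c] unfolding Z_def by blast+
    moreover from this c have "0 < Z ?u ?c" by linarith
    ultimately show ?case by (simp add: Let_def field_simps)
  qed simp
  interpret T: weighted_word_tree \<phi> r R N m s
  proof
    show "length w = N" if "w \<in> R u" for u w
      using that S(1) length_A unfolding R_def by blast
    then show "m (u @ w) * (\<Sum>w\<in>R u. ratio w powr s) = m u" if "w \<in> R u" for u w
    proof -
      have "length w = N" using that S(1) length_A unfolding R_def by blast
      moreover from this have "m (u @ w) = m u / Z u (m u)" using N by (simp add: m_def Let_def)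
      moreover have "Z u (m u) > 0"
        using corr[of "length u div N" u] S(3)[of "m u" u] unfolding Z_def m_def by linarith
      ultimately show ?thesis by (simp add: R_def Z_def)
    qed
    show "R u \<noteq> {}" for u
      using ex_hyperplane S(2) unfolding R_def by blast
    show "1 \<le> m u" "m u \<le> 2" for u using corr by (simp_all add: m_def)
  qed (use N s in auto)
  have lev_P: "u \<in> T.lev v k \<Longrightarrow> P u" for u k
  proof (induction k arbitrary: u)
    case 0
    then show ?case using P(1) by simp
  next
    case (Suc k)
    then obtain u' w where "u' \<in> T.lev v k" "w \<in> R u'" "u = u' @ w"
      unfolding T.lev_Suc_snoc by blast
    then show ?case using Suc.IH P(2) S(1) unfolding R_def by blast
  qed
  show ?thesis
  proof (rule that)
    show "T.D v \<noteq> {}" by (rule T.D_nonempty)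
    show "compact (T.D v)" by (rule T.compact_D)
    show "hyperplane_diffuse (T.D v)"
      using c by (rule T.hyperplane_diffuse_D) (unfold R_def, rule S(2))
    show "\<exists>j. x = coding_map \<phi> j \<and> (\<forall>k. P (prefix_word j (length v + k * N)))" if "x \<in> T.D v" for x
      using T.D_code[OF that] lev_P by metis
    show "open_set_condition \<phi> \<Longrightarrow> ahlfors_regular_dim s (T.D v)"
      by (rule T.ahlfors_regular_dim_D)
    show "hausdorff_measure t (T.D v) \<noteq> 0" if "open_set_condition \<phi>" "0 \<le> t" "t \<le> s" for t
      using that by (rule T.hausdorff_measure_D_nonzero)
  qed
qed

end

subsection \<open>The branching property of the Galton--Watson space\<close>

definition below :: "'i list \<Rightarrow> ('i list \<Rightarrow> 'b) \<Rightarrow> 'i list \<Rightarrow> 'b" where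
  "below v \<omega> = (\<lambda>w. \<omega> (v @ w))"

lemma below_Nil [simp]: "below [] \<omega> = \<omega>"
  by (simp add: below_def)

lemma below_below: "below w (below v \<omega>) = below (v @ w) \<omega>"
  by (simp add: below_def)

text \<open>This is the inverse of splitting a sample point into the root offspring and the
  configurations below all letters, including letters that are not offspring of the root.\<close>

definition graft :: "'b \<times> ('i \<Rightarrow> 'i list \<Rightarrow> 'b) \<Rightarrow> 'i list \<Rightarrow> 'b" where
  "graft p = (\<lambda>w. case w of [] \<Rightarrow> fst p | i # v \<Rightarrow> snd p i v)"

lemma graft_simps [simp]: "graft p [] = fst p" "below [i] (graft p) = snd p i"
  by (simp_all add: graft_def below_def)

lemma space_gw [simp]: "space (gw_space W) = UNIV"
  by (simp add: gw_space_def)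

lemma prob_space_gw: "prob_space (gw_space W)"
  unfolding gw_space_def by (rule prob_space_PiM_pmf)

lemma measurable_gw_component [measurable]:
  "(\<lambda>\<omega>. \<omega> t) \<in> measurable (gw_space W) (count_space UNIV)"
  unfolding gw_space_def by (rule measurable_PiM_pmf_component)

lemma measurable_root_indicator [measurable]:
  "(\<lambda>\<omega>. indicator {S} (\<omega> []) :: real) \<in> borel_measurable (gw_space W)"
  by (rule measurable_compose[OF measurable_gw_component]) simp

lemma measurable_into_gw:
  assumes "\<And>t. (\<lambda>x. f x t) \<in> measurable M (count_space UNIV)"
  shows "f \<in> measurable M (gw_space W)"
  unfolding gw_space_def
proof (rule measurable_PiM_single')
  show "(\<lambda>x. f x t) \<in> measurable M (measure_pmf W)" for t using assms[of t] by simp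
qed auto

lemma measurable_below [measurable]: "below v \<in> measurable (gw_space W) (gw_space W)"
  by (rule measurable_into_gw) (simp add: below_def)

lemma measurable_graft:
  "graft \<in> measurable (measure_pmf W \<Otimes>\<^sub>M PiM UNIV (\<lambda>_. gw_space W)) (gw_space W)"
proof (rule measurable_into_gw)
  fix t :: "'a list"
  show "(\<lambda>p. graft p t) \<in> measurable (measure_pmf W \<Otimes>\<^sub>M PiM UNIV (\<lambda>_. gw_space W)) (count_space UNIV)"
  proof (cases t)
    case Nil
    have "fst \<in> measurable (measure_pmf W \<Otimes>\<^sub>M PiM UNIV (\<lambda>_::'a. gw_space W)) (measure_pmf W)"
      by (rule measurable_fst)
    then show ?thesis by (simp add: Nil)
  next
    case (Cons i v)
    have "(\<lambda>p. snd p i) \<in> measurable (measure_pmf W \<Otimes>\<^sub>M PiM UNIV (\<lambda>_. gw_space W)) (gw_space W)"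
      by (rule measurable_compose[OF measurable_snd measurable_component_singleton]) simp
    from measurable_compose[OF this measurable_gw_component, of v]
    show ?thesis by (simp add: Cons graft_def)
  qed
qed

text \<open>The branching property: the root offspring and the first-generation subtrees are
  independent, and each subtree has the law of the whole tree.\<close>

lemma distr_graft:
  fixes W :: "'i::finite set pmf"
  shows "distr (measure_pmf W \<Otimes>\<^sub>M PiM UNIV (\<lambda>_. gw_space W)) (gw_space W) graft = gw_space W"
    (is "distr ?P _ _ = _")
proof -
  interpret M: product_prob_space "\<lambda>_::'i list. measure_pmf W" UNIV
    by unfold_locales
  interpret gw: prob_space "gw_space W" by (rule prob_space_gw)
  interpret G: product_prob_space "\<lambda>_::'i. gw_space W" UNIV
    by unfold_locales
  have "distr ?P (gw_space W) graft = PiM UNIV (\<lambda>_. measure_pmf W)"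
  proof (rule M.PiM_eq)
    show "sets (distr ?P (gw_space W) graft) = sets (PiM UNIV (\<lambda>_. measure_pmf W))"
      by (simp add: gw_space_def)
    fix J :: "'i list set" and F :: "'i list \<Rightarrow> 'i set set"
    assume J: "finite J"
    \<comment> \<open>A cylinder condition on \<open>J\<close> splits into one on the root, void
      when \<open>[]\<close> is not in \<open>J\<close>, and one on the tails \<open>J' i\<close>
      below each letter \<open>i\<close>. The product over \<open>J\<close> factors
      accordingly.\<close>
    define A0 where "A0 = (if [] \<in> J then F [] else UNIV)"
    define J' where "J' i = {v. i # v \<in> J}" for i
    define C where "C i = {g. \<forall>v\<in>J' i. g v \<in> F (i # v)}" for i
    have fin: "finite (J' i)" for i
      unfolding J'_def using J by (rule finite_vimageI[of _ "Cons i", unfolded vimage_def]) (simp add: inj_def)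
    have cyl: "prod_emb UNIV (\<lambda>_. measure_pmf W) H (Pi\<^sub>E H E) = {\<omega>. \<forall>v\<in>H. \<omega> v \<in> E v}" for H E
      by (auto simp: prod_emb_def PiE_iff Pi_iff restrict_def extensional_def)
    have eC: "emeasure (gw_space W) (C i) = (\<Prod>v\<in>J' i. emeasure W (F (i # v)))" for i
      using M.emeasure_PiM_emb[of "J' i" "\<lambda>v. F (i # v)"] fin by (simp add: C_def cyl gw_space_def)
    have sC: "C i \<in> sets (gw_space W)" for i
    proof -
      have "{\<omega>. \<omega> v \<in> F (i # v)} \<in> sets (gw_space W)" for v
        using measurable_sets[OF measurable_gw_component, of "F (i # v)" v W] by (simp add: vimage_def)
      then have "{\<omega> \<in> space (gw_space W). \<forall>v\<in>J' i. \<omega> v \<in> F (i # v)} \<in> sets (gw_space W)"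
        using fin by (intro sets.sets_Collect_finite_All) auto
      then show ?thesis by (simp add: C_def)
    qed
    have pre: "graft -` {\<omega>. \<forall>v\<in>J. \<omega> v \<in> F v} \<inter> space ?P = A0 \<times> (\<Pi>\<^sub>E i\<in>UNIV. C i)"
    proof -
      have "(\<forall>v\<in>J. graft p v \<in> F v) \<longleftrightarrow> fst p \<in> A0 \<and> (\<forall>i. snd p i \<in> C i)" for p :: "'i set \<times> ('i \<Rightarrow> 'i list \<Rightarrow> 'i set)"
      proof
        assume H: "\<forall>v\<in>J. graft p v \<in> F v"
        show "fst p \<in> A0 \<and> (\<forall>i. snd p i \<in> C i)"
          using H bspec[OF H, of "_ # _"] by (auto simp: A0_def C_def J'_def graft_def)
      next
        assume H: "fst p \<in> A0 \<and> (\<forall>i. snd p i \<in> C i)"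
        show "\<forall>v\<in>J. graft p v \<in> F v"
        proof
          fix v assume "v \<in> J"
          then show "graft p v \<in> F v"
            using H by (cases v) (auto simp: A0_def C_def J'_def graft_def split: if_splits)
        qed
      qed
      then show ?thesis
        by (auto simp: space_pair_measure space_PiM PiE_iff extensional_def)
    qed
    have splitJ: "J - {[]} = (\<Union>i. Cons i ` J' i)"
    proof (intro set_eqI iffI)
      fix v assume "v \<in> J - {[]}" then show "v \<in> (\<Union>i. Cons i ` J' i)"
        by (cases v) (auto simp: J'_def)
    qed (auto simp: J'_def)
    have "emeasure (distr ?P (gw_space W) graft) {\<omega>. \<forall>v\<in>J. \<omega> v \<in> F v} = emeasure ?P (A0 \<times> (\<Pi>\<^sub>E i\<in>UNIV. C i))"
    proof (subst emeasure_distr[OF measurable_graft])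
      have "{\<omega> \<in> space (gw_space W). \<forall>v\<in>J. \<omega> v \<in> F v} \<in> sets (gw_space W)"
        using J measurable_sets[OF measurable_gw_component, of "F _" _ W]
        by (intro sets.sets_Collect_finite_All) (auto simp: vimage_def)
      then show "{\<omega>. \<forall>v\<in>J. \<omega> v \<in> F v} \<in> sets (gw_space W)" by simp
    qed (simp only: pre)
    also have "\<dots> = emeasure W A0 * emeasure (PiM UNIV (\<lambda>_. gw_space W)) (\<Pi>\<^sub>E i\<in>UNIV. C i)"
      by (intro G.P.emeasure_pair_measure_Times sets_PiM_I_finite sC) auto
    also have "emeasure (PiM UNIV (\<lambda>_. gw_space W)) (\<Pi>\<^sub>E i\<in>UNIV. C i) = (\<Prod>i\<in>UNIV. emeasure (gw_space W) (C i))"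
      by (intro G.emeasure_PiM sC) auto
    also have "\<dots> = (\<Prod>i\<in>UNIV. \<Prod>v\<in>Cons i ` J' i. emeasure W (F v))"
      by (simp add: eC prod.reindex)
    also have "\<dots> = (\<Prod>v\<in>J - {[]}. emeasure W (F v))"
      unfolding splitJ using fin by (subst prod.UNION_disjoint) auto
    also have "emeasure W A0 * \<dots> = (\<Prod>v\<in>J. emeasure W (F v))"
    proof (cases "[] \<in> J")
      case True
      then show ?thesis using J by (simp add: A0_def prod.remove)
    next
      case False
      then show ?thesis
        using measure_pmf.emeasure_space_1[of W] by (simp add: A0_def)
    qed
    finally show "emeasure (distr ?P (gw_space W) graft) (prod_emb UNIV (\<lambda>_. measure_pmf W) J (Pi\<^sub>E J F))
        = (\<Prod>j\<in>J. emeasure (measure_pmf W) (F j))"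
      by (simp add: cyl)
  qed
  then show ?thesis by (simp add: gw_space_def)
qed

text \<open>This is Fubini after undoing the graft. The product runs over all letters rather than
  the letters of \<open>S\<close>, since subtrees are independent whether or not they are attached;
  choosing \<open>X i\<close> constantly 1 removes a letter.\<close>

lemma integral_branching:
  fixes W :: "'i::finite set pmf" and X :: "'i \<Rightarrow> ('i list \<Rightarrow> 'i set) \<Rightarrow> real"
  assumes X [measurable]: "\<And>i. X i \<in> borel_measurable (gw_space W)" and b: "\<And>i \<omega>. \<bar>X i \<omega>\<bar> \<le> C"
  shows "(\<integral>\<omega>. indicator {S} (\<omega> []) * (\<Prod>i\<in>UNIV. X i (below [i] \<omega>)) \<partial>gw_space W)
    = pmf W S * (\<Prod>i\<in>UNIV. \<integral>\<omega>. X i \<omega> \<partial>gw_space W)"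
proof -
  interpret gw: prob_space "gw_space W" by (rule prob_space_gw)
  interpret G: product_prob_space "\<lambda>_::'i. gw_space W" UNIV
    by unfold_locales
  let ?Q = "PiM UNIV (\<lambda>_::'i. gw_space W)"
  interpret PP: pair_prob_space "measure_pmf W" ?Q by unfold_locales
  let ?g = "\<lambda>\<omega>. indicator {S} (\<omega> []) * (\<Prod>i\<in>UNIV. X i (below [i] \<omega>))"
  have Xc [measurable]: "(\<lambda>f. X i (f i)) \<in> borel_measurable ?Q" for i
    by (rule measurable_compose[OF measurable_component_singleton[of i UNIV "\<lambda>_. gw_space W"] X]) simp
  have g [measurable]: "?g \<in> borel_measurable (gw_space W)"
    by measurable
  have C0: "0 \<le> C" using b[of undefined undefined] abs_ge_zero order_trans by blast
  have bP: "\<bar>\<Prod>i\<in>UNIV. X i (f i)\<bar> \<le> C ^ card (UNIV :: 'i set)" for f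
    unfolding abs_prod using b by (intro prod_mono[of UNIV _ "\<lambda>_. C", simplified]) auto
  have fst_m [measurable]: "(\<lambda>p. indicator {S} (fst p) :: real) \<in> borel_measurable (measure_pmf W \<Otimes>\<^sub>M ?Q)"
    by (rule measurable_compose[OF measurable_fst]) simp
  have "(\<integral>\<omega>. ?g \<omega> \<partial>gw_space W) = (\<integral>\<omega>. ?g \<omega> \<partial>distr (measure_pmf W \<Otimes>\<^sub>M ?Q) (gw_space W) graft)"
    by (simp add: distr_graft)
  also have "\<dots> = (\<integral>p. ?g (graft p) \<partial>(measure_pmf W \<Otimes>\<^sub>M ?Q))"
    by (rule integral_distr[OF measurable_graft g])
  also have "\<dots> = (\<integral>p. indicator {S} (fst p) * (\<Prod>i\<in>UNIV. X i (snd p i)) \<partial>(measure_pmf W \<Otimes>\<^sub>M ?Q))"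
    by simp
  also have "\<dots> = (\<integral>x. \<integral>f. indicator {S} x * (\<Prod>i\<in>UNIV. X i (f i)) \<partial>?Q \<partial>measure_pmf W)"
  proof (subst PP.integral_fst'[symmetric])
    have "(\<lambda>p. indicator {S} (fst p) * (\<Prod>i\<in>UNIV. X i (snd p i)) :: real) \<in> borel_measurable (measure_pmf W \<Otimes>\<^sub>M ?Q)"
      using measurable_compose[OF measurable_snd Xc] by measurable
    moreover have "\<bar>indicator {S} x * (\<Prod>i\<in>UNIV. X i (f i))\<bar> \<le> C ^ card (UNIV :: 'i set)" for x f
      using bP[of f] C0 by (auto simp: indicator_def abs_mult)
    ultimately show "integrable (measure_pmf W \<Otimes>\<^sub>M ?Q) (\<lambda>p. indicator {S} (fst p) * (\<Prod>i\<in>UNIV. X i (snd p i)))"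
      by (intro PP.P.integrable_const_bound[where B = "C ^ card (UNIV :: 'i set)"]) auto
  qed simp
  also have "\<dots> = (\<integral>x. indicator {S} x * (\<integral>f. (\<Prod>i\<in>UNIV. X i (f i)) \<partial>?Q) \<partial>measure_pmf W)"
    by simp
  also have "\<dots> = pmf W S * (\<integral>f. (\<Prod>i\<in>UNIV. X i (f i)) \<partial>?Q)"
    by (simp add: measure_pmf_single)
  also have "(\<integral>f. (\<Prod>i\<in>UNIV. X i (f i)) \<partial>?Q) = (\<Prod>i\<in>UNIV. \<integral>\<omega>. X i \<omega> \<partial>gw_space W)"
    using b by (intro G.product_integral_prod gw.integrable_const_bound[where B = C]) auto
  finally show ?thesis .
qed

subsection \<open>Moments of weighted generation sizes\<close>

lemma length_gw_level: "v \<in> gw_level \<omega> n \<Longrightarrow> length v = n"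
  by (induction n arbitrary: v) auto

lemma gw_level_snoc: "v @ [j] \<in> gw_level \<omega> (Suc n) \<longleftrightarrow> v \<in> gw_level \<omega> n \<and> j \<in> \<omega> v"
  by auto

lemma gw_level_append:
  "u @ w \<in> gw_level \<omega> (length u + length w) \<longleftrightarrow> u \<in> gw_level \<omega> (length u) \<and> w \<in> gw_level (below u \<omega>) (length w)"
proof (induction w rule: rev_induct)
  case (snoc j w)
  show ?case
    using snoc gw_level_snoc[of "u @ w" j \<omega> "length u + length w"] gw_level_snoc[of w j "below u \<omega>" "length w"]
    by (simp add: below_def del: gw_level.simps)
qed simp

lemma gw_level_Cons: "i # w \<in> gw_level \<omega> (Suc n) \<longleftrightarrow> i \<in> \<omega> [] \<and> w \<in> gw_level (below [i] \<omega>) n"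
proof (cases "length w = n")
  case True
  then show ?thesis
    using gw_level_append[of "[i]" w \<omega>] by simp
next
  case False
  then show ?thesis using length_gw_level by fastforce
qed

lemma gw_level_Suc: "gw_level \<omega> (Suc n) = (\<Union>i\<in>\<omega> []. Cons i ` gw_level (below [i] \<omega>) n)"
proof (intro set_eqI)
  fix v
  show "v \<in> gw_level \<omega> (Suc n) \<longleftrightarrow> v \<in> (\<Union>i\<in>\<omega> []. Cons i ` gw_level (below [i] \<omega>) n)"
  proof (cases v)
    case Nil
    then show ?thesis using length_gw_level[of v \<omega> "Suc n"] by auto
  next
    case (Cons i w)
    then show ?thesis using gw_level_Cons[of i w \<omega> n] by auto
  qed
qed

lemma finite_gw_level: "finite (gw_level \<omega> n :: 'i::finite list set)"
  by (rule finite_subset[OF _ finite_words_length[of n]]) (auto dest: length_gw_level)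

lemma gw_tree_iff: "v \<in> gw_tree \<omega> \<longleftrightarrow> v \<in> gw_level \<omega> (length v)"
  unfolding gw_tree_def using length_gw_level by blast

lemma gw_tree_append: "u @ w \<in> gw_tree \<omega> \<longleftrightarrow> u \<in> gw_tree \<omega> \<and> w \<in> gw_tree (below u \<omega>)"
  using gw_level_append by (simp add: gw_tree_iff)

lemma gw_tree_Cons: "i # w \<in> gw_tree \<omega> \<longleftrightarrow> i \<in> \<omega> [] \<and> w \<in> gw_tree (below [i] \<omega>)"
  by (simp add: gw_tree_iff gw_level_Cons del: gw_level.simps)

lemma Nil_gw_tree [simp]: "[] \<in> gw_tree \<omega>"
  by (simp add: gw_tree_iff)

lemma sets_gw_root: "{\<omega>. \<omega> t \<in> A} \<in> sets (gw_space W)"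
  using measurable_sets[OF measurable_gw_component, of A t W] by (simp add: vimage_def)

lemma sets_below: "G \<in> sets (gw_space W) \<Longrightarrow> {\<omega>. below v \<omega> \<in> G} \<in> sets (gw_space W)"
  using measurable_sets[OF measurable_below, of G W v] by (simp add: vimage_def)

lemma sets_gw_tree: "{\<omega>. v \<in> gw_tree \<omega>} \<in> sets (gw_space W)"
proof (induction v)
  case Nil
  then show ?case using sets.top[of "gw_space W"] by simp
next
  case (Cons i v)
  have "{\<omega>. i # v \<in> gw_tree \<omega>} = {\<omega>. \<omega> [] \<in> {S. i \<in> S}} \<inter> {\<omega>. below [i] \<omega> \<in> {\<omega>. v \<in> gw_tree \<omega>}}"
    by (auto simp: gw_tree_Cons)
  then show ?case using sets_gw_root sets_below[OF Cons] by (metis sets.Int)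
qed

text \<open>Recursion at the root matches the branching property. \<open>gw_weight_eq\<close>
  identifies the result as the total weight of those words of generation \<open>n\<close> whose
  subtree lies in \<open>G\<close>.\<close>

primrec gw_weight :: "('i::finite \<Rightarrow> real) \<Rightarrow> ('i list \<Rightarrow> 'i set) set \<Rightarrow> nat \<Rightarrow> ('i list \<Rightarrow> 'i set) \<Rightarrow> real" where
  "gw_weight c G 0 \<omega> = indicator G \<omega>"
| "gw_weight c G (Suc n) \<omega> = (\<Sum>i\<in>\<omega> []. c i * gw_weight c G n (below [i] \<omega>))"

lemma gw_weight_eq:
  "gw_weight c G n \<omega> = (\<Sum>w\<in>{w \<in> gw_level \<omega> n. below w \<omega> \<in> G}. prod_list (map c w))"
proof (induction n arbitrary: \<omega>)
  case 0
  have "{w \<in> gw_level \<omega> 0. below w \<omega> \<in> G} = (if \<omega> \<in> G then {[]} else {})" by auto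
  then show ?case by simp
next
  case (Suc n)
  let ?H = "\<lambda>i. {w \<in> gw_level (below [i] \<omega>) n. below w (below [i] \<omega>) \<in> G}"
  have eq: "{w \<in> gw_level \<omega> (Suc n). below w \<omega> \<in> G} = (\<Union>i\<in>\<omega> []. Cons i ` ?H i)"
    by (auto simp: gw_level_Suc below_below simp del: gw_level.simps)
  have fin: "finite (?H i)" for i by (simp add: finite_gw_level)
  have "(\<Sum>w\<in>(\<Union>i\<in>\<omega> []. Cons i ` ?H i). prod_list (map c w))
      = (\<Sum>i\<in>\<omega> []. \<Sum>w\<in>Cons i ` ?H i. prod_list (map c w))"
    by (intro sum.UNION_disjoint) (use fin in auto)
  then show ?case
    unfolding eq by (simp add: sum.reindex Suc sum_distrib_left)
qed

text \<open>Summing over all possible root sets turns the random index set into a fixed finite sum,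
  ready for linearity of the integral.\<close>

lemma gw_weight_Suc_indicator:
  "gw_weight c G (Suc n) \<omega> = (\<Sum>S\<in>UNIV. \<Sum>i\<in>S. c i * (indicator {S} (\<omega> []) * gw_weight c G n (below [i] \<omega>)))"
proof -
  have "(\<Sum>S\<in>UNIV. \<Sum>i\<in>S. c i * (indicator {S} (\<omega> []) * gw_weight c G n (below [i] \<omega>)))
     = (\<Sum>S\<in>UNIV. indicator {S} (\<omega> []) * (\<Sum>i\<in>S. c i * gw_weight c G n (below [i] \<omega>)))"
    by (simp add: sum_distrib_left mult_ac)
  also have "\<dots> = (\<Sum>S\<in>UNIV. if S = \<omega> [] then (\<Sum>i\<in>S. c i * gw_weight c G n (below [i] \<omega>)) else 0)"
    by (intro sum.cong) (auto simp: indicator_def)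
  finally show ?thesis by simp
qed

lemma measurable_gw_weight [measurable]:
  "G \<in> sets (gw_space W) \<Longrightarrow> gw_weight c G n \<in> borel_measurable (gw_space W)"
proof (induction n)
  case 0
  then show ?case by (simp add: borel_measurable_indicator)
next
  case (Suc n)
  have [measurable]: "(\<lambda>\<omega>. gw_weight c G n (below [i] \<omega>)) \<in> borel_measurable (gw_space W)" for i
    by (rule measurable_compose[OF measurable_below]) (rule Suc)+
  show ?case
    by (subst gw_weight_Suc_indicator[abs_def]) measurable
qed

lemma gw_weight_bounds:
  fixes c :: "'i::finite \<Rightarrow> real"
  assumes "\<And>i. 0 \<le> c i" "\<And>i. c i \<le> 1"
  shows "0 \<le> gw_weight c G n \<omega> \<and> gw_weight c G n \<omega> \<le> real (CARD('i)) ^ n"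
proof (induction n arbitrary: \<omega>)
  case (Suc n)
  have "gw_weight c G (Suc n) \<omega> \<le> (\<Sum>i\<in>\<omega> []. 1 * real (CARD('i)) ^ n)"
    unfolding gw_weight.simps using assms Suc by (intro sum_mono mult_mono) auto
  also have "\<dots> = real (card (\<omega> [])) * real (CARD('i)) ^ n" by simp
  also have "\<dots> \<le> real (CARD('i)) * real (CARD('i)) ^ n"
    by (intro mult_right_mono) (auto intro: card_mono)
  finally show ?case using assms Suc by (auto intro!: sum_nonneg mult_nonneg_nonneg)
qed simp

lemma integral_branching_single:
  fixes W :: "'i::finite set pmf"
  assumes f: "f \<in> borel_measurable (gw_space W)" "\<And>\<omega>. \<bar>f \<omega>\<bar> \<le> C"
  shows "(\<integral>\<omega>. indicator {S} (\<omega> []) * f (below [i] \<omega>) \<partial>gw_space W) = pmf W S * (\<integral>\<omega>. f \<omega> \<partial>gw_space W :: real)"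
proof -
  interpret gw: prob_space "gw_space W" by (rule prob_space_gw)
  define X where "X k = (if k = i then f else (\<lambda>_. 1))" for k
  have "(\<Prod>k\<in>UNIV. X k (below [k] \<omega>)) = f (below [i] \<omega>)" for \<omega>
  proof -
    have "(\<Prod>k\<in>UNIV. X k (below [k] \<omega>)) = (\<Prod>k\<in>UNIV. if k = i then f (below [k] \<omega>) else 1)"
      by (intro prod.cong) (auto simp: X_def)
    then show ?thesis by simp
  qed
  moreover have "(\<Prod>k\<in>UNIV. \<integral>\<omega>. X k \<omega> \<partial>gw_space W) = (\<integral>\<omega>. f \<omega> \<partial>gw_space W)"
  proof -
    have "(\<Prod>k\<in>UNIV. \<integral>\<omega>. X k \<omega> \<partial>gw_space W) = (\<Prod>k\<in>UNIV. if k = i then (\<integral>\<omega>. f \<omega> \<partial>gw_space W) else 1)"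
      by (intro prod.cong) (auto simp: X_def gw.prob_space[simplified])
    then show ?thesis by simp
  qed
  moreover have "\<bar>X k \<omega>\<bar> \<le> max C 1" "X k \<in> borel_measurable (gw_space W)" for k \<omega>
    using f(2)[of \<omega>] f(1) by (auto simp: X_def)
  ultimately show ?thesis using integral_branching[of X W "max C 1" S] by simp
qed

lemma integral_branching_pair:
  fixes W :: "'i::finite set pmf"
  assumes f: "f \<in> borel_measurable (gw_space W)" "\<And>\<omega>. \<bar>f \<omega>\<bar> \<le> C" and "i \<noteq> j"
  shows "(\<integral>\<omega>. indicator {S} (\<omega> []) * (f (below [i] \<omega>) * f (below [j] \<omega>)) \<partial>gw_space W)
    = pmf W S * (\<integral>\<omega>. f \<omega> \<partial>gw_space W :: real)\<^sup>2"
proof -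
  interpret gw: prob_space "gw_space W" by (rule prob_space_gw)
  define X where "X k = (if k \<in> {i, j} then f else (\<lambda>_. 1))" for k
  have "(\<Prod>k\<in>UNIV. X k (below [k] \<omega>)) = f (below [i] \<omega>) * f (below [j] \<omega>)" for \<omega>
  proof -
    have "(\<Prod>k\<in>UNIV. X k (below [k] \<omega>)) = (\<Prod>k\<in>{i, j}. f (below [k] \<omega>))"
      by (rule prod.mono_neutral_cong_right) (auto simp: X_def)
    then show ?thesis using \<open>i \<noteq> j\<close> by simp
  qed
  moreover have "(\<Prod>k\<in>UNIV. \<integral>\<omega>. X k \<omega> \<partial>gw_space W) = (\<integral>\<omega>. f \<omega> \<partial>gw_space W)\<^sup>2"
  proof -
    have "(\<Prod>k\<in>UNIV. \<integral>\<omega>. X k \<omega> \<partial>gw_space W) = (\<Prod>k\<in>{i, j}. \<integral>\<omega>. f \<omega> \<partial>gw_space W)"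
      by (rule prod.mono_neutral_cong_right) (auto simp: X_def gw.prob_space[simplified])
    then show ?thesis using \<open>i \<noteq> j\<close> by (simp add: power2_eq_square)
  qed
  moreover have "\<bar>X k \<omega>\<bar> \<le> max C 1" "X k \<in> borel_measurable (gw_space W)" for k \<omega>
    using f(2)[of \<omega>] f(1) by (auto simp: X_def)
  ultimately show ?thesis using integral_branching[of X W "max C 1" S] by simp
qed

text \<open>A pointwise quadratic bound replaces the Cauchy-Schwarz inequality: where
  \<open>X\<close> is at least half its mean, (tX - 1)^2 \<ge> 0 bounds it by t X^2 / 2 +
  1/(2t).\<close>

lemma (in prob_space) paley_zygmund_half:
  assumes X: "integrable M X" "integrable M (\<lambda>x. (X x)\<^sup>2)" and pos: "expectation X > 0"
    and V: "expectation (\<lambda>x. (X x)\<^sup>2) \<le> V"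
  shows "(expectation X)\<^sup>2 / (4 * V) \<le> prob {x \<in> space M. expectation X / 2 \<le> X x}"
proof -
  define e where "e = expectation X"
  have [measurable]: "X \<in> borel_measurable M" using X(1) by simp
  have "e\<^sup>2 \<le> expectation (\<lambda>x. (X x)\<^sup>2)"
  proof -
    have "0 \<le> expectation (\<lambda>x. (X x - e)\<^sup>2)" by simp
    also have "expectation (\<lambda>x. (X x - e)\<^sup>2) = expectation (\<lambda>x. (X x)\<^sup>2) - e\<^sup>2"
      unfolding e_def using X by (rule variance_eq)
    finally show ?thesis by simp
  qed
  then have Vpos: "V > 0" using V pos unfolding e_def
    by (meson less_le_trans order_trans zero_less_power)
  define F where "F = {x \<in> space M. e / 2 \<le> X x}"
  have F: "F \<in> events" unfolding F_def by measurable
  \<comment> \<open>With this value the quadratic term integrates to at most a quarter of the mean,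
    so another quarter must come from the event \<open>F\<close>.\<close>
  define t where "t = e / (2 * V)"
  have t: "t > 0" using pos Vpos by (simp add: t_def e_def)
  have "X x \<le> e / 2 + (t / 2 * (X x)\<^sup>2 + 1 / (2 * t) * indicator F x)" if "x \<in> space M" for x
  proof (cases "x \<in> F")
    case True
    have "0 \<le> (t * X x - 1)\<^sup>2" by simp
    then have "2 * t * X x \<le> t\<^sup>2 * (X x)\<^sup>2 + 1" by (simp add: power2_eq_square algebra_simps)
    then have "X x \<le> t / 2 * (X x)\<^sup>2 + 1 / (2 * t)" using t by (simp add: field_simps power2_eq_square)
    then show ?thesis using True pos by (simp add: e_def)
  next
    case False
    then have "X x \<le> e / 2" using that by (auto simp: F_def)
    moreover have "0 \<le> t / 2 * (X x)\<^sup>2" using t by simp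
    ultimately show ?thesis using False by simp
  qed
  moreover have iF: "integrable M (indicator F :: _ \<Rightarrow> real)"
    using F by (intro integrable_real_indicator) (auto simp: emeasure_eq_measure)
  ultimately have "expectation X \<le> expectation (\<lambda>x. e / 2 + (t / 2 * (X x)\<^sup>2 + 1 / (2 * t) * indicator F x))"
    using X by (intro integral_mono) auto
  also have "\<dots> = e / 2 + (t / 2 * expectation (\<lambda>x. (X x)\<^sup>2) + 1 / (2 * t) * prob F)"
    using X iF F by (simp add: prob_space)
  also have "\<dots> \<le> e / 2 + (t / 2 * V + 1 / (2 * t) * prob F)"
    using V t by simp
  also have "t / 2 * V = e / 4" using Vpos by (simp add: t_def)
  also have "1 / (2 * t) * prob F = V / e * prob F" using Vpos pos by (simp add: t_def)
  finally have le: "e / 4 \<le> V / e * prob F" unfolding e_def[symmetric] by linarith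
  have e: "e > 0" using pos by (simp add: e_def)
  have "e * (e / 4) \<le> e * (V / e * prob F)" using le e by (intro mult_left_mono) auto
  then have "e\<^sup>2 \<le> prob F * (4 * V)" using e by (simp add: power2_eq_square mult_ac)
  then have "e\<^sup>2 / (4 * V) \<le> prob F" using Vpos by (simp add: pos_divide_le_eq)
  then show ?thesis by (simp add: F_def e_def)
qed

definition mean_weight :: "'i::finite set pmf \<Rightarrow> ('i \<Rightarrow> real) \<Rightarrow> real" where
  "mean_weight W c = (\<Sum>S\<in>UNIV. pmf W S * (\<Sum>i\<in>S. c i))"

lemma expectation_gw_weight:
  fixes W :: "'i::finite set pmf"
  assumes c: "\<And>i. 0 \<le> c i" "\<And>i. c i \<le> 1" and G: "G \<in> sets (gw_space W)"
  shows "(\<integral>\<omega>. gw_weight c G n \<omega> \<partial>gw_space W) = measure (gw_space W) G * mean_weight W c ^ n"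
proof (induction n)
  case 0
  then show ?case using G by simp
next
  case (Suc n)
  interpret gw: prob_space "gw_space W" by (rule prob_space_gw)
  have b: "\<bar>gw_weight c G n \<omega>\<bar> \<le> real (CARD('i)) ^ n" for \<omega>
    using gw_weight_bounds[of c G n \<omega>, OF c] by simp
  have sh [measurable]: "(\<lambda>\<omega>. gw_weight c G n (below [i] \<omega>)) \<in> borel_measurable (gw_space W)" for i
    using measurable_compose[OF measurable_below measurable_gw_weight[OF G]] .
  have int: "integrable (gw_space W) (\<lambda>\<omega>. indicator {S} (\<omega> []) * gw_weight c G n (below [i] \<omega>))" for S i
    using b by (intro gw.integrable_const_bound[where B = "real (CARD('i)) ^ n"]) (auto simp: indicator_def)
  have "(\<integral>\<omega>. gw_weight c G (Suc n) \<omega> \<partial>gw_space W)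
      = (\<Sum>S\<in>UNIV. \<Sum>i\<in>S. c i * (\<integral>\<omega>. indicator {S} (\<omega> []) * gw_weight c G n (below [i] \<omega>) \<partial>gw_space W))"
    unfolding gw_weight_Suc_indicator using int by simp
  also have "\<dots> = (\<Sum>S\<in>UNIV. \<Sum>i\<in>S. c i * (pmf W S * (\<integral>\<omega>. gw_weight c G n \<omega> \<partial>gw_space W)))"
    by (subst integral_branching_single[OF measurable_gw_weight[OF G] b]) simp
  also have "\<dots> = mean_weight W c * (\<integral>\<omega>. gw_weight c G n \<omega> \<partial>gw_space W)"
    by (simp add: mean_weight_def sum_distrib_left sum_distrib_right mult_ac)
  finally show ?case using Suc by simp
qed

text \<open>Expand the square over pairs of root letters. Equal letters contribute the second moment
  with weight \<open>c i\<close> squared; distinct letters are independent and contribute the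
  squared mean. The squared mean is kept for equal letters as well, which completes the square of
  the weight of \<open>S\<close>.\<close>

lemma second_moment_gw_weight:
  fixes W :: "'i::finite set pmf"
  assumes c: "\<And>i. 0 \<le> c i" "\<And>i. c i \<le> 1" and G: "G \<in> sets (gw_space W)"
  shows "(\<integral>\<omega>. (gw_weight c G (Suc n) \<omega>)\<^sup>2 \<partial>gw_space W)
    \<le> mean_weight W (\<lambda>i. (c i)\<^sup>2) * (\<integral>\<omega>. (gw_weight c G n \<omega>)\<^sup>2 \<partial>gw_space W)
      + (\<Sum>S\<in>UNIV. pmf W S * (\<Sum>i\<in>S. c i)\<^sup>2) * (\<integral>\<omega>. gw_weight c G n \<omega> \<partial>gw_space W)\<^sup>2"
proof -
  interpret gw: prob_space "gw_space W" by (rule prob_space_gw)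
  let ?Y = "gw_weight c G n" let ?N = "real (CARD('i)) ^ n"
  define I where "I S i j = (\<integral>\<omega>. indicator {S} (\<omega> []) * (?Y (below [i] \<omega>) * ?Y (below [j] \<omega>)) \<partial>gw_space W)" for S i j
  have b0: "0 \<le> ?Y \<omega>" "?Y \<omega> \<le> ?N" for \<omega> using gw_weight_bounds[of c, OF c] by blast+
  have b: "\<bar>?Y \<omega>\<bar> \<le> ?N" for \<omega> using b0[of \<omega>] by simp
  have b2: "\<bar>?Y \<omega> * ?Y \<omega>'\<bar> \<le> ?N * ?N" for \<omega> \<omega>'
    unfolding abs_mult using b by (intro mult_mono) auto
  have Y [measurable]: "?Y \<in> borel_measurable (gw_space W)" using G by measurable
  have sh [measurable]: "(\<lambda>\<omega>. ?Y (below [i] \<omega>)) \<in> borel_measurable (gw_space W)" for i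
    using measurable_compose[OF measurable_below Y] .
  have int: "integrable (gw_space W) (\<lambda>\<omega>. indicator {S} (\<omega> []) * (?Y (below [i] \<omega>) * ?Y (below [j] \<omega>)))" for S i j
    using b2 by (intro gw.integrable_const_bound[where B = "?N * ?N"]) (auto simp: indicator_def)
  have sq: "(gw_weight c G (Suc n) \<omega>)\<^sup>2
      = (\<Sum>S\<in>UNIV. \<Sum>i\<in>S. \<Sum>j\<in>S. c i * c j * (indicator {S} (\<omega> []) * (?Y (below [i] \<omega>) * ?Y (below [j] \<omega>))))" for \<omega>
  proof -
    have "(\<Sum>S\<in>UNIV. \<Sum>i\<in>S. \<Sum>j\<in>S. c i * c j * (indicator {S} (\<omega> []) * (?Y (below [i] \<omega>) * ?Y (below [j] \<omega>))))
       = (\<Sum>S\<in>UNIV. if S = \<omega> [] then (\<Sum>i\<in>S. \<Sum>j\<in>S. (c i * ?Y (below [i] \<omega>)) * (c j * ?Y (below [j] \<omega>))) else 0)"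
      by (intro sum.cong refl) (auto simp: indicator_def mult_ac intro!: sum.cong)
    then show ?thesis by (simp add: power2_eq_square sum_product)
  qed
  have diag: "I S i i = pmf W S * (\<integral>\<omega>. (?Y \<omega>)\<^sup>2 \<partial>gw_space W)" for S i
    unfolding I_def power2_eq_square[symmetric]
  proof (rule integral_branching_single[where C = "?N * ?N"])
    show "\<bar>(?Y \<omega>)\<^sup>2\<bar> \<le> ?N * ?N" for \<omega> using b2[of \<omega> \<omega>] by (simp add: power2_eq_square)
  qed simp
  have off: "I S i j = pmf W S * (\<integral>\<omega>. ?Y \<omega> \<partial>gw_space W)\<^sup>2" if "i \<noteq> j" for S i j
    unfolding I_def using Y b that by (rule integral_branching_pair)
  have "(\<integral>\<omega>. (gw_weight c G (Suc n) \<omega>)\<^sup>2 \<partial>gw_space W) = (\<Sum>S\<in>UNIV. \<Sum>i\<in>S. \<Sum>j\<in>S. c i * c j * I S i j)"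
    unfolding sq I_def using int by simp
  also have "\<dots> \<le> (\<Sum>S\<in>UNIV. \<Sum>i\<in>S. \<Sum>j\<in>S. (if j = i then (c i)\<^sup>2 * (pmf W S * (\<integral>\<omega>. (?Y \<omega>)\<^sup>2 \<partial>gw_space W)) else 0)
      + c i * c j * (pmf W S * (\<integral>\<omega>. ?Y \<omega> \<partial>gw_space W)\<^sup>2))"
  proof (intro sum_mono)
    fix S i j
    show "c i * c j * I S i j \<le> (if j = i then (c i)\<^sup>2 * (pmf W S * (\<integral>\<omega>. (?Y \<omega>)\<^sup>2 \<partial>gw_space W)) else 0)
      + c i * c j * (pmf W S * (\<integral>\<omega>. ?Y \<omega> \<partial>gw_space W)\<^sup>2)"
      using c(1)[of i] c(1)[of j] by (cases "j = i") (auto simp: diag off power2_eq_square)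
  qed
  also have "\<dots> = (\<Sum>S\<in>UNIV. \<Sum>i\<in>S. (c i)\<^sup>2 * (pmf W S * (\<integral>\<omega>. (?Y \<omega>)\<^sup>2 \<partial>gw_space W)))
      + (\<Sum>S\<in>UNIV. \<Sum>i\<in>S. \<Sum>j\<in>S. c i * c j * (pmf W S * (\<integral>\<omega>. ?Y \<omega> \<partial>gw_space W)\<^sup>2))"
    by (simp add: sum.distrib)
  also have "(\<Sum>S\<in>UNIV. \<Sum>i\<in>S. (c i)\<^sup>2 * (pmf W S * (\<integral>\<omega>. (?Y \<omega>)\<^sup>2 \<partial>gw_space W)))
      = mean_weight W (\<lambda>i. (c i)\<^sup>2) * (\<integral>\<omega>. (?Y \<omega>)\<^sup>2 \<partial>gw_space W)"
    by (simp add: mean_weight_def sum_distrib_left sum_distrib_right mult_ac)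
  also have "(\<Sum>S\<in>UNIV. \<Sum>i\<in>S. \<Sum>j\<in>S. c i * c j * (pmf W S * (\<integral>\<omega>. ?Y \<omega> \<partial>gw_space W)\<^sup>2))
      = (\<Sum>S\<in>UNIV. pmf W S * (\<Sum>i\<in>S. c i)\<^sup>2) * (\<integral>\<omega>. ?Y \<omega> \<partial>gw_space W)\<^sup>2"
    unfolding sum_distrib_right
    by (intro sum.cong refl) (simp add: power2_eq_square sum_product sum_distrib_left sum_distrib_right mult_ac)
  finally show ?thesis .
qed

text \<open>Weights at most 1 give A \<le> l < l^2, so in the second moment the part linear in the
  probability of \<open>G\<close> grows more slowly than the squared mean.\<close>

lemma gw_weight_large:
  fixes W :: "'i::finite set pmf"
  assumes c: "\<And>i. 0 \<le> c i" "\<And>i. c i \<le> 1" and lam: "mean_weight W c > 1"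
  obtains \<kappa> where "\<kappa> > 0"
    "\<And>p b. p > 0 \<Longrightarrow> \<exists>n0. \<forall>n\<ge>n0. \<forall>G\<in>sets (gw_space W). p \<le> measure (gw_space W) G \<longrightarrow>
        \<kappa> \<le> measure (gw_space W) {\<omega>. b \<le> gw_weight c G n \<omega>}"
proof -
  interpret gw: prob_space "gw_space W" by (rule prob_space_gw)
  define l where "l = mean_weight W c"
  define A where "A = mean_weight W (\<lambda>i. (c i)\<^sup>2)"
  define B where "B = (\<Sum>S\<in>UNIV. pmf W S * (\<Sum>i\<in>S. c i)\<^sup>2)"
  have l: "l > 1" using lam by (simp add: l_def)
  have "A \<le> l"
    unfolding A_def l_def mean_weight_def power2_eq_square
    using c by (intro sum_mono mult_left_mono mult_left_le) auto
  also have "l < l\<^sup>2" using l by (simp add: power2_eq_square)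
  finally have Al: "A < l\<^sup>2" .
  have A0: "0 \<le> A" unfolding A_def mean_weight_def by (intro sum_nonneg mult_nonneg_nonneg) auto
  have B0: "0 \<le> B" unfolding B_def by (intro sum_nonneg mult_nonneg_nonneg) auto
  \<comment> \<open>\<open>C\<close> solves A C + B = C l^2, so that the bound \<open>second\<close>
    reproduces itself under the recursion for second moments.\<close>
  define C where "C = B / (l\<^sup>2 - A)"
  have C0: "0 \<le> C" using B0 Al by (simp add: C_def)
  have C: "A * C + B = C * l\<^sup>2" using Al by (simp add: C_def field_simps)
  have second: "(\<integral>\<omega>. (gw_weight c G n \<omega>)\<^sup>2 \<partial>gw_space W) \<le> gw.prob G * A ^ n + C * (gw.prob G)\<^sup>2 * (l\<^sup>2) ^ n"
    if G: "G \<in> sets (gw_space W)" for G n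
  proof (induction n)
    case 0
    have "(\<lambda>\<omega>. (indicator G \<omega> :: real)\<^sup>2) = indicator G" by (auto simp: indicator_def)
    then show ?case using G C0 by simp
  next
    case (Suc n)
    have "(\<integral>\<omega>. (gw_weight c G (Suc n) \<omega>)\<^sup>2 \<partial>gw_space W)
       \<le> A * (\<integral>\<omega>. (gw_weight c G n \<omega>)\<^sup>2 \<partial>gw_space W) + B * (gw.prob G * l ^ n)\<^sup>2"
      using second_moment_gw_weight[of c G W n, OF c G] expectation_gw_weight[of c G W n, OF c G]
      by (simp add: A_def B_def l_def)
    also have "\<dots> \<le> A * (gw.prob G * A ^ n + C * (gw.prob G)\<^sup>2 * (l\<^sup>2) ^ n) + B * (gw.prob G * l ^ n)\<^sup>2"
      using Suc A0 by (intro add_right_mono mult_left_mono) auto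
    also have "\<dots> = gw.prob G * A ^ Suc n + (A * C + B) * ((gw.prob G)\<^sup>2 * (l\<^sup>2) ^ n)"
      by (simp add: algebra_simps power_mult_distrib power2_eq_square)
    also have "\<dots> = gw.prob G * A ^ Suc n + C * (gw.prob G)\<^sup>2 * (l\<^sup>2) ^ Suc n"
      unfolding C by simp
    finally show ?case .
  qed
  define \<kappa> where "\<kappa> = 1 / (4 * (1 + C))"
  have "\<exists>n0. \<forall>n\<ge>n0. \<forall>G\<in>sets (gw_space W). p \<le> gw.prob G \<longrightarrow> \<kappa> \<le> gw.prob {\<omega>. b \<le> gw_weight c G n \<omega>}"
    if p: "p > 0" for p b
  proof -
    have "A / l\<^sup>2 < 1" "0 \<le> A / l\<^sup>2" using Al A0 l by auto
    then have "(\<lambda>n. (A / l\<^sup>2) ^ n) \<longlonglongrightarrow> 0" by (intro LIMSEQ_power_zero) auto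
    then have "eventually (\<lambda>n. (A / l\<^sup>2) ^ n < p) sequentially" using p by (rule order_tendstoD)
    moreover have "eventually (\<lambda>n. 2 * b / p \<le> l ^ n) sequentially"
      using filterlim_realpow_sequentially_gt1[of l] l unfolding filterlim_at_infinity_conv_norm_at_top
        filterlim_at_top by auto
    ultimately have "eventually (\<lambda>n. (A / l\<^sup>2) ^ n < p \<and> 2 * b / p \<le> l ^ n) sequentially"
      by eventually_elim simp
    \<comment> \<open>The first condition makes P A^n at most the squared mean; the second makes
      half the mean at least \<open>b\<close>.\<close>
    then obtain n0 where n0: "\<And>n. n \<ge> n0 \<Longrightarrow> (A / l\<^sup>2) ^ n < p" "\<And>n. n \<ge> n0 \<Longrightarrow> 2 * b / p \<le> l ^ n"
      by (auto simp: eventually_sequentially)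
    have "\<kappa> \<le> gw.prob {\<omega>. b \<le> gw_weight c G n \<omega>}"
      if n: "n \<ge> n0" and G: "G \<in> sets (gw_space W)" and Gp: "p \<le> gw.prob G" for n G
    proof -
      let ?P = "gw.prob G" and ?Y = "gw_weight c G n"
      have P: "?P > 0" using p Gp by linarith
      have E: "gw.expectation ?Y = ?P * l ^ n" using expectation_gw_weight[of c, OF c G] by (simp add: l_def)
      have [measurable]: "?Y \<in> borel_measurable (gw_space W)" using G by measurable
      have Yb: "\<bar>?Y \<omega>\<bar> \<le> real (CARD('i)) ^ n" for \<omega>
        using gw_weight_bounds[of c G n \<omega>, OF c] by simp
      have "\<bar>(?Y \<omega>)\<^sup>2\<bar> \<le> (real (CARD('i)) ^ n)\<^sup>2" for \<omega>
        using power_mono[OF Yb[of \<omega>] abs_ge_zero, of 2] by simp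
      then have int: "integrable (gw_space W) ?Y" "integrable (gw_space W) (\<lambda>\<omega>. (?Y \<omega>)\<^sup>2)"
        using Yb by (intro gw.integrable_const_bound[where B = "real (CARD('i)) ^ n"]
            gw.integrable_const_bound[where B = "(real (CARD('i)) ^ n)\<^sup>2"]; simp)+
      have "?P * A ^ n \<le> ?P\<^sup>2 * (l\<^sup>2) ^ n"
      proof -
        have "A ^ n \<le> ?P * (l\<^sup>2) ^ n"
          using n0(1)[OF n] Gp l by (simp add: power_divide divide_less_eq)
            (metis less_le_trans less_imp_le mult_right_mono zero_le_power zero_le_power2)
        then have "?P * A ^ n \<le> ?P * (?P * (l\<^sup>2) ^ n)" using P by (intro mult_left_mono) auto
        then show ?thesis by (simp add: power2_eq_square mult_ac)
      qed
      then have V: "gw.expectation (\<lambda>\<omega>. (?Y \<omega>)\<^sup>2) \<le> (1 + C) * (?P * l ^ n)\<^sup>2"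
        using second[OF G, of n]
        by (simp add: algebra_simps power_mult_distrib power_mult[symmetric])
      have "\<kappa> = (gw.expectation ?Y)\<^sup>2 / (4 * ((1 + C) * (?P * l ^ n)\<^sup>2))"
        unfolding E \<kappa>_def using P l by simp
      also have "\<dots> \<le> gw.prob {\<omega> \<in> space (gw_space W). gw.expectation ?Y / 2 \<le> ?Y \<omega>}"
        using int _ V by (rule gw.paley_zygmund_half) (use P l E in simp)
      also have "\<dots> \<le> gw.prob {\<omega>. b \<le> ?Y \<omega>}"
      proof (rule gw.finite_measure_mono)
        have "2 * b \<le> p * l ^ n" using n0(2)[OF n] p by (simp add: field_simps)
        also have "\<dots> \<le> ?P * l ^ n" using Gp l by (intro mult_right_mono) auto
        finally have "b \<le> gw.expectation ?Y / 2" unfolding E by simp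
        then show "{\<omega> \<in> space (gw_space W). gw.expectation ?Y / 2 \<le> ?Y \<omega>} \<subseteq> {\<omega>. b \<le> ?Y \<omega>}"
          by (auto simp del: field_sum_of_halves)
        have "{\<omega> \<in> space (gw_space W). b \<le> ?Y \<omega>} \<in> sets (gw_space W)" by measurable
        then show "{\<omega>. b \<le> ?Y \<omega>} \<in> gw.events" by simp
      qed
      finally show ?thesis .
    qed
    then show ?thesis by blast
  qed
  moreover have "\<kappa> > 0" using C0 by (simp add: \<kappa>_def)
  ultimately show ?thesis using that by blast
qed

subsection \<open>Transversal families of cylinders\<close>

text \<open>Prescribe the offspring of \<open>\<omega>'\<close> at the ancestors of \<open>U\<close>
  and ask that each subtree rooted in \<open>U\<close> lie in \<open>H\<close>. These requirements
  are independent, so \<open>e\<close> counts the words of \<open>U\<close> and \<open>p\<close>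
  depends on the prescribed offspring alone, uniformly in \<open>H\<close>.\<close>

lemma cylinder_prob_ge:
  fixes W :: "'i::finite set pmf"
  assumes "\<And>a. \<omega>' a \<in> set_pmf W" "U \<subseteq> gw_level \<omega>' k"
  shows "\<exists>p>0. \<exists>e. \<forall>H\<in>sets (gw_space W).
    p * measure (gw_space W) H ^ e \<le> measure (gw_space W) {\<omega>. \<forall>u\<in>U. u \<in> gw_tree \<omega> \<and> below u \<omega> \<in> H}"
  using assms
proof (induction k arbitrary: \<omega>' U)
  case 0
  interpret gw: prob_space "gw_space W" by (rule prob_space_gw)
  consider "U = {}" | "U = {[]}" using 0 by auto
  then show ?case
  proof cases
    case 1
    then show ?thesis by (intro exI[of _ 1] conjI exI[of _ 0]) (auto simp: gw.prob_space[simplified])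
  next
    case 2
    then show ?thesis by (intro exI[of _ 1] conjI exI[of _ 1]) auto
  qed
next
  case (Suc k)
  interpret gw: prob_space "gw_space W" by (rule prob_space_gw)
  define V where "V i = {u. i # u \<in> U}" for i
  define Ev where "Ev H i = {\<omega>. \<forall>u\<in>V i. u \<in> gw_tree \<omega> \<and> below u \<omega> \<in> H}" for H i
  have V: "V i \<subseteq> gw_level (below [i] \<omega>') k" for i
  proof
    fix u assume "u \<in> V i"
    then have "i # u \<in> gw_level \<omega>' (Suc k)" using Suc.prems(2) unfolding V_def by blast
    then show "u \<in> gw_level (below [i] \<omega>') k" unfolding gw_level_Cons by blast
  qed
  have "\<exists>p>0. \<exists>e. \<forall>H\<in>sets (gw_space W). p * gw.prob H ^ e \<le> gw.prob (Ev H i)" for i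
    unfolding Ev_def using Suc.prems(1) by (intro Suc.IH[OF _ V]) (simp add: below_def)
  then obtain p e where pe: "\<And>i. p i > 0"
      "\<And>H i. H \<in> sets (gw_space W) \<Longrightarrow> p i * gw.prob H ^ e i \<le> gw.prob (Ev H i)" by metis
  define q where "q = pmf W (\<omega>' []) * (\<Prod>i\<in>UNIV. p i)"
  have "q > 0" unfolding q_def using pe(1) Suc.prems(1)[of "[]"] by (simp add: pmf_positive prod_pos)
  moreover have "q * gw.prob H ^ (\<Sum>i\<in>UNIV. e i) \<le> gw.prob {\<omega>. \<forall>u\<in>U. u \<in> gw_tree \<omega> \<and> below u \<omega> \<in> H}"
    if H: "H \<in> sets (gw_space W)" for H
  proof -
    have ev: "{\<omega>. \<forall>u\<in>X. u \<in> gw_tree \<omega> \<and> below u \<omega> \<in> H} \<in> sets (gw_space W)"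
      if X: "finite X" for X
    proof -
      have "{\<omega> \<in> space (gw_space W). \<forall>u\<in>X. u \<in> gw_tree \<omega> \<and> below u \<omega> \<in> H} \<in> sets (gw_space W)"
        using X sets.Int[OF sets_gw_tree sets_below[OF H]]
        by (intro sets.sets_Collect_finite_All) (auto simp: Collect_conj_eq[symmetric])
      then show ?thesis by simp
    qed
    have finU: "finite U" by (rule finite_subset[OF Suc.prems(2) finite_gw_level])
    have finV: "finite (V i)" for i by (rule finite_subset[OF V finite_gw_level])
    have Ev: "Ev H i \<in> sets (gw_space W)" for i unfolding Ev_def by (rule ev[OF finV])
    have "q * gw.prob H ^ (\<Sum>i\<in>UNIV. e i) = pmf W (\<omega>' []) * (\<Prod>i\<in>UNIV. p i * gw.prob H ^ e i)"
      by (simp add: q_def prod.distrib power_sum)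
    also have "\<dots> \<le> pmf W (\<omega>' []) * (\<Prod>i\<in>UNIV. gw.prob (Ev H i))"
      using pe H by (intro mult_left_mono prod_mono) (auto intro!: mult_nonneg_nonneg simp: less_imp_le)
    also have "\<dots> = pmf W (\<omega>' []) * (\<Prod>i\<in>UNIV. \<integral>\<omega>. indicator (Ev H i) \<omega> \<partial>gw_space W)"
      using Ev by simp
    also have "\<dots> = (\<integral>\<omega>. indicator {\<omega>' []} (\<omega> []) * (\<Prod>i\<in>UNIV. indicator (Ev H i) (below [i] \<omega>)) \<partial>gw_space W)"
      using Ev by (intro integral_branching[of "\<lambda>i. indicator (Ev H i)" W 1, symmetric])
        (auto simp: indicator_def)
    also have "\<dots> = (\<integral>\<omega>. indicator {\<omega>. \<omega> [] = \<omega>' [] \<and> (\<forall>i. below [i] \<omega> \<in> Ev H i)} \<omega> \<partial>gw_space W)"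
    proof (rule Bochner_Integration.integral_cong)
      fix \<omega> :: "'i list \<Rightarrow> 'i set"
      have "(\<Prod>i\<in>UNIV. indicator (Ev H i) (below [i] \<omega>)) = (if \<forall>i. below [i] \<omega> \<in> Ev H i then 1 else 0 :: real)"
        by (auto simp: indicator_def)
      then show "indicator {\<omega>' []} (\<omega> []) * (\<Prod>i\<in>UNIV. indicator (Ev H i) (below [i] \<omega>))
         = (indicator {\<omega>. \<omega> [] = \<omega>' [] \<and> (\<forall>i. below [i] \<omega> \<in> Ev H i)} \<omega> :: real)"
        by (auto simp: indicator_def)
    qed simp
    also have "\<dots> = gw.prob {\<omega>. \<omega> [] = \<omega>' [] \<and> (\<forall>i. below [i] \<omega> \<in> Ev H i)}"
    proof -
      have "{\<omega> \<in> space (gw_space W). \<omega> [] = \<omega>' []} \<in> sets (gw_space W)"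
        using sets_gw_root[of "[]" "{\<omega>' []}" W] by simp
      moreover have "{\<omega> \<in> space (gw_space W). \<forall>i\<in>UNIV. below [i] \<omega> \<in> Ev H i} \<in> sets (gw_space W)"
        using sets_below[OF Ev] by (intro sets.sets_Collect_finite_All) auto
      ultimately have "{\<omega>. \<omega> [] = \<omega>' []} \<inter> {\<omega>. \<forall>i. below [i] \<omega> \<in> Ev H i} \<in> sets (gw_space W)"
        by (intro sets.Int) auto
      then show ?thesis by (simp add: Collect_conj_eq)
    qed
    also have "\<dots> \<le> gw.prob {\<omega>. \<forall>u\<in>U. u \<in> gw_tree \<omega> \<and> below u \<omega> \<in> H}"
    proof (rule gw.finite_measure_mono[OF _ ev[OF finU]], rule subsetI, rule CollectI, rule ballI)
      fix \<omega> u assume \<omega>: "\<omega> \<in> {\<omega>. \<omega> [] = \<omega>' [] \<and> (\<forall>i. below [i] \<omega> \<in> Ev H i)}" and u: "u \<in> U"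
      obtain i w where iw: "u = i # w"
        using u Suc.prems(2) length_gw_level[of u \<omega>' "Suc k"] by (cases u) auto
      then have "i # w \<in> gw_level \<omega>' (Suc k)" using u Suc.prems(2) by blast
      then have "i \<in> \<omega> []" using \<omega> unfolding gw_level_Cons by auto
      moreover have "w \<in> V i" using u iw by (simp add: V_def)
      then have "w \<in> gw_tree (below [i] \<omega>) \<and> below w (below [i] \<omega>) \<in> H" using \<omega> by (simp add: Ev_def)
      ultimately show "u \<in> gw_tree \<omega> \<and> below u \<omega> \<in> H"
        by (simp add: iw gw_tree_Cons below_below)
    qed
    finally show ?thesis .
  qed
  ultimately show ?case by blast
qed

lemma tree_boundary_case_nat:
  assumes "i \<in> \<omega> []" "j \<in> tree_boundary (gw_tree (below [i] \<omega>))"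
  shows "case_nat i j \<in> tree_boundary (gw_tree \<omega>)"
  unfolding tree_boundary_def
proof (intro CollectI allI)
  fix n
  show "prefix_word (case_nat i j) n \<in> gw_tree \<omega>"
    using assms by (cases n) (auto simp: prefix_word_Suc_case gw_tree_Cons tree_boundary_def)
qed

lemma (in similarity_system) image_gw_fractal_subset:
  assumes "i \<in> \<omega> []"
  shows "\<phi> i ` gw_fractal \<phi> (below [i] \<omega>) \<subseteq> gw_fractal \<phi> \<omega>"
proof
  fix x assume "x \<in> \<phi> i ` gw_fractal \<phi> (below [i] \<omega>)"
  then obtain j where j: "j \<in> tree_boundary (gw_tree (below [i] \<omega>))" "x = \<phi> i (coding_map \<phi> j)"
    by (auto simp: gw_fractal_def)
  then have "x = coding_map \<phi> (case_nat i j)" by (simp add: coding_map_case_nat)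
  then show "x \<in> gw_fractal \<phi> \<omega>"
    using tree_boundary_case_nat[OF assms j(1)] by (auto simp: gw_fractal_def)
qed

lemma expectation_pmf_finite:
  fixes W :: "'i::finite set pmf"
  shows "measure_pmf.expectation W f = (\<Sum>S\<in>UNIV. pmf W S * f S :: real)"
  using integral_measure_pmf_real[of UNIV W f] by (simp add: mult.commute)

lemma admissible_branching:
  assumes "admissible_offspring W"
  obtains S where "S \<in> set_pmf W" "card S \<ge> 2"
proof -
  have "\<exists>S\<in>set_pmf W. card S \<ge> 2"
  proof (rule ccontr)
    assume "\<not> ?thesis"
    then have "pmf W S * real (card S) \<le> pmf W S * 1" for S
      by (cases "S \<in> set_pmf W") (force simp: set_pmf_iff not_le intro!: mult_left_mono)+
    then have "(\<Sum>S\<in>UNIV. pmf W S * real (card S)) \<le> (\<Sum>S\<in>UNIV. pmf W S * 1)"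
      by (intro sum_mono)
    also have "\<dots> = 1" using sum_pmf_eq_1[of UNIV W] by simp
    finally show False using assms by (simp add: admissible_offspring_def expectation_pmf_finite)
  qed
  then show ?thesis using that by blast
qed

text \<open>Two distinct letters of one offspring set carry two trees: the one built so far, whose
  points may lie in a hyperplane, and one whose fractal leaves the pullback of that hyperplane. The
  second exists by non-planarity and can be taken with all offspring in the support, as that holds
  almost surely.\<close>

lemma (in similarity_system) ex_spanning_tree:
  assumes adm: "admissible_offspring W" and np: "non_planar W \<phi>"
  obtains \<omega> P where "\<And>a. \<omega> a \<in> set_pmf W" "finite P" "P \<subseteq> gw_fractal \<phi> \<omega>" "aff_dim P = DIM('a)"
proof -
  obtain S where S: "S \<in> set_pmf W" "card S \<ge> 2" by (rule admissible_branching[OF adm])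
  obtain a b where ab: "a \<in> S" "b \<in> S" "a \<noteq> b"
    using S(2) by (metis card_2_iff' card_le_Suc0_iff_eq finite not_less_eq_eq numeral_2_eq_2)
  \<comment> \<open>Counting the dimension plus 1 lets the induction start from the empty set, of
    affine dimension -1.\<close>
  have "m \<le> DIM('a) + 1 \<Longrightarrow> \<exists>\<omega> P. (\<forall>a. \<omega> a \<in> set_pmf W) \<and> finite P \<and> P \<subseteq> gw_fractal \<phi> \<omega> \<and> int m \<le> aff_dim P + 1" for m
  proof (induction m)
    case 0
    show ?case using S(1) by (intro exI[of _ "\<lambda>_. S"] exI[of _ "{}"]) auto
  next
    case (Suc m)
    then obtain \<omega>1 P where \<omega>1: "\<forall>a. \<omega>1 a \<in> set_pmf W" and P: "finite P" "P \<subseteq> gw_fractal \<phi> \<omega>1" "int m \<le> aff_dim P + 1"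
      by auto
    show ?case
    proof (cases "int (Suc m) \<le> aff_dim P + 1")
      case True
      then show ?thesis using \<omega>1 P by blast
    next
      case False
      have dim: "aff_dim (\<phi> a ` P) = aff_dim P" using aff_dim_word_map[of "[a]" P] by (simp add: word_map_Cons)
      have "aff_dim (affine hull (\<phi> a ` P)) < DIM('a)" using False Suc.prems by (simp add: dim)
      then obtain n t where L: "n \<noteq> 0" "affine hull (\<phi> a ` P) \<subseteq> {x. n \<bullet> x = t}"
        by (rule aff_lowdim_subset_hyperplane)
      then have "{x. n \<bullet> x = t} \<in> affine_hyperplanes" by (auto simp: affine_hyperplanes_def)
      from vimage_word_map_hyperplane[OF this, of "[b]"]
      have "\<phi> b -` {x. n \<bullet> x = t} \<in> affine_hyperplanes" by (simp add: word_map_Cons)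
      then have "\<not> (AE \<omega> in gw_space W. gw_fractal \<phi> \<omega> \<subseteq> \<phi> b -` {x. n \<bullet> x = t})"
        using np unfolding non_planar_def by blast
      moreover have "AE \<omega> in gw_space W. \<forall>a. \<omega> a \<in> set_pmf W"
        unfolding gw_space_def by (rule AE_PiM_pmf_support)
      ultimately obtain \<omega>2 where \<omega>2: "\<forall>a. \<omega>2 a \<in> set_pmf W" "\<not> gw_fractal \<phi> \<omega>2 \<subseteq> \<phi> b -` {x. n \<bullet> x = t}"
        by (metis (no_types, lifting) eventually_mono)
      then obtain y where y: "y \<in> gw_fractal \<phi> \<omega>2" "\<phi> b y \<notin> affine hull (\<phi> a ` P)"
        using L(2) by blast
      define \<omega> where "\<omega> = graft (S, \<lambda>i. if i = a then \<omega>1 else \<omega>2)"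
      have \<omega>: "\<omega> [] = S" "below [a] \<omega> = \<omega>1" "below [b] \<omega> = \<omega>2"
        using ab(3) by (simp_all add: \<omega>_def)
      have "\<forall>v. \<omega> v \<in> set_pmf W"
        using S(1) \<omega>1 \<omega>2(1) by (auto simp: \<omega>_def graft_def split: list.split)
      moreover have "insert (\<phi> b y) (\<phi> a ` P) \<subseteq> gw_fractal \<phi> \<omega>"
        using image_gw_fractal_subset[of a \<omega>] image_gw_fractal_subset[of b \<omega>] ab P(2) y(1) by (auto simp: \<omega>)
      moreover have "int (Suc m) \<le> aff_dim (insert (\<phi> b y) (\<phi> a ` P)) + 1"
        using y(2) P(3) dim by (simp add: aff_dim_insert)
      ultimately show ?thesis using P(1) by (intro exI[of _ \<omega>] exI[of _ "insert (\<phi> b y) (\<phi> a ` P)"]) auto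
    qed
  qed
  from this[of "DIM('a) + 1"] obtain \<omega> P where
    P: "\<forall>a. \<omega> a \<in> set_pmf W" "finite P" "P \<subseteq> gw_fractal \<phi> \<omega>" "int (DIM('a) + 1) \<le> aff_dim P + 1" by blast
  moreover have "aff_dim P = DIM('a)" using P(4) aff_dim_le_DIM[of P] by simp
  ultimately show ?thesis using that by blast
qed

text \<open>The total deviation \<open>f\<close> of \<open>P\<close> in a unit direction is
  continuous and never 0, hence bounded below on the sphere. If all points were within
  \<open>\<epsilon>\<close> of a hyperplane, its unit normal would have deviation below
  \<open>2 * \<epsilon> * card P\<close>, the minimum.\<close>

lemma spanning_set_avoids_hyperplanes:
  fixes P :: "'a::euclidean_space set"
  assumes P: "finite P" "aff_dim P = DIM('a)"
  obtains \<epsilon> where "\<epsilon> > 0" "\<And>L. L \<in> affine_hyperplanes \<Longrightarrow> \<exists>x\<in>P. \<forall>z\<in>L. \<epsilon> \<le> dist x z"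
proof -
  have "P \<noteq> {}" using P(2) by auto
  then obtain x0 where x0: "x0 \<in> P" by blast
  define f where "f a = (\<Sum>x\<in>P. \<bar>a \<bullet> (x - x0)\<bar>)" for a
  have "continuous_on (sphere 0 1) f" unfolding f_def by (intro continuous_intros)
  moreover have "sphere (0::'a) 1 \<noteq> {}" by simp
  ultimately obtain a0 where a0: "a0 \<in> sphere 0 1" "\<And>a. a \<in> sphere 0 1 \<Longrightarrow> f a0 \<le> f a"
    using continuous_attains_inf[OF compact_sphere] by metis
  have pos: "f a0 > 0"
  proof (rule ccontr)
    assume "\<not> f a0 > 0"
    then have "f a0 = 0" unfolding f_def by (meson abs_ge_zero less_eq_real_def not_less sum_nonneg order_antisym)
    then have "\<forall>x\<in>P. a0 \<bullet> (x - x0) = 0" unfolding f_def using P(1) by (simp add: sum_nonneg_eq_0_iff)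
    then have "P \<subseteq> {x. a0 \<bullet> x = a0 \<bullet> x0}" by (auto simp: inner_diff_right)
    then have "aff_dim P \<le> aff_dim {x. a0 \<bullet> x = a0 \<bullet> x0}" by (rule aff_dim_subset)
    moreover have "a0 \<noteq> 0" using a0(1) by auto
    ultimately show False using P(2) by (simp add: aff_dim_hyperplane)
  qed
  have cP: "card P > 0" using P(1) x0 by (auto simp: card_gt_0_iff)
  define \<epsilon> where "\<epsilon> = f a0 / (2 * card P)"
  have \<epsilon>: "\<epsilon> > 0" using pos cP by (simp add: \<epsilon>_def)
  moreover have "\<exists>x\<in>P. \<forall>z\<in>L. \<epsilon> \<le> dist x z" if L: "L \<in> affine_hyperplanes" for L
  proof (rule ccontr)
    assume "\<not> ?thesis"
    then have near: "\<exists>z\<in>L. dist x z < \<epsilon>" if "x \<in> P" for x using that by (meson not_le)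
    obtain a b where ab: "a \<noteq> 0" "L = {x. a \<bullet> x = b}" using L by (auto simp: affine_hyperplanes_def)
    define n where "n = a /\<^sub>R norm a"
    have n: "norm n = 1" using ab(1) by (simp add: n_def)
    have d: "\<bar>n \<bullet> x - b / norm a\<bar> < \<epsilon>" if x: "x \<in> P" for x
    proof -
      obtain z where z: "z \<in> L" "dist x z < \<epsilon>" using near[OF x] by blast
      have "n \<bullet> z = b / norm a" using z(1) by (simp add: ab(2) n_def divide_inverse mult.commute)
      then have "n \<bullet> x - b / norm a = n \<bullet> (x - z)" by (simp add: inner_diff_right)
      then have "\<bar>n \<bullet> x - b / norm a\<bar> \<le> norm n * norm (x - z)" using Cauchy_Schwarz_ineq2[of n "x - z"] by simp
      then show ?thesis using z(2) n by (simp add: dist_norm)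
    qed
    have "f n < (\<Sum>x\<in>P. 2 * \<epsilon>)"
      unfolding f_def using P(1) \<open>P \<noteq> {}\<close>
    proof (rule sum_strict_mono)
      fix x assume "x \<in> P"
      then show "\<bar>n \<bullet> (x - x0)\<bar> < 2 * \<epsilon>"
        using d[of x] d[OF x0] by (simp add: inner_diff_right)
    qed
    also have "\<dots> = f a0" using cP by (simp add: \<epsilon>_def)
    finally show False using a0(2)[of n] n by simp
  qed
  ultimately show ?thesis using that by blast
qed

text \<open>Truncate the codes of a spanning set so far out that each cylinder has diameter below
  half its distance gap; the other half remains as the constant \<open>c\<close>.\<close>

lemma (in similarity_system) ex_transversal_words:
  assumes "admissible_offspring W" "non_planar W \<phi>"
  obtains \<omega> k U c where "\<And>a. \<omega> a \<in> set_pmf W" "U \<subseteq> gw_level \<omega> k" "U \<noteq> {}" "c > 0"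
    "\<And>L. L \<in> affine_hyperplanes \<Longrightarrow> \<exists>u\<in>U. \<forall>y\<in>cyl u. \<forall>z\<in>L. c \<le> dist y z"
proof -
  obtain \<omega> P where P: "\<And>a. \<omega> a \<in> set_pmf W" "finite P" "P \<subseteq> gw_fractal \<phi> \<omega>" "aff_dim P = DIM('a)"
    using ex_spanning_tree[OF assms] by blast
  obtain \<epsilon> where \<epsilon>: "\<epsilon> > 0" "\<And>L. L \<in> affine_hyperplanes \<Longrightarrow> \<exists>x\<in>P. \<forall>z\<in>L. \<epsilon> \<le> dist x z"
    using spanning_set_avoids_hyperplanes[OF P(2,4)] by blast
  have "\<forall>x\<in>P. \<exists>j. j \<in> tree_boundary (gw_tree \<omega>) \<and> x = coding_map \<phi> j"
    using P(3) by (auto simp: gw_fractal_def)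
  then obtain J where J: "\<And>x. x \<in> P \<Longrightarrow> J x \<in> tree_boundary (gw_tree \<omega>)" "\<And>x. x \<in> P \<Longrightarrow> x = coding_map \<phi> (J x)"
    by metis
  obtain k where k: "rmax ^ k < \<epsilon> / (2 * diam)"
    using real_arch_pow_inv[of "\<epsilon> / (2 * diam)" rmax] rmax_less_1 \<epsilon>(1) diam_pos by auto
  let ?U = "(\<lambda>x. prefix_word (J x) k) ` P"
  show ?thesis
  proof (rule that)
    show "?U \<subseteq> gw_level \<omega> k" using J(1) by (auto simp: tree_boundary_def gw_tree_iff)
    show "?U \<noteq> {}" using P(4) by auto
    show "\<epsilon> / 2 > 0" using \<epsilon> by simp
    fix L :: "'a set" assume "L \<in> affine_hyperplanes"
    then obtain x where x: "x \<in> P" "\<And>z. z \<in> L \<Longrightarrow> \<epsilon> \<le> dist x z" using \<epsilon>(2) by blast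
    have "\<epsilon> / 2 \<le> dist y z" if y: "y \<in> cyl (prefix_word (J x) k)" and z: "z \<in> L" for y z
    proof -
      have "dist x y < ratio (prefix_word (J x) k) * diam"
        using coding_map_mem[of "J x" k] J(2)[OF x(1)] y by (intro dist_word_map_K) auto
      also have "\<dots> \<le> rmax ^ k * diam"
        using ratio_le_rmax[of "prefix_word (J x) k"] diam_pos by (intro mult_right_mono) auto
      also have "\<dots> < \<epsilon> / 2" using k diam_pos by (simp add: field_simps)
      finally show ?thesis using x(2)[OF z] dist_triangle[of x z y] by simp
    qed
    then show "\<exists>u\<in>?U. \<forall>y\<in>cyl u. \<forall>z\<in>L. \<epsilon> / 2 \<le> dist y z" using x(1) by blast
  qed (rule P(1))
qed

subsection \<open>Percolation to a robust event\<close>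

lemma gw_weight_mono:
  assumes "G \<subseteq> H" "\<And>i. 0 \<le> c i"
  shows "gw_weight c G n \<omega> \<le> gw_weight c H n \<omega>"
proof (induction n arbitrary: \<omega>)
  case 0
  then show ?case using assms(1) by (auto simp: indicator_def)
next
  case (Suc n)
  then show ?case using assms(2) by (auto intro!: sum_mono mult_left_mono)
qed

text \<open>Every round keeps probability at least \<open>p\<close>, so continuity from above
  applies to the decreasing events. The limit still satisfies the defining property because the
  weight of one generation looks at only finitely many subtrees.\<close>

lemma ex_robust_event:
  fixes W :: "'i::finite set pmf"
  assumes c: "\<And>i. 0 \<le> c i" "\<And>i. c i \<le> 1" and lam: "mean_weight W c > 1"
    and \<omega>': "\<And>a. \<omega>' a \<in> set_pmf W" and U: "U \<subseteq> gw_level \<omega>' k"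
  obtains p where "p > 0" "\<And>b. \<exists>n0. \<forall>n\<ge>n0. \<exists>G\<in>sets (gw_space W). p \<le> measure (gw_space W) G \<and>
      (\<forall>\<omega>\<in>G. \<forall>u\<in>U. u \<in> gw_tree \<omega> \<and> b \<le> gw_weight c G n (below u \<omega>))"
proof -
  interpret gw: prob_space "gw_space W" by (rule prob_space_gw)
  obtain \<kappa> where \<kappa>: "\<kappa> > 0"
    "\<And>p b. p > 0 \<Longrightarrow> \<exists>n0. \<forall>n\<ge>n0. \<forall>G\<in>sets (gw_space W). p \<le> gw.prob G \<longrightarrow>
        \<kappa> \<le> gw.prob {\<omega>. b \<le> gw_weight c G n \<omega>}"
    using gw_weight_large[of c, OF c lam] by blast
  obtain p0 e where p0: "p0 > 0" "\<And>H. H \<in> sets (gw_space W) \<Longrightarrow>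
      p0 * gw.prob H ^ e \<le> gw.prob {\<omega>. \<forall>u\<in>U. u \<in> gw_tree \<omega> \<and> below u \<omega> \<in> H}"
    using cylinder_prob_ge[of \<omega>' W U k, OF \<omega>' U] by blast
  \<comment> \<open>This value is preserved by a round: probability at least \<open>p\<close> gives
    weight at least \<open>b\<close> with probability \<open>\<kappa>\<close>, and the pattern with
    such subtrees has probability at least \<open>p0 * \<kappa> ^ e\<close>. The minimum with 1 is
    for the starting event.\<close>
  define p where "p = min 1 (p0 * \<kappa> ^ e)"
  have p: "p > 0" using \<kappa>(1) p0(1) by (simp add: p_def)
  have "\<exists>n0. \<forall>n\<ge>n0. \<exists>G\<in>sets (gw_space W). p \<le> gw.prob G \<and>
      (\<forall>\<omega>\<in>G. \<forall>u\<in>U. u \<in> gw_tree \<omega> \<and> b \<le> gw_weight c G n (below u \<omega>))" for b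
  proof -
    obtain n0 where n0: "\<And>n G. n \<ge> n0 \<Longrightarrow> G \<in> sets (gw_space W) \<Longrightarrow> p \<le> gw.prob G \<Longrightarrow>
        \<kappa> \<le> gw.prob {\<omega>. b \<le> gw_weight c G n \<omega>}"
      using \<kappa>(2)[OF p, of b] by blast
    have "\<exists>G\<in>sets (gw_space W). p \<le> gw.prob G \<and>
      (\<forall>\<omega>\<in>G. \<forall>u\<in>U. u \<in> gw_tree \<omega> \<and> b \<le> gw_weight c G n (below u \<omega>))" if n: "n \<ge> n0" for n
    proof -
      define step where "step G = {\<omega>. \<forall>u\<in>U. u \<in> gw_tree \<omega> \<and> below u \<omega> \<in> {\<omega>. b \<le> gw_weight c G n \<omega>}}" for G
      define good where "good m = (step ^^ m) UNIV" for m
      have step_mono: "step G \<subseteq> step H" if "G \<subseteq> H" for G H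
        using gw_weight_mono[of G H c n, OF that c(1)] unfolding step_def by (auto intro: order_trans)
      have good_Suc: "good (Suc m) = step (good m)" for m by (simp add: good_def)
      have "good (Suc m) \<subseteq> good m" for m
      proof (induction m)
        case 0
        then show ?case by (simp add: good_def)
      next
        case (Suc m)
        from step_mono[OF this] show ?case by (simp only: good_Suc)
      qed
      then have dec: "decseq good" by (rule decseq_SucI)
      have level_set: "{\<omega>. b \<le> gw_weight c G n \<omega>} \<in> gw.events" if "G \<in> gw.events" for G
      proof -
        have [measurable]: "gw_weight c G n \<in> borel_measurable (gw_space W)" using that by measurable
        have "{\<omega> \<in> space (gw_space W). b \<le> gw_weight c G n \<omega>} \<in> gw.events" by measurable
        then show ?thesis by simp
      qed
      have finU: "finite U" by (rule finite_subset[OF U finite_gw_level])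
      have step_meas: "step G \<in> gw.events" if "G \<in> gw.events" for G
      proof -
        have "{\<omega> \<in> space (gw_space W). \<forall>u\<in>U. u \<in> gw_tree \<omega> \<and> below u \<omega> \<in> {\<omega>. b \<le> gw_weight c G n \<omega>}} \<in> gw.events"
          using finU sets.Int[OF sets_gw_tree sets_below[OF level_set[OF that]]]
          by (intro sets.sets_Collect_finite_All) (auto simp: Collect_conj_eq[symmetric])
        then show ?thesis by (simp add: step_def)
      qed
      have good: "good m \<in> gw.events \<and> p \<le> gw.prob (good m)" for m
      proof (induction m)
        case 0
        then show ?case using sets.top[of "gw_space W"] by (simp add: good_def gw.prob_space[simplified] p_def)
      next
        case (Suc m)
        have "\<kappa> \<le> gw.prob {\<omega>. b \<le> gw_weight c (good m) n \<omega>}" using n0[OF n] Suc by blast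
        then have "p0 * \<kappa> ^ e \<le> p0 * gw.prob {\<omega>. b \<le> gw_weight c (good m) n \<omega>} ^ e"
          using p0(1) \<kappa>(1) by (intro mult_left_mono power_mono) auto
        also have "\<dots> \<le> gw.prob (good (Suc m))"
          unfolding good_Suc step_def using Suc by (intro p0(2) level_set) auto
        finally show ?case using step_meas Suc by (auto simp: good_Suc p_def)
      qed
      define G where "G = (\<Inter>m. good m)"
      have G: "G \<in> gw.events" unfolding G_def using good by (intro sets.countable_INT) auto
      have "(\<lambda>m. gw.prob (good m)) \<longlonglongrightarrow> gw.prob G"
        unfolding G_def using good dec by (intro gw.finite_Lim_measure_decseq) auto
      then have "p \<le> gw.prob G" using good by (intro LIMSEQ_le_const) auto
      moreover have "u \<in> gw_tree \<omega> \<and> b \<le> gw_weight c G n (below u \<omega>)" if "\<omega> \<in> G" "u \<in> U" for \<omega> u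
      proof -
        have st: "\<omega> \<in> step (good m)" for m
          using that(1) good_Suc[of m] unfolding G_def by blast
        let ?\<omega> = "below u \<omega>"
        \<comment> \<open>A subtree outside \<open>G\<close> has left the decreasing sequence from
          index \<open>M w\<close> on. Beyond the largest of these indices over the generation,
          \<open>good m\<close> and \<open>G\<close> select the same words.\<close>
        define M where "M w = (LEAST m. below w ?\<omega> \<notin> good m)" for w
        have M: "below w ?\<omega> \<notin> good (M w)" if "below w ?\<omega> \<notin> G" for w
        proof -
          have "\<exists>m. below w ?\<omega> \<notin> good m" using that by (auto simp: G_def)
          then show ?thesis unfolding M_def by (rule LeastI_ex)
        qed
        define m where "m = Max (insert 0 (M ` gw_level ?\<omega> n))"
        have "below w ?\<omega> \<in> good m \<longleftrightarrow> below w ?\<omega> \<in> G" if w: "w \<in> gw_level ?\<omega> n" for w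
        proof
          assume m: "below w ?\<omega> \<in> good m"
          show "below w ?\<omega> \<in> G"
          proof (rule ccontr)
            assume "below w ?\<omega> \<notin> G"
            then have "below w ?\<omega> \<notin> good (M w)" by (rule M)
            moreover have "M w \<le> m" unfolding m_def using w finite_gw_level by (intro Max_ge) auto
            ultimately show False using m dec by (auto simp: decseq_def)
          qed
        qed (auto simp: G_def)
        then have "{w \<in> gw_level ?\<omega> n. below w ?\<omega> \<in> good m} = {w \<in> gw_level ?\<omega> n. below w ?\<omega> \<in> G}"
          by blast
        then have "gw_weight c (good m) n ?\<omega> = gw_weight c G n ?\<omega>" by (simp add: gw_weight_eq)
        then show ?thesis using st[of m] that(2) by (auto simp: step_def)
      qed
      ultimately show ?thesis using G by blast
    qed
    then show ?thesis by blast
  qed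
  then show ?thesis using that[OF p] by blast
qed

section \<open>Good subtrees in almost every surviving tree\<close>

lemma prob_all_children:
  fixes W :: "'i::finite set pmf"
  assumes A: "A \<in> sets (gw_space W)"
  shows "{\<omega>. \<forall>i\<in>\<omega> []. below [i] \<omega> \<in> A} \<in> sets (gw_space W)" (is ?M)
    and "measure (gw_space W) {\<omega>. \<forall>i\<in>\<omega> []. below [i] \<omega> \<in> A}
      = (\<Sum>S\<in>UNIV. pmf W S * measure (gw_space W) A ^ card S)" (is ?P)
proof -
  interpret gw: prob_space "gw_space W" by (rule prob_space_gw)
  let ?E = "\<lambda>S. {\<omega>. \<omega> [] = S} \<inter> {\<omega>. \<forall>i\<in>S. below [i] \<omega> \<in> A}"
  have E: "?E S \<in> gw.events" for S
  proof (intro sets.Int)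
    show "{\<omega>. \<omega> [] = S} \<in> gw.events" using sets_gw_root[of "[]" "{S}"] by simp
    have "{\<omega> \<in> space (gw_space W). \<forall>i\<in>S. below [i] \<omega> \<in> A} \<in> gw.events"
      using sets_below[OF A] by (intro sets.sets_Collect_finite_All) auto
    then show "{\<omega>. \<forall>i\<in>S. below [i] \<omega> \<in> A} \<in> gw.events" by simp
  qed
  have eq: "{\<omega>. \<forall>i\<in>\<omega> []. below [i] \<omega> \<in> A} = (\<Union>S. ?E S)" by auto
  show ?M unfolding eq using E by (intro sets.finite_UN) auto
  have "gw.prob (?E S) = pmf W S * gw.prob A ^ card S" for S
  proof -
    define X where "X i \<omega> = (if i \<in> S then indicator A \<omega> else 1 :: real)" for i \<omega>
    have "gw.prob (?E S) = (\<integral>\<omega>. indicator (?E S) \<omega> \<partial>gw_space W)" using E by simp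
    also have "\<dots> = (\<integral>\<omega>. indicator {S} (\<omega> []) * (\<Prod>i\<in>UNIV. X i (below [i] \<omega>)) \<partial>gw_space W)"
    proof (intro Bochner_Integration.integral_cong refl)
      fix \<omega> :: "'i list \<Rightarrow> 'i set"
      have "(\<Prod>i\<in>UNIV. X i (below [i] \<omega>)) = (\<Prod>i\<in>S. indicator A (below [i] \<omega>))"
        by (intro prod.mono_neutral_cong_right) (auto simp: X_def)
      also have "\<dots> = (if \<forall>i\<in>S. below [i] \<omega> \<in> A then 1 else 0)"
        by (auto simp: indicator_def)
      finally show "indicator (?E S) \<omega> = indicator {S} (\<omega> []) * (\<Prod>i\<in>UNIV. X i (below [i] \<omega>))"
        by (auto simp: indicator_def)
    qed
    also have "\<dots> = pmf W S * (\<Prod>i\<in>UNIV. \<integral>\<omega>. X i \<omega> \<partial>gw_space W)"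
      using A by (intro integral_branching[where C = 1]) (auto simp: X_def)
    also have "(\<Prod>i\<in>UNIV. \<integral>\<omega>. X i \<omega> \<partial>gw_space W) = (\<Prod>i\<in>S. gw.prob A)"
      using A by (intro prod.mono_neutral_cong_right) (auto simp: X_def gw.prob_space[simplified])
    finally show ?thesis by simp
  qed
  moreover have "gw.prob (\<Union>S. ?E S) = (\<Sum>S\<in>UNIV. gw.prob (?E S))"
    using E by (intro gw.finite_measure_finite_Union) (auto simp: disjoint_family_on_def)
  ultimately show ?P unfolding eq by simp
qed

text \<open>With f the generating function, 1 - f(x) = (1 - x) h(x), where h increases strictly
  because \<open>S0\<close> contributes a linear term. Below 1, f(q) = q means h(q) = 1 and b \<le>
  f(b) means h(b) \<le> 1, which excludes q < b.\<close>

lemma pgf_fixed_point_unique: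
  fixes W :: "'i::finite set pmf"
  assumes S0: "S0 \<in> set_pmf W" "card S0 \<ge> 2"
    and q: "0 \<le> q" "q = (\<Sum>S\<in>UNIV. pmf W S * q ^ card S)"
    and b: "q \<le> b" "b < 1" "b \<le> (\<Sum>S\<in>UNIV. pmf W S * b ^ card S)"
  shows "b = q"
proof (rule ccontr)
  assume "b \<noteq> q"
  with b have qb: "q < b" by simp
  define h where "h x = (\<Sum>S\<in>UNIV. pmf W S * (\<Sum>k<card S. x ^ k))" for x :: real
  have h: "1 - (\<Sum>S\<in>UNIV. pmf W S * x ^ card S) = (1 - x) * h x" for x
  proof -
    have "1 - (\<Sum>S\<in>UNIV. pmf W S * x ^ card S) = (\<Sum>S\<in>UNIV. pmf W S * (1 - x ^ card S))"
      using sum_pmf_eq_1[of UNIV W] by (simp add: right_diff_distrib sum_subtractf)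
    then show ?thesis
      by (simp add: one_diff_power_eq h_def sum_distrib_left mult_ac)
  qed
  have "(1 - q) * h q = (1 - q) * 1" using h[of q] q(2) by simp
  then have "h q = 1" using qb b(2) by simp
  moreover have "(1 - b) * h b \<le> (1 - b) * 1" using h[of b] b(3) by simp
  then have "h b \<le> 1" using b(2) by simp
  moreover have "h q < h b"
    unfolding h_def
  proof (rule sum_strict_mono_ex1)
    have le: "(\<Sum>k<n. q ^ k) \<le> (\<Sum>k<n. b ^ k)" for n
      using q(1) qb by (intro sum_mono power_mono) auto
    show "\<forall>S\<in>UNIV. pmf W S * (\<Sum>k<card S. q ^ k) \<le> pmf W S * (\<Sum>k<card S. b ^ k)"
      using le by (auto intro: mult_left_mono)
    have "(\<Sum>k<card S0. q ^ k) < (\<Sum>k<card S0. b ^ k)"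
    proof (rule sum_strict_mono_ex1)
      show "\<forall>k\<in>{..<card S0}. q ^ k \<le> b ^ k" using q(1) qb by (auto intro: power_mono)
      show "\<exists>k\<in>{..<card S0}. q ^ k < b ^ k" using S0(2) qb by (intro bexI[of _ 1]) auto
    qed simp
    then show "\<exists>S\<in>UNIV. pmf W S * (\<Sum>k<card S. q ^ k) < pmf W S * (\<Sum>k<card S. b ^ k)"
      using S0(1) by (intro bexI[of _ S0]) (auto simp: pmf_positive)
  qed simp
  ultimately show False by simp
qed

lemma gw_level_empty_mono: "gw_level \<omega> m = {} \<Longrightarrow> m \<le> n \<Longrightarrow> gw_level \<omega> n = {}"
  by (induction n) (auto simp: le_Suc_eq)

lemma nonextinct_iff: "nonextinct \<omega> \<longleftrightarrow> (\<exists>i\<in>\<omega> []. nonextinct (below [i] \<omega>))" for \<omega> :: "'i::finite list \<Rightarrow> 'i set"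
proof
  assume ne: "nonextinct \<omega>"
  show "\<exists>i\<in>\<omega> []. nonextinct (below [i] \<omega>)"
  proof (rule ccontr)
    assume "\<not> ?thesis"
    then have "\<forall>i\<in>\<omega> []. \<exists>n. gw_level (below [i] \<omega>) n = {}" by (auto simp: nonextinct_def)
    then obtain g where g: "\<And>i. i \<in> \<omega> [] \<Longrightarrow> gw_level (below [i] \<omega>) (g i) = {}" by metis
    have "gw_level (below [i] \<omega>) (Max (range g)) = {}" if "i \<in> \<omega> []" for i
      by (rule gw_level_empty_mono[OF g[OF that]]) simp
    then have "gw_level \<omega> (Suc (Max (range g))) = {}" unfolding gw_level_Suc by auto
    then show False using ne unfolding nonextinct_def by blast
  qed
next
  assume "\<exists>i\<in>\<omega> []. nonextinct (below [i] \<omega>)"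
  then obtain i where i: "i \<in> \<omega> []" "\<And>n. gw_level (below [i] \<omega>) n \<noteq> {}" by (auto simp: nonextinct_def)
  then have "gw_level \<omega> (Suc n) \<noteq> {}" for n unfolding gw_level_Suc using i(2)[of n] by blast
  then show "nonextinct \<omega>" unfolding nonextinct_def by (metis gw_level_empty_mono le_SucI order_refl)
qed

lemma nonextinct_if_below:
  assumes "v \<in> gw_tree \<omega>" "nonextinct (below v \<omega>)"
  shows "nonextinct \<omega>"
proof -
  have "gw_level \<omega> n \<noteq> {}" for n
  proof
    assume e: "gw_level \<omega> n = {}"
    obtain w where w: "w \<in> gw_level (below v \<omega>) n" using assms(2) by (auto simp: nonextinct_def)
    then have "v @ w \<in> gw_level \<omega> (length v + n)"
      using gw_level_append[of v w \<omega>] assms(1) length_gw_level[OF w] by (simp add: gw_tree_iff)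
    then show False using gw_level_empty_mono[OF e, of "length v + n"] by simp
  qed
  then show ?thesis by (simp add: nonextinct_def)
qed

lemma sets_nonextinct:
  fixes W :: "'i::finite set pmf"
  shows "{\<omega>. nonextinct \<omega>} \<in> sets (gw_space W)"
proof -
  have "{\<omega>. nonextinct \<omega>} = (\<Inter>n. \<Union>w\<in>{w :: 'i list. length w = n}. {\<omega>. w \<in> gw_tree \<omega>})"
    unfolding nonextinct_def gw_tree_iff by (auto dest: length_gw_level)
  also have "\<dots> \<in> sets (gw_space W)"
  proof (rule sets.countable_INT)
    have "(\<Union>w\<in>{w :: 'i list. length w = n}. {\<omega>. w \<in> gw_tree \<omega>}) \<in> sets (gw_space W)" for n
      by (intro sets.finite_UN sets_gw_tree finite_words_length)
    then show "range (\<lambda>n. \<Union>w\<in>{w :: 'i list. length w = n}. {\<omega>. w \<in> gw_tree \<omega>}) \<subseteq> sets (gw_space W)"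
      by blast
  qed simp
  finally show ?thesis .
qed

text \<open>Extinction has a fixed point of the generating function as its probability. Absence of
  good vertices is inherited by the subtrees of the root's offspring and has probability below 1, so
  its probability b satisfies b \<le> f(b). Trees in \<open>G\<close> survive, so the first event
  lies in the second, and the two differ by a null set.\<close>

lemma AE_recurrent_event:
  fixes W :: "'i::finite set pmf"
  assumes adm: "admissible_offspring W" and G: "G \<in> sets (gw_space W)" "measure (gw_space W) G > 0"
    and ne: "\<And>\<omega>. \<omega> \<in> G \<Longrightarrow> nonextinct \<omega>"
  shows "AE \<omega> in gw_space W. nonextinct \<omega> \<longrightarrow> (\<exists>v\<in>gw_tree \<omega>. below v \<omega> \<in> G)"
proof -
  interpret gw: prob_space "gw_space W" by (rule prob_space_gw)
  obtain S0 where S0: "S0 \<in> set_pmf W" "card S0 \<ge> 2" by (rule admissible_branching[OF adm])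
  define B where "B = {\<omega>. \<forall>v\<in>gw_tree \<omega>. below v \<omega> \<notin> G}"
  define X where "X = {\<omega> :: 'i list \<Rightarrow> 'i set. \<not> nonextinct \<omega>}"
  have B: "B \<in> gw.events"
  proof -
    have "{\<omega>. v \<in> gw_tree \<omega> \<longrightarrow> below v \<omega> \<notin> G} \<in> gw.events" for v
    proof -
      have "space (gw_space W) - ({\<omega>. v \<in> gw_tree \<omega>} \<inter> {\<omega>. below v \<omega> \<in> G}) \<in> gw.events"
        by (intro sets.compl_sets sets.Int sets_gw_tree sets_below G)
      moreover have "space (gw_space W) - ({\<omega>. v \<in> gw_tree \<omega>} \<inter> {\<omega>. below v \<omega> \<in> G})
          = {\<omega>. v \<in> gw_tree \<omega> \<longrightarrow> below v \<omega> \<notin> G}" by auto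
      ultimately show ?thesis by simp
    qed
    then have "{\<omega> \<in> space (gw_space W). \<forall>v. v \<in> gw_tree \<omega> \<longrightarrow> below v \<omega> \<notin> G} \<in> gw.events"
      by (intro sets.sets_Collect_countable_All) auto
    then show ?thesis by (simp add: B_def Ball_def)
  qed
  have X: "X \<in> gw.events"
  proof -
    have "space (gw_space W) - {\<omega>. nonextinct \<omega>} \<in> gw.events" by (intro sets.compl_sets sets_nonextinct)
    moreover have "space (gw_space W) - {\<omega>. nonextinct \<omega>} = X" by (auto simp: X_def)
    ultimately show ?thesis by simp
  qed
  have XB: "X \<subseteq> B"
    using nonextinct_if_below ne unfolding X_def B_def by blast
  have "gw.prob B = gw.prob X"
  proof (rule pgf_fixed_point_unique[OF S0])
    have "X = {\<omega>. \<forall>i\<in>\<omega> []. below [i] \<omega> \<in> X}" unfolding X_def using nonextinct_iff by blast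
    then show "gw.prob X = (\<Sum>S\<in>UNIV. pmf W S * gw.prob X ^ card S)"
      using prob_all_children(2)[OF X] by simp
    have "B \<subseteq> {\<omega>. \<forall>i\<in>\<omega> []. below [i] \<omega> \<in> B}"
    proof
      fix \<omega> assume "\<omega> \<in> B"
      then show "\<omega> \<in> {\<omega>. \<forall>i\<in>\<omega> []. below [i] \<omega> \<in> B}"
        by (auto simp: B_def below_below gw_tree_Cons dest: bspec[of _ _ "_ # _"])
    qed
    then show "gw.prob B \<le> (\<Sum>S\<in>UNIV. pmf W S * gw.prob B ^ card S)"
      unfolding prob_all_children(2)[OF B, symmetric] by (intro gw.finite_measure_mono prob_all_children(1) B)
    show "gw.prob X \<le> gw.prob B" using XB B by (rule gw.finite_measure_mono)
    have "B \<subseteq> space (gw_space W) - G" by (auto simp: B_def dest: bspec[of _ _ "[]"])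
    then have "gw.prob B \<le> gw.prob (space (gw_space W) - G)"
      by (intro gw.finite_measure_mono sets.compl_sets G(1))
    also have "\<dots> < 1" using G by (subst gw.prob_compl) auto
    finally show "gw.prob B < 1" .
  qed simp
  then have "gw.prob (B - X) = 0" using XB B X by (simp add: gw.finite_measure_Diff)
  then have "AE \<omega> in gw_space W. \<omega> \<notin> B - X"
    using B X by (intro AE_not_in) (auto simp: null_sets_def gw.emeasure_eq_measure)
  then show ?thesis
    by eventually_elim (auto simp: B_def X_def)
qed

subsection \<open>Regular parts of the fractal\<close>

lemma powr_power_commute: "0 < x \<Longrightarrow> (x ^ n) powr s = (x powr s) ^ n" for x s :: real
  by (induction n) (auto simp: powr_mult)

context similarity_system begin

lemma prod_list_powr: "prod_list (map (\<lambda>i. r i powr s) w) = ratio w powr s"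
  by (induction w) (simp_all add: powr_mult)

lemma gw_fractal_memI:
  assumes "0 < N" "\<And>k. prefix_word j (l + k * N) \<in> gw_tree \<omega>"
  shows "coding_map \<phi> j \<in> gw_fractal \<phi> \<omega>"
proof -
  have "prefix_word j n \<in> gw_tree \<omega>" for n
  proof -
    have "n * 1 \<le> n * N" using assms(1) by (intro mult_le_mono) auto
    then have "prefix_word j (l + n * N) = prefix_word j n @ drop n (prefix_word j (l + n * N))"
      by (metis append_take_drop_id mult.right_neutral take_prefix_word trans_le_add2)
    then show ?thesis using assms(2)[of n] gw_tree_append by metis
  qed
  then show ?thesis by (auto simp: gw_fractal_def tree_boundary_def)
qed

lemma nonextinct_if_gw_fractal_nonempty:
  assumes "gw_fractal \<phi> \<omega> \<noteq> {}"
  shows "nonextinct \<omega>"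
proof -
  obtain j where "\<And>n. prefix_word j n \<in> gw_tree \<omega>"
    using assms by (auto simp: gw_fractal_def tree_boundary_def)
  then have "prefix_word j n \<in> gw_level \<omega> n" for n by (simp add: gw_tree_iff)
  then show ?thesis unfolding nonextinct_def by blast
qed

text \<open>The dimension bound is recorded as nonvanishing of all measures up to \<open>s\<close>.
  It becomes a bound on the infimum \<open>hausdorff_dim\<close> once some Hausdorff measure of the
  fractal is known to vanish.\<close>

definition regular_part :: "real \<Rightarrow> 'a set \<Rightarrow> 'a set \<Rightarrow> bool" where
  "regular_part s E D \<longleftrightarrow> D \<subseteq> E \<and> D \<noteq> {} \<and> hyperplane_diffuse D \<and>
     (open_set_condition \<phi> \<longrightarrow> ahlfors_regular_dim s D \<and> (\<forall>t. 0 \<le> t \<and> t \<le> s \<longrightarrow> hausdorff_measure t D \<noteq> 0))"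

theorem AE_regular_part:
  assumes adm: "admissible_offspring W" and np: "non_planar W \<phi>"
    and s: "0 < s" and lam: "mean_weight W (\<lambda>i. r i powr s) > 1"
  shows "AE \<omega> in gw_space W. nonextinct \<omega> \<longrightarrow> (\<exists>D. regular_part s (gw_fractal \<phi> \<omega>) D)"
proof -
  interpret gw: prob_space "gw_space W" by (rule prob_space_gw)
  define c where "c = (\<lambda>i. r i powr s)"
  have lam_c: "mean_weight W c > 1" using lam by (simp only: c_def)
  have c: "0 \<le> c i" "c i \<le> 1" for i
    using powr_mono2[of s "r i" 1] s r_pos[of i] r_less_1[of i] by (auto simp: c_def)
  obtain \<omega>' k U d where U: "\<And>a. \<omega>' a \<in> set_pmf W" "U \<subseteq> gw_level \<omega>' k" "U \<noteq> {}" "d > 0"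
    "\<And>L. L \<in> affine_hyperplanes \<Longrightarrow> \<exists>u\<in>U. \<forall>y\<in>cyl u. \<forall>z\<in>L. d \<le> dist y z"
    by (rule ex_transversal_words[OF adm np]) (rule that)
  have lenU: "length u = k" if "u \<in> U" for u using that U(2) length_gw_level by blast
  have finU: "finite U" by (rule finite_subset[OF U(2) finite_gw_level])
  obtain p where p: "p > 0" "\<And>b. \<exists>n0. \<forall>n\<ge>n0. \<exists>G\<in>sets (gw_space W). p \<le> gw.prob G \<and>
      (\<forall>\<omega>\<in>G. \<forall>u\<in>U. u \<in> gw_tree \<omega> \<and> b \<le> gw_weight c G n (below u \<omega>))"
    by (rule ex_robust_event[of c W \<omega>' U k, OF c lam_c U(1,2)]) (rule that)
  \<comment> \<open>Below a pattern word of length \<open>k\<close> a weight of at least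
    \<open>b\<close> remains at least 1 after multiplication by \<open>ratio u powr s\<close>, so
    one pattern word alone supplies the weight of a block.\<close>
  define b where "b = 1 / (rmin ^ k) powr s"
  have b: "b > 0" using rmin_pos by (simp add: b_def)
  define M where "M = max 2 (card U)"
  have M: "real M > 0" by (simp add: M_def)
  have rs: "rmax powr s < 1" using powr_less_mono2[of s rmax 1] s rmax_pos rmax_less_1 by simp
  obtain n0 where n0: "\<And>n. n \<ge> n0 \<Longrightarrow> \<exists>G\<in>sets (gw_space W). p \<le> gw.prob G \<and>
      (\<forall>\<omega>\<in>G. \<forall>u\<in>U. u \<in> gw_tree \<omega> \<and> b \<le> gw_weight c G n (below u \<omega>))"
    using p(2)[of b] by blast
  obtain n1 where n1: "(rmax powr s) ^ n1 < 1 / (2 * real M)"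
    using real_arch_pow_inv[of "1 / (2 * real M)" "rmax powr s"] rs M by auto
  \<comment> \<open>The three entries make the block length positive even when \<open>k = 0\<close>,
    provide the robust event, and make words light enough for the transversal family.\<close>
  define n where "n = max 1 (max n0 n1)"
  define N where "N = k + n"
  have N: "0 < N" by (simp add: N_def n_def less_max_iff_disj)
  have small: "real M * (rmax ^ N) powr s \<le> 1 / 2"
  proof -
    have "(rmax ^ N) powr s = (rmax powr s) ^ N" using rmax_pos by (rule powr_power_commute)
    also have "\<dots> \<le> (rmax powr s) ^ n1" using rs by (intro power_decreasing) (auto simp: N_def n_def)
    finally have "(rmax ^ N) powr s \<le> 1 / (2 * real M)" using n1 by linarith
    then have "real M * (rmax ^ N) powr s \<le> real M * (1 / (2 * real M))" using M by (intro mult_left_mono) auto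
    then show ?thesis using M by simp
  qed
  have "n0 \<le> n" by (simp add: n_def le_max_iff_disj)
  then obtain G where G: "G \<in> sets (gw_space W)" "p \<le> gw.prob G"
      "\<And>\<omega> u. \<omega> \<in> G \<Longrightarrow> u \<in> U \<Longrightarrow> u \<in> gw_tree \<omega> \<and> b \<le> gw_weight c G n (below u \<omega>)"
    using n0[of n] by blast
  have "G \<noteq> {}" using G(2) p(1) by auto
  then obtain \<omega>0 where \<omega>0: "\<omega>0 \<in> G" by blast
  define H where "H u \<omega> = {w \<in> gw_level (below u \<omega>) n. below w (below u \<omega>) \<in> G}" for u \<omega>
  define A where "A \<omega> = (\<Union>u\<in>U. (@) u ` H u \<omega>)" for \<omega>
  have wt: "(\<Sum>w\<in>H u \<omega>. ratio w powr s) = gw_weight c G n (below u \<omega>)" for u \<omega>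
    unfolding gw_weight_eq H_def c_def prod_list_powr ..
  have finH: "finite (H u \<omega>)" for u \<omega> by (simp add: H_def finite_gw_level)
  have length_A: "length w = N" if "w \<in> A \<omega>" for w \<omega>
    using that lenU length_gw_level by (auto simp: A_def H_def N_def)
  have A_tree: "w \<in> gw_tree \<omega> \<and> below w \<omega> \<in> G" if \<omega>: "\<omega> \<in> G" and wA: "w \<in> A \<omega>" for w \<omega>
  proof -
    obtain u w' where w: "w = u @ w'" "u \<in> U" "w' \<in> gw_level (below u \<omega>) n" "below w' (below u \<omega>) \<in> G"
      using wA by (auto simp: A_def H_def)
    have "u \<in> gw_tree \<omega>" using G(3)[OF \<omega> w(2)] by blast
    moreover have "w' \<in> gw_tree (below u \<omega>)" using w(3) by (auto simp: gw_tree_def)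
    ultimately show ?thesis using w(4) by (simp add: w(1) gw_tree_append below_below)
  qed
  have transversal: "\<exists>F\<subseteq>A \<omega>. card F \<le> M \<and>
      (\<forall>L\<in>affine_hyperplanes. \<exists>w\<in>F. \<forall>y\<in>cyl w. \<forall>z\<in>L. d \<le> dist y z)" if \<omega>: "\<omega> \<in> G" for \<omega>
  proof -
    have "\<exists>w. w \<in> H u \<omega>" if u: "u \<in> U" for u
    proof (rule ccontr)
      assume "\<not> ?thesis"
      then have "H u \<omega> = {}" by blast
      then show False using G(3)[OF \<omega> u] b unfolding wt[symmetric] by simp
    qed
    then obtain g where g: "\<And>u. u \<in> U \<Longrightarrow> g u \<in> H u \<omega>" by metis
    let ?F = "(\<lambda>u. u @ g u) ` U"
    have "\<exists>w\<in>?F. \<forall>y\<in>cyl w. \<forall>z\<in>L. d \<le> dist y z" if L: "L \<in> affine_hyperplanes" for L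
    proof -
      obtain u where u: "u \<in> U" "\<forall>y\<in>cyl u. \<forall>z\<in>L. d \<le> dist y z" using U(5)[OF L] by blast
      then have "\<forall>y\<in>cyl (u @ g u). \<forall>z\<in>L. d \<le> dist y z"
        using word_map_append_K_subset[of u "g u"] by blast
      then show ?thesis using u(1) by blast
    qed
    moreover have "?F \<subseteq> A \<omega>" using g by (auto simp: A_def)
    moreover have "card ?F \<le> M" using card_image_le[OF finU, of "\<lambda>u. u @ g u"] by (simp add: M_def)
    ultimately show ?thesis by (intro exI[of _ ?F]) auto
  qed
  have large: "1 \<le> (\<Sum>w\<in>A \<omega>. ratio w powr s)" if \<omega>: "\<omega> \<in> G" for \<omega>
  proof -
    obtain u where u: "u \<in> U" using U(3) by blast
    have "1 = (rmin ^ k) powr s * b" using rmin_pos by (simp add: b_def)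
    also have "\<dots> \<le> ratio u powr s * gw_weight c G n (below u \<omega>)"
      using G(3)[OF \<omega> u] b rmin_le_ratio[of u] lenU[OF u] rmin_pos s
      by (intro mult_mono powr_mono2) auto
    also have "\<dots> = (\<Sum>w\<in>(@) u ` H u \<omega>. ratio w powr s)"
      by (subst sum.reindex) (auto simp: inj_on_def wt[symmetric] sum_distrib_left powr_mult)
    also have "\<dots> \<le> (\<Sum>w\<in>A \<omega>. ratio w powr s)"
      using u finU finH by (intro sum_mono2) (auto simp: A_def)
    finally show ?thesis .
  qed
  have main: "\<exists>D. regular_part s (gw_fractal \<phi> \<omega>) D" if v: "v \<in> gw_tree \<omega>" "below v \<omega> \<in> G" for v \<omega>
  proof -
    \<comment> \<open>The selection theorem wants its hypotheses at every word, so words without a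
      good subtree borrow the children of a fixed tree in \<open>G\<close>. Paths starting at a good
      vertex never meet them.\<close>
    define A' where "A' u = (if below u \<omega> \<in> G then A (below u \<omega>) else A \<omega>0)" for u
    have A': "\<exists>\<omega>\<in>G. A' u = A \<omega>" for u using \<omega>0 by (auto simp: A'_def)
    obtain D where D: "D \<noteq> {}" "compact D" "hyperplane_diffuse D"
      "\<And>x. x \<in> D \<Longrightarrow> \<exists>j. x = coding_map \<phi> j \<and>
        (\<forall>k. prefix_word j (length v + k * N) \<in> gw_tree \<omega> \<and> below (prefix_word j (length v + k * N)) \<omega> \<in> G)"
      "open_set_condition \<phi> \<Longrightarrow> ahlfors_regular_dim s D"
      "\<And>t. open_set_condition \<phi> \<Longrightarrow> 0 \<le> t \<Longrightarrow> t \<le> s \<Longrightarrow> hausdorff_measure t D \<noteq> 0"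
    proof (rule subtree_fractal[OF N s U(4), where A = A' and M = M and v = v
          and P = "\<lambda>u. u \<in> gw_tree \<omega> \<and> below u \<omega> \<in> G"])
      show "length w = N" if "w \<in> A' u" for u w using that A'[of u] length_A by auto
      show "\<exists>F\<subseteq>A' u. card F \<le> M \<and>
          (\<forall>L\<in>affine_hyperplanes. \<exists>w\<in>F. \<forall>y\<in>cyl w. \<forall>z\<in>L. d \<le> dist y z)" for u
        using A'[of u] transversal by metis
      show "1 \<le> (\<Sum>w\<in>A' u. ratio w powr s)" for u using A'[of u] large by metis
      show "u @ w \<in> gw_tree \<omega> \<and> below (u @ w) \<omega> \<in> G"
        if "u \<in> gw_tree \<omega> \<and> below u \<omega> \<in> G" "w \<in> A' u" for u w
        using that A_tree[of "below u \<omega>" w] by (simp add: A'_def gw_tree_append below_below)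
    qed (use small v in \<open>auto simp: M_def\<close>)
    have "D \<subseteq> gw_fractal \<phi> \<omega>"
    proof
      fix x assume "x \<in> D"
      from D(4)[OF this] show "x \<in> gw_fractal \<phi> \<omega>" using gw_fractal_memI[OF N] by blast
    qed
    then show ?thesis using D unfolding regular_part_def by blast
  qed
  \<comment> \<open>Applied at the root, the construction shows that a tree in \<open>G\<close> has
    nonempty fractal, hence an infinite branch.\<close>
  have "nonextinct \<omega>" if "\<omega> \<in> G" for \<omega>
  proof -
    have "gw_fractal \<phi> \<omega> \<noteq> {}" using main[of "[]" \<omega>] that unfolding regular_part_def by auto
    then show ?thesis by (rule nonextinct_if_gw_fractal_nonempty)
  qed
  moreover have "gw.prob G > 0" using G(2) p(1) by linarith
  ultimately have "AE \<omega> in gw_space W. nonextinct \<omega> \<longrightarrow> (\<exists>v\<in>gw_tree \<omega>. below v \<omega> \<in> G)"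
    by (intro AE_recurrent_event[OF adm G(1)])
  then show ?thesis
    by eventually_elim (use main in blast)
qed

section \<open>First moment bound on the dimension\<close>

lemma hausdorff_pre_gw_fractal_le:
  assumes "rmax ^ n * diam \<le> \<delta>" "0 \<le> t"
  shows "hausdorff_pre t \<delta> (gw_fractal \<phi> \<omega>) \<le> ennreal (diam powr t * gw_weight (\<lambda>i. r i powr t) UNIV n \<omega>)"
proof -
  let ?L = "gw_level \<omega> n"
  have finL: "finite ?L" by (rule finite_gw_level)
  obtain h where h: "bij_betw h {0..<card ?L} ?L" using ex_bij_betw_nat_finite[OF finL] by blast
  \<comment> \<open>The finite cover by cylinders of generation \<open>n\<close> is continued to a
    sequence by empty sets, which cost nothing because \<open>0 powr t = 0\<close>.\<close>
  define V where "V i = (if i < card ?L then cyl (h i) else {})" for i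
  have bnd: "bounded (V i)" for i
    by (simp add: V_def compact_imp_bounded compact_word_map_K)
  have diamV: "diameter (cyl w) \<le> ratio w * diam" for w
  proof (rule diameter_le)
    show "norm (x - y) \<le> ratio w * diam" if "x \<in> cyl w" "y \<in> cyl w" for x y
      using dist_word_map_K[OF that] by (simp add: dist_norm)
  qed (simp add: K_nonempty)
  have "gw_fractal \<phi> \<omega> \<subseteq> (\<Union>i. V i)"
  proof
    fix x assume "x \<in> gw_fractal \<phi> \<omega>"
    then obtain j where j: "x = coding_map \<phi> j" "prefix_word j n \<in> gw_tree \<omega>"
      by (auto simp: gw_fractal_def tree_boundary_def)
    then have "prefix_word j n \<in> ?L" by (simp add: gw_tree_iff)
    then have "prefix_word j n \<in> h ` {0..<card ?L}" using bij_betw_imp_surj_on[OF h] by simp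
    then obtain i where "i < card ?L" "prefix_word j n = h i" by auto
    then have "x \<in> V i" using coding_map_mem[of j n] by (simp add: V_def j(1))
    then show "x \<in> (\<Union>i. V i)" by blast
  qed
  moreover have "diameter (V i) \<le> \<delta>" for i
  proof (cases "i < card ?L")
    case True
    then have "length (h i) = n" using h length_gw_level by (metis atLeastLessThan_iff bij_betwE zero_le)
    then have "ratio (h i) * diam \<le> rmax ^ n * diam"
      using ratio_le_rmax[of "h i"] diam_pos by (intro mult_right_mono) auto
    then show ?thesis using True diamV[of "h i"] assms(1) by (simp add: V_def)
  next
    case False
    have "0 \<le> rmax ^ n * diam" using rmax_pos diam_pos by simp
    then show ?thesis using False assms(1) by (simp add: V_def)
  qed
  ultimately have "hausdorff_pre t \<delta> (gw_fractal \<phi> \<omega>) \<le> (\<Sum>i. ennreal (diameter (V i) powr t))"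
    unfolding hausdorff_pre_def using bnd by (intro INF_lower) auto
  also have "\<dots> = (\<Sum>i\<in>{0..<card ?L}. ennreal (diameter (V i) powr t))"
    by (rule suminf_finite) (auto simp: V_def)
  also have "\<dots> = (\<Sum>i\<in>{0..<card ?L}. ennreal (diameter (cyl (h i)) powr t))"
    by (intro sum.cong) (auto simp: V_def)
  also have "\<dots> = (\<Sum>w\<in>?L. ennreal (diameter (cyl w) powr t))"
    by (rule sum.reindex_bij_betw[OF h])
  also have "\<dots> \<le> (\<Sum>w\<in>?L. ennreal (diam powr t * ratio w powr t))"
  proof (intro sum_mono ennreal_leI)
    fix w
    have "diameter (cyl w) powr t \<le> (ratio w * diam) powr t"
      using diamV[of w] assms(2) diameter_ge_0[OF compact_imp_bounded[OF compact_word_map_K]]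
      by (intro powr_mono2) auto
    then show "diameter (cyl w) powr t \<le> diam powr t * ratio w powr t"
      using diam_pos by (simp add: powr_mult mult.commute)
  qed
  also have "\<dots> = ennreal (diam powr t * gw_weight (\<lambda>i. r i powr t) UNIV n \<omega>)"
    by (simp add: sum_ennreal gw_weight_eq prod_list_powr sum_distrib_left)
  finally show ?thesis .
qed

text \<open>The expected weights of the generations form a convergent geometric series. Almost
  surely the weights themselves are then summable and tend to 0, and they bound the cost of ever
  finer covers.\<close>

theorem AE_hausdorff_measure_zero:
  assumes t: "0 \<le> t" and lam: "mean_weight W (\<lambda>i. r i powr t) < 1"
  shows "AE \<omega> in gw_space W. hausdorff_measure t (gw_fractal \<phi> \<omega>) = 0"
proof -
  interpret gw: prob_space "gw_space W" by (rule prob_space_gw)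
  define c where "c = (\<lambda>i. r i powr t)"
  have c: "0 \<le> c i" "c i \<le> 1" for i
    using powr_mono2[of t "r i" 1] t r_pos[of i] r_less_1[of i] by (auto simp: c_def)
  let ?Y = "gw_weight c UNIV" let ?l = "mean_weight W c"
  have U: "UNIV \<in> sets (gw_space W)" using sets.top[of "gw_space W"] by simp
  have meas [measurable]: "?Y n \<in> borel_measurable (gw_space W)" for n using U by measurable
  have Y0: "0 \<le> ?Y n \<omega>" "?Y n \<omega> \<le> real CARD('i) ^ n" for n \<omega> using gw_weight_bounds[of c, OF c] by blast+
  have int: "integrable (gw_space W) (?Y n)" for n
    using Y0 by (intro gw.integrable_const_bound[where B = "real CARD('i) ^ n"]) auto
  have E: "(\<integral>\<^sup>+\<omega>. ennreal (?Y n \<omega>) \<partial>gw_space W) = ennreal (?l ^ n)" for n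
    using expectation_gw_weight[of c UNIV W n, OF c U] gw.prob_space
    by (simp add: nn_integral_eq_integral[OF int] Y0)
  have l0: "0 \<le> ?l" unfolding mean_weight_def using c by (auto intro!: sum_nonneg mult_nonneg_nonneg)
  have l1: "?l < 1" using lam by (simp only: c_def)
  have "(\<integral>\<^sup>+\<omega>. (\<Sum>n. ennreal (?Y n \<omega>)) \<partial>gw_space W) = (\<Sum>n. ennreal (?l ^ n))"
    by (subst nn_integral_suminf) (auto simp: E)
  also have "\<dots> \<noteq> \<infinity>"
    using l0 l1 by (subst suminf_ennreal2) (auto simp: summable_geometric)
  finally have "AE \<omega> in gw_space W. (\<Sum>n. ennreal (?Y n \<omega>)) \<noteq> \<infinity>"
    by (intro nn_integral_PInf_AE) auto
  then show ?thesis
  proof eventually_elim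
    case (elim \<omega>)
    have "summable (\<lambda>n. ?Y n \<omega>)" using elim Y0 by (intro summable_suminf_not_top) auto
    then have "(\<lambda>n. ?Y n \<omega>) \<longlonglongrightarrow> 0" by (rule summable_LIMSEQ_zero)
    then have lim: "(\<lambda>n. ennreal (diam powr t * ?Y n \<omega>)) \<longlonglongrightarrow> ennreal (diam powr t * 0)"
      by (intro tendsto_ennrealI tendsto_mult tendsto_const)
    have "hausdorff_pre t \<delta> (gw_fractal \<phi> \<omega>) = 0" if \<delta>: "\<delta> > 0" for \<delta>
    proof -
      have "(\<lambda>n. rmax ^ n * diam) \<longlonglongrightarrow> 0 * diam"
        using rmax_pos rmax_less_1 by (intro tendsto_mult tendsto_const LIMSEQ_power_zero) auto
      then have "eventually (\<lambda>n. rmax ^ n * diam < \<delta>) sequentially"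
        using \<delta> by (intro order_tendstoD(2)) auto
      then have "eventually (\<lambda>n. hausdorff_pre t \<delta> (gw_fractal \<phi> \<omega>) \<le> ennreal (diam powr t * ?Y n \<omega>)) sequentially"
        unfolding c_def by eventually_elim (rule hausdorff_pre_gw_fractal_le, use t in auto)
      then have "hausdorff_pre t \<delta> (gw_fractal \<phi> \<omega>) \<le> ennreal (diam powr t * 0)"
        by (intro tendsto_lowerbound[OF lim]) auto
      then show ?thesis by simp
    qed
    then show ?case unfolding hausdorff_measure_def by (simp add: SUP_constant)
  qed
qed

end

subsection \<open>The critical exponent\<close>

lemma hausdorff_measure_mono:
  assumes "A \<subseteq> B"
  shows "hausdorff_measure t A \<le> hausdorff_measure t B"
proof -
  have "hausdorff_pre t \<delta> A \<le> hausdorff_pre t \<delta> B" for \<delta>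
    unfolding hausdorff_pre_def using assms by (intro INF_superset_mono) auto
  then show ?thesis unfolding hausdorff_measure_def by (intro SUP_mono) auto
qed

lemma hausdorff_dim_le:
  assumes "0 \<le> t" "hausdorff_measure t A = 0"
  shows "hausdorff_dim A \<le> t"
  unfolding hausdorff_dim_def using assms by (intro cInf_lower bdd_belowI[of _ 0]) auto

text \<open>The infimum defining the dimension is only meaningful when some Hausdorff measure vanishes,
  which is what the first assumption of the following two lemmas secures.\<close>

lemma hausdorff_dim_mono:
  assumes "0 \<le> t" "hausdorff_measure t B = 0" "A \<subseteq> B"
  shows "hausdorff_dim A \<le> hausdorff_dim B"
  unfolding hausdorff_dim_def
proof (rule cInf_superset_mono)
  show "{s. 0 \<le> s \<and> hausdorff_measure s B = 0} \<noteq> {}" using assms by blast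
  have "hausdorff_measure s A = 0" if "hausdorff_measure s B = 0" for s
    using hausdorff_measure_mono[OF assms(3), of s] that by simp
  then show "{s. 0 \<le> s \<and> hausdorff_measure s B = 0} \<subseteq> {s. 0 \<le> s \<and> hausdorff_measure s A = 0}" by blast
qed (auto intro: bdd_belowI[of _ 0])

lemma hausdorff_dim_ge:
  assumes "0 \<le> t" "hausdorff_measure t A = 0" "\<And>t. 0 \<le> t \<Longrightarrow> t \<le> s \<Longrightarrow> hausdorff_measure t A \<noteq> 0"
  shows "s \<le> hausdorff_dim A"
  unfolding hausdorff_dim_def
proof (rule cInf_greatest)
  show "{s. 0 \<le> s \<and> hausdorff_measure s A = 0} \<noteq> {}" using assms by blast
  show "s \<le> x" if "x \<in> {s. 0 \<le> s \<and> hausdorff_measure s A = 0}" for x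
    using that assms(3)[of x] by (cases "x \<le> s") auto
qed

text \<open>\<open>g n\<close> is an index where \<open>d\<close> is largest among the first ones,
  so the new sequence is the running maximum. Indices may repeat.\<close>

lemma ex_mono_subsequence_to_sup:
  fixes d lo :: "nat \<Rightarrow> real"
  assumes "\<And>n. lo n \<le> d n" "\<And>n. d n \<le> a" "lo \<longlonglongrightarrow> a"
  obtains g where "incseq (\<lambda>n. d (g n))" "(\<lambda>n. d (g n)) \<longlonglongrightarrow> a"
proof -
  have "\<exists>i\<le>n. \<forall>j\<le>n. d j \<le> d i" for n
  proof -
    have "finite (d ` {..n})" "d ` {..n} \<noteq> {}" by auto
    from Max_in[OF this] obtain i where "i \<le> n" "Max (d ` {..n}) = d i" by (metis atMost_iff imageE)
    then show ?thesis by (metis Max_ge atMost_iff finite_atMost finite_imageI imageI)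
  qed
  then obtain g where g: "\<And>n. g n \<le> n" "\<And>n j. j \<le> n \<Longrightarrow> d j \<le> d (g n)" by metis
  have "incseq (\<lambda>n. d (g n))"
    using g by (intro incseq_SucI) (meson le_SucI)
  moreover have "(\<lambda>n. d (g n)) \<longlonglongrightarrow> a"
  proof (rule tendsto_sandwich[OF _ _ assms(3) tendsto_const])
    show "eventually (\<lambda>n. lo n \<le> d (g n)) sequentially"
      using assms(1) g(2) by (intro always_eventually allI) (meson order_refl order_trans)
    show "eventually (\<lambda>n. d (g n) \<le> a) sequentially" using assms(2) by simp
  qed
  ultimately show ?thesis using that by blast
qed

context similarity_system begin

lemma mean_weight_powr_mono:
  assumes "s \<le> t"
  shows "mean_weight W (\<lambda>i. r i powr t) \<le> rmax powr (t - s) * mean_weight W (\<lambda>i. r i powr s)"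
proof -
  have "r i powr t \<le> rmax powr (t - s) * r i powr s" for i
  proof -
    have "r i powr t = r i powr (t - s) * r i powr s" by (simp add: powr_add[symmetric])
    also have "\<dots> \<le> rmax powr (t - s) * r i powr s"
      using assms r_pos[of i] r_le_rmax[of i] by (intro mult_right_mono powr_mono2) auto
    finally show ?thesis .
  qed
  then have "mean_weight W (\<lambda>i. r i powr t) \<le> (\<Sum>S\<in>UNIV. pmf W S * (\<Sum>i\<in>S. rmax powr (t - s) * r i powr s))"
    unfolding mean_weight_def by (intro sum_mono mult_left_mono) auto
  also have "\<dots> = rmax powr (t - s) * mean_weight W (\<lambda>i. r i powr s)"
    by (simp add: mean_weight_def sum_distrib_left mult_ac)
  finally show ?thesis .
qed

text \<open>At exponent 0 the mean weight is the expected number of offspring, above 1, and raising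
  the exponent by t multiplies it by at most \<open>rmax powr t\<close>. The intermediate value
  theorem gives the crossing and this decay makes it strict.\<close>

lemma ex_critical_exponent:
  assumes "admissible_offspring W"
  obtains \<alpha> where "\<alpha> > 0" "\<And>s. s < \<alpha> \<Longrightarrow> mean_weight W (\<lambda>i. r i powr s) > 1"
    "\<And>s. \<alpha> < s \<Longrightarrow> mean_weight W (\<lambda>i. r i powr s) < 1"
proof -
  define F where "F s = mean_weight W (\<lambda>i. r i powr s)" for s
  have F0: "F 0 > 1"
    using assms r_pos by (simp add: F_def mean_weight_def admissible_offspring_def expectation_pmf_finite less_imp_neq[symmetric])
  have cont: "continuous_on {0..b} F" for b
    unfolding F_def mean_weight_def using r_pos by (intro continuous_intros) (auto simp: less_imp_neq[symmetric])
  have rs: "rmax powr s < 1" if "s > 0" for s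
    using powr_less_mono2[of s rmax 1] that rmax_pos rmax_less_1 by simp
  obtain n where n: "rmax ^ n < 1 / F 0"
    using real_arch_pow_inv[of "1 / F 0" rmax] rmax_less_1 F0 by auto
  have "F (real n) \<le> rmax powr real n * F 0" using mean_weight_powr_mono[of 0 "real n" W] by (simp add: F_def)
  also have "\<dots> < 1" using n F0 rmax_pos by (simp add: powr_realpow field_simps)
  finally have "F (real n) < 1" .
  then obtain \<alpha> where \<alpha>: "0 \<le> \<alpha>" "F \<alpha> = 1"
    using IVT2'[of F "real n" 1 0] F0 cont by auto
  have strict: "F t < F s" if "s < t" "0 < F s" for s t
  proof -
    have "F t \<le> rmax powr (t - s) * F s" using mean_weight_powr_mono[of s t W] that by (simp add: F_def)
    also have "\<dots> < 1 * F s" using rs[of "t - s"] that by (intro mult_strict_right_mono) auto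
    finally show ?thesis by simp
  qed
  show ?thesis
  proof (rule that)
    show "\<alpha> > 0" using \<alpha> F0 by (cases "\<alpha> = 0") auto
    show "mean_weight W (\<lambda>i. r i powr s) > 1" if "s < \<alpha>" for s
    proof -
      \<comment> \<open>Strict decrease needs a positive value at \<open>s\<close>; comparison with
        the value 1 at \<open>\<alpha>\<close> supplies it.\<close>
      have "1 \<le> rmax powr (\<alpha> - s) * F s" using mean_weight_powr_mono[of s \<alpha> W] that \<alpha>(2) by (simp add: F_def)
      then have "0 < F s" using powr_gt_zero[of rmax "\<alpha> - s"] rmax_pos
        by (metis less_le_trans less_numeral_extra(1) zero_less_mult_pos less_irrefl)
      then show ?thesis using strict[OF that] \<alpha>(2) by (simp add: F_def)
    qed
    show "mean_weight W (\<lambda>i. r i powr s) < 1" if "\<alpha> < s" for s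
      using strict[OF that] \<alpha>(2) by (simp add: F_def)
  qed
qed

text \<open>The dimensions of the parts lie between exponents tending to \<open>\<alpha>\<close> and
  the dimension of \<open>E\<close>, which is at most \<open>\<alpha>\<close>; so \<open>E\<close>
  has dimension exactly \<open>\<alpha>\<close>. The parts are unrelated for different
  \<open>n\<close>, and the running maximum makes their dimensions increase.\<close>

lemma regular_parts_exhaust:
  fixes E :: "'a set"
  assumes osc: "open_set_condition \<phi>" and \<alpha>: "\<alpha> > 0"
    and D: "\<And>n::nat. regular_part (\<alpha> * (1 - 1 / (real n + 2))) E (D n)"
    and E: "\<And>n::nat. hausdorff_measure (\<alpha> + 1 / (real n + 1)) E = 0"
  obtains g where "incseq (\<lambda>n. hausdorff_dim (D (g n)))"
    "(\<lambda>n. hausdorff_dim (D (g n))) \<longlonglongrightarrow> hausdorff_dim E"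
proof -
  define lo where "lo n = \<alpha> * (1 - 1 / (real n + 2))" for n
  have pos: "0 \<le> \<alpha> + 1 / (real n + 1)" for n using \<alpha> by simp
  have null: "hausdorff_measure (\<alpha> + 1 / (real 0 + 1)) A = 0" if "A \<subseteq> E" for A
    using hausdorff_measure_mono[OF that, of "\<alpha> + 1 / (real 0 + 1)"] E[of 0] by simp
  have dE: "hausdorff_dim E \<le> \<alpha>"
  proof (rule LIMSEQ_le_const)
    show "(\<lambda>n. \<alpha> + 1 / (real n + 1)) \<longlonglongrightarrow> \<alpha>"
      using tendsto_add[OF tendsto_const LIMSEQ_inverse_real_of_nat, of \<alpha>] by (simp add: inverse_eq_divide add.commute)
    show "\<exists>N. \<forall>n\<ge>N. hausdorff_dim E \<le> \<alpha> + 1 / (real n + 1)"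
      using hausdorff_dim_le[OF pos E] by blast
  qed
  have lo: "lo n \<le> hausdorff_dim (D n)" for n
    using D[of n] osc pos[of 0] null[of "D n"]
    unfolding regular_part_def lo_def by (intro hausdorff_dim_ge[of "\<alpha> + 1 / (real 0 + 1)"]) auto
  have up: "hausdorff_dim (D n) \<le> hausdorff_dim E" for n
    using D[of n] pos[of 0] null[of E]
    unfolding regular_part_def by (intro hausdorff_dim_mono[of "\<alpha> + 1 / (real 0 + 1)"]) auto
  have "(\<lambda>n. 1 / (real n + 2)) \<longlonglongrightarrow> 0"
    using LIMSEQ_ignore_initial_segment[OF LIMSEQ_inverse_real_of_nat, of 1] by (simp add: inverse_eq_divide add.commute)
  then have "(\<lambda>n. \<alpha> * (1 - 1 / (real n + 2))) \<longlonglongrightarrow> \<alpha> * (1 - 0)" by (intro tendsto_intros)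
  then have lim: "lo \<longlonglongrightarrow> \<alpha>" by (simp add: lo_def[abs_def])
  have "\<alpha> \<le> hausdorff_dim E"
    using lim lo up by (intro LIMSEQ_le_const2[OF lim]) (meson order_trans)
  then have "hausdorff_dim E = \<alpha>" using dE by simp
  then show ?thesis
    using ex_mono_subsequence_to_sup[of lo "\<lambda>n. hausdorff_dim (D n)" \<alpha>] lo up lim that by metis
qed

end

theorem theorem1p7:
  fixes \<phi> :: "'i::finite \<Rightarrow> 'a::euclidean_space \<Rightarrow> 'a"
    and W :: "'i set pmf"
  assumes "similarity_ifs \<phi>"
    and "admissible_offspring W"
    and "non_planar W \<phi>"
  shows "(AE \<omega> in gw_space W. nonextinct \<omega> \<longrightarrow>
            (\<exists>D. D \<subseteq> gw_fractal \<phi> \<omega> \<and> D \<noteq> {} \<and> hyperplane_diffuse D))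
       \<and> (open_set_condition \<phi> \<longrightarrow>
          (AE \<omega> in gw_space W. nonextinct \<omega> \<longrightarrow>
            (\<exists>D :: nat \<Rightarrow> 'a set.
               (\<forall>n. D n \<subseteq> gw_fractal \<phi> \<omega> \<and> D n \<noteq> {} \<and>
                    hyperplane_diffuse (D n) \<and> ahlfors_regular (D n)) \<and>
               incseq (\<lambda>n. hausdorff_dim (D n)) \<and>
               (\<lambda>n. hausdorff_dim (D n)) \<longlonglongrightarrow> hausdorff_dim (gw_fractal \<phi> \<omega>))))"
proof -
  obtain r where "\<And>i. 0 < r i \<and> r i < 1 \<and> (\<forall>x y. dist (\<phi> i x) (\<phi> i y) = r i * dist x y)"
    using assms(1) unfolding similarity_ifs_def contracting_similarity_def by metis
  then interpret similarity_system \<phi> r by unfold_locales auto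
  obtain \<alpha> where \<alpha>: "\<alpha> > 0" "\<And>s. s < \<alpha> \<Longrightarrow> mean_weight W (\<lambda>i. r i powr s) > 1"
      "\<And>s. \<alpha> < s \<Longrightarrow> mean_weight W (\<lambda>i. r i powr s) < 1"
    using ex_critical_exponent[OF assms(2)] by blast
  define s where "s n = \<alpha> * (1 - 1 / (real n + 2))" for n
  have s: "0 < s n" "s n < \<alpha>" for n
  proof -
    have "0 < 1 / (real n + 2)" "1 / (real n + 2) < 1" by simp_all
    then have "0 < \<alpha> * (1 - 1 / (real n + 2))" "\<alpha> * (1 - 1 / (real n + 2)) < \<alpha> * 1"
      using \<alpha>(1) by (intro mult_pos_pos mult_strict_left_mono; linarith)+
    then show "0 < s n" "s n < \<alpha>" by (simp_all add: s_def)
  qed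
  \<comment> \<open>Countably many exponents suffice, so one null set serves them all; the parts are
    chosen afterwards, tree by tree.\<close>
  have sub: "AE \<omega> in gw_space W. \<forall>n. nonextinct \<omega> \<longrightarrow> (\<exists>D. regular_part (s n) (gw_fractal \<phi> \<omega>) D)"
    unfolding AE_all_countable using AE_regular_part[OF assms(2,3)] s \<alpha>(2) by blast
  have null: "AE \<omega> in gw_space W. \<forall>n. hausdorff_measure (\<alpha> + 1 / (real n + 1)) (gw_fractal \<phi> \<omega>) = 0"
    unfolding AE_all_countable using \<alpha> by (intro allI AE_hausdorff_measure_zero) auto
  show ?thesis
  proof (intro conjI impI)
    show "AE \<omega> in gw_space W. nonextinct \<omega> \<longrightarrow>
            (\<exists>D. D \<subseteq> gw_fractal \<phi> \<omega> \<and> D \<noteq> {} \<and> hyperplane_diffuse D)"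
      using sub
    proof eventually_elim
      case (elim \<omega>)
      then show ?case unfolding regular_part_def by meson
    qed
    assume osc: "open_set_condition \<phi>"
    show "AE \<omega> in gw_space W. nonextinct \<omega> \<longrightarrow>
            (\<exists>D :: nat \<Rightarrow> 'a set.
               (\<forall>n. D n \<subseteq> gw_fractal \<phi> \<omega> \<and> D n \<noteq> {} \<and>
                    hyperplane_diffuse (D n) \<and> ahlfors_regular (D n)) \<and>
               incseq (\<lambda>n. hausdorff_dim (D n)) \<and>
               (\<lambda>n. hausdorff_dim (D n)) \<longlonglongrightarrow> hausdorff_dim (gw_fractal \<phi> \<omega>))"
      using sub null
    proof eventually_elim
      case (elim \<omega>)
      show ?case
      proof (cases "nonextinct \<omega>")
        case True
        then obtain D where D: "\<And>n. regular_part (s n) (gw_fractal \<phi> \<omega>) (D n)"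
          using elim(1) by metis
        obtain g where g: "incseq (\<lambda>n. hausdorff_dim (D (g n)))"
            "(\<lambda>n. hausdorff_dim (D (g n))) \<longlonglongrightarrow> hausdorff_dim (gw_fractal \<phi> \<omega>)"
          using regular_parts_exhaust[OF osc \<alpha>(1) D[unfolded s_def]] elim(2) by blast
        have "D n \<subseteq> gw_fractal \<phi> \<omega> \<and> D n \<noteq> {} \<and> hyperplane_diffuse (D n) \<and> ahlfors_regular (D n)" for n
          using D[of n] osc s(1)[of n] unfolding regular_part_def ahlfors_regular_def by blast
        then show ?thesis
          using g by (intro impI exI[of _ "\<lambda>n. D (g n)"]) blast
      qed simp
    qed
  qed
qed

end
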